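(* Let $p:\mathbb C\to\mathbb C$ be a holomorphic function whose zero set is smooth and reduced (that is, all zeros of $p$ are simple), and let $$X=\{(u,v,x)\in\mathbb C^3: uv-p(x)=0\}$$ with the action of $T=\mathbb C^*$ given by $t\cdot(u,v,x)=(tu,t^{-1}v,x)$. Then $X^T$ consists of isolated reduced points and hence $X$ is $T$-elliptic.
   Context: $X^T$ is the fixed-point set of the $T$-action on $X$; it is identified with $\{x\in\mathbb C:p(x)=0\}$. A spray on a complex manifold $X$ is a holomorphic map $s:E\to X$ defined on the total space of a holomorphic vector bundle $E$ on $X$ such that $s(0_x)=x$ for all $x\in X$; it is dominating if $s|_{E_x}:E_x\to X$ is a submersion at $0_x$ for all $x\in X$. Given a holomorphic action of a complex Lie group $T$ on $X$, it is a $T$-spray if the action on $X$ lifts to a holomorphic action on $E$ by vector bundle isomorphisms such that both $s$ and the projection $E\to X$ are $T$-equivariant. $X$ is $T$-elliptic if it carries a dominating $T$-spray. *)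

theory Defs
  imports "HOL-Complex_Analysis.Complex_Analysis" "HOL-Algebra.Group"
begin

section \<open>Holomorphic maps between coordinate spaces\<close>

text \<open>
  The dimension of a manifold and the rank of a bundle have to be ordinary numbers, since the
  definition of ellipticity quantifies existentially over bundles of any rank. So the space of
  complex $n$-vectors is modelled, as \<^const>\<open>Euclidean_space\<close> does over the reals, by the sequences
  that vanish from index $n$ on. In particular \<open>Cn k \<subseteq> Cn n\<close> for \<open>k \<le> n\<close>.
\<close>

type_synonym cvec = "nat \<Rightarrow> complex"

definition Cn :: "nat \<Rightarrow> cvec set" where
  "Cn n = {z. \<forall>i\<ge>n. z i = 0}"

definition Cn_topology :: "nat \<Rightarrow> cvec topology" where
  "Cn_topology n = subtopology euclidean (Cn n)"

text \<open>Complex differentiability at \<open>z\<close> of a function of \<open>n\<close> variables; \<open>a i\<close> is the partial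
  derivative in the \<open>i\<close>-th variable.\<close>

definition has_complex_gradient :: "nat \<Rightarrow> (cvec \<Rightarrow> complex) \<Rightarrow> cvec \<Rightarrow> cvec \<Rightarrow> bool" where
  "has_complex_gradient n f a z \<longleftrightarrow>
     ((\<lambda>w. (f w - f z - (\<Sum>i<n. a i * (w i - z i))) /
           of_real (L2_set (\<lambda>i. norm (w i - z i)) {..<n})) \<longlongrightarrow> 0) (at z within Cn n)"

text \<open>Used only for sets \<open>W\<close> that are open in \<open>Cn n\<close>.\<close>

definition holomorphic_Cn :: "nat \<Rightarrow> nat \<Rightarrow> cvec set \<Rightarrow> (cvec \<Rightarrow> cvec) \<Rightarrow> bool" where
  "holomorphic_Cn n m W f \<longleftrightarrow>
     (\<forall>z\<in>W. f z \<in> Cn m \<and> (\<forall>j<m. \<exists>a. has_complex_gradient n (\<lambda>w. f w j) a z))"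

definition has_jacobian :: "nat \<Rightarrow> nat \<Rightarrow> (cvec \<Rightarrow> cvec) \<Rightarrow> (nat \<Rightarrow> nat \<Rightarrow> complex) \<Rightarrow> cvec \<Rightarrow> bool" where
  "has_jacobian n m f J z \<longleftrightarrow> (\<forall>j<m. has_complex_gradient n (\<lambda>w. f w j) (J j) z)"

definition jacobian_map :: "nat \<Rightarrow> nat \<Rightarrow> (nat \<Rightarrow> nat \<Rightarrow> complex) \<Rightarrow> cvec \<Rightarrow> cvec" where
  "jacobian_map n m J h = (\<lambda>j. if j < m then \<Sum>i<n. J j i * h i else 0)"

definition append_vec :: "nat \<Rightarrow> cvec \<Rightarrow> cvec \<Rightarrow> cvec" where
  "append_vec n z w = (\<lambda>i. if i < n then z i else w (i - n))"


section \<open>Complex manifolds\<close>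

type_synonym 'a chart = "'a set \<times> ('a \<Rightarrow> cvec)"

record 'a cmanifold =
  mtop :: "'a topology"
  mdim :: nat
  charts :: "'a chart set"

abbreviation points :: "'a cmanifold \<Rightarrow> 'a set" where
  "points M \<equiv> topspace (mtop M)"

definition is_chart :: "'a topology \<Rightarrow> nat \<Rightarrow> 'a chart \<Rightarrow> bool" where
  "is_chart T n = (\<lambda>(U, \<phi>).
     openin T U \<and> openin (Cn_topology n) (\<phi> ` U) \<and>
     homeomorphic_map (subtopology T U) (subtopology (Cn_topology n) (\<phi> ` U)) \<phi>)"

definition compatible_charts :: "nat \<Rightarrow> 'a chart \<Rightarrow> 'a chart \<Rightarrow> bool" where
  "compatible_charts n = (\<lambda>(U, \<phi>) (V, \<psi>).
     holomorphic_Cn n n (\<phi> ` (U \<inter> V)) (\<lambda>z. \<psi> (inv_into U \<phi> z)) \<and>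
     holomorphic_Cn n n (\<psi> ` (U \<inter> V)) (\<lambda>z. \<phi> (inv_into V \<psi> z)))"

definition complex_manifold :: "'a cmanifold \<Rightarrow> bool" where
  "complex_manifold M \<longleftrightarrow>
     Hausdorff_space (mtop M) \<and> second_countable (mtop M) \<and>
     (\<forall>c\<in>charts M. is_chart (mtop M) (mdim M) c) \<and>
     (\<Union>c\<in>charts M. fst c) = points M \<and>
     (\<forall>c\<in>charts M. \<forall>d\<in>charts M. compatible_charts (mdim M) c d)"

definition maximal_atlas :: "'a cmanifold \<Rightarrow> 'a chart set" where
  "maximal_atlas M =
     {c. is_chart (mtop M) (mdim M) c \<and> (\<forall>d\<in>charts M. compatible_charts (mdim M) c d)}"

definition holomorphic_map :: "'a cmanifold \<Rightarrow> 'b cmanifold \<Rightarrow> ('a \<Rightarrow> 'b) \<Rightarrow> bool" where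
  "holomorphic_map M N f \<longleftrightarrow>
     continuous_map (mtop M) (mtop N) f \<and>
     (\<forall>a\<in>points M. \<exists>(U, \<phi>)\<in>charts M. \<exists>(V, \<psi>)\<in>charts N.
        a \<in> U \<and> f a \<in> V \<and>
        holomorphic_Cn (mdim M) (mdim N) (\<phi> ` {x\<in>U. f x \<in> V}) (\<lambda>z. \<psi> (f (inv_into U \<phi> z))))"

definition biholomorphic :: "'a cmanifold \<Rightarrow> 'b cmanifold \<Rightarrow> ('a \<Rightarrow> 'b) \<Rightarrow> bool" where
  "biholomorphic M N f \<longleftrightarrow>
     holomorphic_map M N f \<and>
     (\<exists>g. holomorphic_map N M g \<and> (\<forall>x\<in>points M. g (f x) = x) \<and> (\<forall>y\<in>points N. f (g y) = y))"

text \<open>Surjectivity of the differential does not depend on the charts in which it is computed.\<close>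

definition submersion_at :: "'a cmanifold \<Rightarrow> 'b cmanifold \<Rightarrow> ('a \<Rightarrow> 'b) \<Rightarrow> 'a \<Rightarrow> bool" where
  "submersion_at M N f a \<longleftrightarrow>
     (\<exists>(U, \<phi>)\<in>charts M. \<exists>(V, \<psi>)\<in>charts N. \<exists>J.
        a \<in> U \<and> f a \<in> V \<and>
        has_jacobian (mdim M) (mdim N) (\<lambda>z. \<psi> (f (inv_into U \<phi> z))) J (\<phi> a) \<and>
        jacobian_map (mdim M) (mdim N) J ` Cn (mdim M) = Cn (mdim N))"

definition complex_space :: "nat \<Rightarrow> cvec cmanifold" where
  "complex_space n = \<lparr>mtop = Cn_topology n, mdim = n, charts = {(Cn n, id)}\<rparr>"

definition complex_line :: "complex cmanifold" where
  "complex_line = \<lparr>mtop = euclidean, mdim = 1, charts = {(UNIV, \<lambda>z i. if i = 0 then z else 0)}\<rparr>"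

definition complex_3space :: "(complex \<times> complex \<times> complex) cmanifold" where
  "complex_3space = \<lparr>mtop = euclidean, mdim = 3,
     charts = {(UNIV, \<lambda>(u, v, x) i. if i = 0 then u else if i = 1 then v else if i = 2 then x else 0)}\<rparr>"

definition open_submanifold :: "'a cmanifold \<Rightarrow> 'a set \<Rightarrow> 'a cmanifold" where
  "open_submanifold M W = \<lparr>mtop = subtopology (mtop M) W, mdim = mdim M,
     charts = (\<lambda>(U, \<phi>). (U \<inter> W, \<phi>)) ` charts M\<rparr>"

definition product_manifold :: "'a cmanifold \<Rightarrow> 'b cmanifold \<Rightarrow> ('a \<times> 'b) cmanifold" where
  "product_manifold M N = \<lparr>mtop = prod_topology (mtop M) (mtop N), mdim = mdim M + mdim N,
     charts = (\<lambda>((U, \<phi>), (V, \<psi>)). (U \<times> V, \<lambda>(a, b). append_vec (mdim M) (\<phi> a) (\<psi> b)))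
                ` (charts M \<times> charts N)\<rparr>"

text \<open>The structure of \<open>k\<close>-dimensional embedded submanifold on \<open>S\<close>, given by restricting to \<open>S\<close> the
  slice charts of \<open>M\<close>. It is a \<^const>\<open>complex_manifold\<close> only if there are slice charts around every
  point of \<open>S\<close>.\<close>

definition embedded_submanifold :: "'a cmanifold \<Rightarrow> nat \<Rightarrow> 'a set \<Rightarrow> 'a cmanifold" where
  "embedded_submanifold M k S = \<lparr>mtop = subtopology (mtop M) S, mdim = k,
     charts = {(U \<inter> S, \<phi>) | U \<phi>. (U, \<phi>) \<in> maximal_atlas M \<and> \<phi> ` (U \<inter> S) = \<phi> ` U \<inter> Cn k}\<rparr>"


section \<open>Complex Lie groups and holomorphic actions\<close>

definition complex_lie_group :: "'t monoid \<Rightarrow> 't cmanifold \<Rightarrow> bool" where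
  "complex_lie_group G L \<longleftrightarrow>
     group G \<and> complex_manifold L \<and> points L = carrier G \<and>
     holomorphic_map (product_manifold L L) L (\<lambda>(s, t). s \<otimes>\<^bsub>G\<^esub> t) \<and>
     holomorphic_map L L (m_inv G)"

definition holomorphic_action ::
  "'t monoid \<Rightarrow> 't cmanifold \<Rightarrow> 'a cmanifold \<Rightarrow> ('t \<Rightarrow> 'a \<Rightarrow> 'a) \<Rightarrow> bool" where
  "holomorphic_action G L X act \<longleftrightarrow>
     complex_lie_group G L \<and> complex_manifold X \<and>
     holomorphic_map (product_manifold L X) X (\<lambda>(t, x). act t x) \<and>
     (\<forall>x\<in>points X. act \<one>\<^bsub>G\<^esub> x = x) \<and>
     (\<forall>s\<in>carrier G. \<forall>t\<in>carrier G. \<forall>x\<in>points X. act (s \<otimes>\<^bsub>G\<^esub> t) x = act s (act t x))"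

definition fixed_points :: "'t monoid \<Rightarrow> 'a cmanifold \<Rightarrow> ('t \<Rightarrow> 'a \<Rightarrow> 'a) \<Rightarrow> 'a set" where
  "fixed_points G X act = {x\<in>points X. \<forall>t\<in>carrier G. act t x = x}"

definition isolated_point :: "'a cmanifold \<Rightarrow> 'a set \<Rightarrow> 'a \<Rightarrow> bool" where
  "isolated_point X F a \<longleftrightarrow> (\<exists>W. openin (mtop X) W \<and> W \<inter> F = {a})"

text \<open>Germs at \<open>a\<close> are represented by functions that are holomorphic near \<open>a\<close>, and equality of
  germs is equality near \<open>a\<close>.\<close>

definition holomorphic_near :: "'a cmanifold \<Rightarrow> 'a \<Rightarrow> ('a \<Rightarrow> complex) \<Rightarrow> bool" where
  "holomorphic_near X a f \<longleftrightarrow>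
     (\<exists>W. openin (mtop X) W \<and> a \<in> W \<and> holomorphic_map (open_submanifold X W) complex_line f)"

text \<open>
  The complex subspace of fixed points is the largest one on which every group element acts as the
  identity, so at a fixed point \<open>a\<close> its ideal in the local ring of \<open>X\<close> is generated by the germs
  \<open>h \<circ> act t - h\<close>. The fixed-point space is reduced at \<open>a\<close> if the quotient of the local ring by this
  ideal has no nilpotents.
\<close>

definition fixed_point_ideal ::
  "'t monoid \<Rightarrow> 'a cmanifold \<Rightarrow> ('t \<Rightarrow> 'a \<Rightarrow> 'a) \<Rightarrow> 'a \<Rightarrow> ('a \<Rightarrow> complex) set" where
  "fixed_point_ideal G X act a =
     {f. holomorphic_near X a f \<and>
        (\<exists>(m::nat) g h t.
           (\<forall>k<m. holomorphic_near X a (g k) \<and> holomorphic_near X a (h k) \<and> t k \<in> carrier G) \<and>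
           (\<exists>W. openin (mtop X) W \<and> a \<in> W \<and>
              (\<forall>x\<in>W. f x = (\<Sum>k<m. g k x * (h k (act (t k) x) - h k x)))))}"

definition reduced_fixed_point ::
  "'t monoid \<Rightarrow> 'a cmanifold \<Rightarrow> ('t \<Rightarrow> 'a \<Rightarrow> 'a) \<Rightarrow> 'a \<Rightarrow> bool" where
  "reduced_fixed_point G X act a \<longleftrightarrow>
     a \<in> fixed_points G X act \<and>
     (\<forall>f n. holomorphic_near X a f \<and> (\<lambda>x. f x ^ n) \<in> fixed_point_ideal G X act a
        \<longrightarrow> f \<in> fixed_point_ideal G X act a)"


section \<open>Holomorphic vector bundles\<close>

record ('a, 'e) vbundle =
  total :: "'e cmanifold"
  bproj :: "'e \<Rightarrow> 'a"
  brank :: nat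
  fzero :: "'a \<Rightarrow> 'e"
  fadd :: "'e \<Rightarrow> 'e \<Rightarrow> 'e"
  fscale :: "complex \<Rightarrow> 'e \<Rightarrow> 'e"

definition fibre :: "('a, 'e) vbundle \<Rightarrow> 'a \<Rightarrow> 'e set" where
  "fibre B x = {e\<in>points (total B). bproj B e = x}"

text \<open>A local trivialisation over \<open>U\<close> is \<open>e \<mapsto> (bproj B e, h e)\<close>.\<close>

definition local_trivialisation ::
  "'a cmanifold \<Rightarrow> ('a, 'e) vbundle \<Rightarrow> 'a set \<Rightarrow> ('e \<Rightarrow> cvec) \<Rightarrow> bool" where
  "local_trivialisation X B U h \<longleftrightarrow>
     openin (mtop X) U \<and>
     biholomorphic (open_submanifold (total B) {e\<in>points (total B). bproj B e \<in> U})
       (product_manifold (open_submanifold X U) (complex_space (brank B)))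
       (\<lambda>e. (bproj B e, h e)) \<and>
     (\<forall>x\<in>U. h (fzero B x) = (\<lambda>i. 0) \<and>
        (\<forall>e\<in>fibre B x. \<forall>e'\<in>fibre B x. h (fadd B e e') = (\<lambda>i. h e i + h e' i)) \<and>
        (\<forall>c. \<forall>e\<in>fibre B x. h (fscale B c e) = (\<lambda>i. c * h e i)))"

text \<open>The vector space axioms in the fibres need not be stated: a local trivialisation maps each
  fibre bijectively onto \<open>Cn (brank B)\<close> and carries the fibre operations to those of vectors.\<close>

definition holomorphic_vector_bundle :: "'a cmanifold \<Rightarrow> ('a, 'e) vbundle \<Rightarrow> bool" where
  "holomorphic_vector_bundle X B \<longleftrightarrow>
     complex_manifold X \<and> complex_manifold (total B) \<and> holomorphic_map (total B) X (bproj B) \<and>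
     (\<forall>x\<in>points X. fzero B x \<in> fibre B x \<and>
        (\<forall>e\<in>fibre B x. \<forall>e'\<in>fibre B x. fadd B e e' \<in> fibre B x) \<and>
        (\<forall>c. \<forall>e\<in>fibre B x. fscale B c e \<in> fibre B x)) \<and>
     (\<forall>x\<in>points X. \<exists>U h. x \<in> U \<and> local_trivialisation X B U h)"

definition fibre_manifold :: "'a cmanifold \<Rightarrow> ('a, 'e) vbundle \<Rightarrow> 'a \<Rightarrow> 'e cmanifold" where
  "fibre_manifold X B x = \<lparr>mtop = subtopology (mtop (total B)) (fibre B x), mdim = brank B,
     charts = {(fibre B x, h) | h. \<exists>U. x \<in> U \<and> local_trivialisation X B U h}\<rparr>"


section \<open>Sprays\<close>

definition spray :: "'a cmanifold \<Rightarrow> ('a, 'e) vbundle \<Rightarrow> ('e \<Rightarrow> 'a) \<Rightarrow> bool" where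
  "spray X B s \<longleftrightarrow>
     holomorphic_vector_bundle X B \<and> holomorphic_map (total B) X s \<and>
     (\<forall>x\<in>points X. s (fzero B x) = x)"

definition dominating_spray :: "'a cmanifold \<Rightarrow> ('a, 'e) vbundle \<Rightarrow> ('e \<Rightarrow> 'a) \<Rightarrow> bool" where
  "dominating_spray X B s \<longleftrightarrow>
     spray X B s \<and> (\<forall>x\<in>points X. submersion_at (fibre_manifold X B x) X s (fzero B x))"

text \<open>In \<open>equivariant_spray\<close>, \<open>\<rho>\<close> is the lift of \<open>act\<close> to the bundle. Each \<open>\<rho> t\<close> is an isomorphism
  because \<open>\<rho>\<close> is an action, with inverse \<open>\<rho>\<close> of the inverse of \<open>t\<close>.\<close>

definition equivariant_spray ::
  "'t monoid \<Rightarrow> 't cmanifold \<Rightarrow> 'a cmanifold \<Rightarrow> ('t \<Rightarrow> 'a \<Rightarrow> 'a) \<Rightarrow>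
   ('a, 'e) vbundle \<Rightarrow> ('t \<Rightarrow> 'e \<Rightarrow> 'e) \<Rightarrow> ('e \<Rightarrow> 'a) \<Rightarrow> bool" where
  "equivariant_spray G L X act B \<rho> s \<longleftrightarrow>
     spray X B s \<and> holomorphic_action G L X act \<and> holomorphic_action G L (total B) \<rho> \<and>
     (\<forall>t\<in>carrier G. \<forall>e\<in>points (total B).
        bproj B (\<rho> t e) = act t (bproj B e) \<and> s (\<rho> t e) = act t (s e)) \<and>
     (\<forall>t\<in>carrier G. \<forall>x\<in>points X.
        (\<forall>e\<in>fibre B x. \<forall>e'\<in>fibre B x. \<rho> t (fadd B e e') = fadd B (\<rho> t e) (\<rho> t e')) \<and>
        (\<forall>c. \<forall>e\<in>fibre B x. \<rho> t (fscale B c e) = fscale B c (\<rho> t e)))"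

text \<open>An existential quantifier cannot range over types, so the type of the points of the total
  space is fixed here. This loses no generality: the total space of a bundle of rank \<open>r\<close> over \<open>X\<close>
  is in bijection over \<open>X\<close> with \<open>points X \<times> Cn r\<close>, and all structure can be transported along such
  a bijection.\<close>

definition equivariantly_elliptic ::
  "'t monoid \<Rightarrow> 't cmanifold \<Rightarrow> 'a cmanifold \<Rightarrow> ('t \<Rightarrow> 'a \<Rightarrow> 'a) \<Rightarrow> bool" where
  "equivariantly_elliptic G L X act \<longleftrightarrow>
     (\<exists>(B :: ('a, 'a \<times> cvec) vbundle) \<rho> s.
        dominating_spray X B s \<and> equivariant_spray G L X act B \<rho> s)"


section \<open>The surface and the torus action\<close>

definition Cstar :: "complex monoid" where
  "Cstar = \<lparr>carrier = UNIV - {0}, mult = (*), one = 1\<rparr>"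

definition Cstar_manifold :: "complex cmanifold" where
  "Cstar_manifold = open_submanifold complex_line (UNIV - {0})"

definition surface :: "(complex \<Rightarrow> complex) \<Rightarrow> (complex \<times> complex \<times> complex) cmanifold" where
  "surface p = embedded_submanifold complex_3space 2 {(u, v, x). u * v - p x = 0}"

definition torus_action :: "complex \<Rightarrow> complex \<times> complex \<times> complex \<Rightarrow> complex \<times> complex \<times> complex" where
  "torus_action t = (\<lambda>(u, v, x). (t * u, inverse t * v, x))"

lemma fixed_points_surface:
  "fixed_points Cstar (surface p) torus_action = (\<lambda>x. (0, 0, x)) ` {x. p x = 0}"
proof (intro Set.set_eqI iffI)
  fix a assume a: "a \<in> fixed_points Cstar (surface p) torus_action"
  obtain u v x where uvx: "a = (u, v, x)" by (cases a) auto
  have pts: "u * v - p x = 0"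
    using a by (simp add: uvx fixed_points_def surface_def embedded_submanifold_def complex_3space_def)
  have "torus_action 2 (u, v, x) = (u, v, x)"
    using a by (simp add: uvx fixed_points_def Cstar_def)
  then have "u = 0" "v = 0" by (simp_all add: torus_action_def)
  with pts show "a \<in> (\<lambda>x. (0, 0, x)) ` {x. p x = 0}" by (simp add: uvx)
next
  fix a assume "a \<in> (\<lambda>x. (0::complex, 0::complex, x)) ` {x. p x = 0}"
  then obtain x where "a = (0, 0, x)" "p x = 0" by blast
  then show "a \<in> fixed_points Cstar (surface p) torus_action"
    by (simp add: fixed_points_def surface_def embedded_submanifold_def complex_3space_def
        torus_action_def)
qed

end

theory Submission
  imports Defs
begin

text \<open>
  Writing \<open>p (x + w) = p x + w q(x, w)\<close>, the complete vector fields \<open>u \<partial>\<^sub>x + p'(x) \<partial>\<^sub>v\<close> and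
  \<open>v \<partial>\<^sub>x + p'(x) \<partial>\<^sub>u\<close> on the surface have the flows
  \<open>(u, v, x) \<mapsto> (u, v + a q(x, a u), x + a u)\<close> and \<open>(u, v, x) \<mapsto> (u + b q(x, b v), v, x + b v)\<close>,
  which are homogeneous of weights \<open>-1\<close> and \<open>1\<close> under the torus. Composing them with the action of
  \<open>exp c\<close> gives an equivariant spray on the trivial bundle of rank 3 with these weights. It is
  dominating: where \<open>u\<close> or \<open>v\<close> is nonzero, one of the two fields and the generator
  \<open>u \<partial>\<^sub>u - v \<partial>\<^sub>v\<close> of the action are independent, and at a fixed point \<open>p'(x) \<noteq> 0\<close> makes the two fields
  independent.

  At a fixed point \<open>u\<close> and \<open>v\<close> are local coordinates on the surface. As weight vectors they lie in
  the fixed point ideal, so by Hadamard's lemma that ideal is the maximal ideal.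
\<close>

section \<open>Complex differentiability on coordinate spaces\<close>

text \<open>Holomorphy in several variables means complex differentiability at each point of an open
  set, not a power series expansion. So dividing a function of two variables by one of them, which
  the coefficient \<open>q(x, w)\<close> and Hadamard's lemma both require, cannot be done term by
  term. Joint differentiability of the quotient where the divisor vanishes is the analytic core, and
  one estimate serves both uses.

  The flows come from solving the equation of the surface. Along the first field \<open>u\<close> is
  constant, so \<open>x\<close> moves linearly to \<open>x + a u\<close>, and
  \<open>u v = p x\<close> forces the increment of \<open>v\<close> to be
  \<open>(p (x + a u) - p x) / u\<close>. This is \<open>a q(x, a u)\<close>, which keeps its
  meaning at \<open>u = 0\<close>. As \<open>x\<close> is invariant under the torus,
  \<open>a u\<close> has to be invariant too, and this dictates the weights of the fibre
  coordinates. The exponential appears because a fibre is a vector space while the torus is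
  not.\<close>

definition hdiff :: "nat \<Rightarrow> (cvec \<Rightarrow> complex) \<Rightarrow> cvec \<Rightarrow> bool" where
  "hdiff n f z \<longleftrightarrow> (\<exists>a. has_complex_gradient n f a z)"

lemma Cn_eqI: "z = w" if "z \<in> Cn n" "w \<in> Cn n" "\<And>i. i < n \<Longrightarrow> z i = w i"
proof
  fix i show "z i = w i" using that by (cases "i < n") (auto simp: Cn_def)
qed

lemma L2_set_pos_Cn:
  assumes "z \<in> Cn n" "w \<in> Cn n" "w \<noteq> z"
  shows "L2_set (\<lambda>i. norm (w i - z i)) {..<n} > 0"
proof -
  have "L2_set (\<lambda>i. norm (w i - z i)) {..<n} \<noteq> 0"
    using assms Cn_eqI[of w n z] by (auto simp: L2_set_eq_0_iff)
  then show ?thesis using L2_set_nonneg[of "\<lambda>i. norm (w i - z i)" "{..<n}"] by linarith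
qed

text \<open>Caratheodory's form of differentiability turns the sum, product and chain rules into
  algebraic identities between the coefficient functions \<open>b\<close>.\<close>

lemma caratheodory_imp_gradient:
  assumes z: "z \<in> Cn n"
    and eq: "\<And>w. w \<in> Cn n \<Longrightarrow> f w = f z + (\<Sum>i<n. b w i * (w i - z i))"
    and lim: "\<And>i. i < n \<Longrightarrow> ((\<lambda>w. b w i) \<longlongrightarrow> a i) (at z within Cn n)"
  shows "has_complex_gradient n f a z"
proof -
  let ?L = "\<lambda>w. L2_set (\<lambda>i. norm (w i - z i)) {..<n}"
  have "((\<lambda>w. \<Sum>i<n. norm (b w i - a i)) \<longlongrightarrow> (\<Sum>i<n. 0)) (at z within Cn n)"
    by (intro tendsto_sum tendsto_norm_zero) (use lim in \<open>auto simp: LIM_zero\<close>)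
  then have lim0: "((\<lambda>w. \<Sum>i<n. norm (b w i - a i)) \<longlongrightarrow> 0) (at z within Cn n)" by simp
  show ?thesis unfolding has_complex_gradient_def
  proof (rule Lim_null_comparison[OF _ lim0], unfold eventually_at_filter, intro always_eventually allI impI)
    fix w assume w: "w \<noteq> z" "w \<in> Cn n"
    have L: "?L w > 0" using L2_set_pos_Cn[OF z w(2,1)] .
    \<comment> \<open>Each \<open>norm (w i - z i)\<close> is at most the Euclidean norm in the
      denominator, so the quotient is dominated by the sum of
      \<open>norm (b w i - a i)\<close>.\<close>
    have "f w - f z - (\<Sum>i<n. a i * (w i - z i)) = (\<Sum>i<n. (b w i - a i) * (w i - z i))"
      using eq[OF w(2)] by (simp add: left_diff_distrib sum_subtractf)
    also have "norm \<dots> \<le> (\<Sum>i<n. norm (b w i - a i) * ?L w)"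
      by (rule sum_norm_le) (auto simp: norm_mult intro!: mult_left_mono member_le_L2_set)
    finally show "norm ((f w - f z - (\<Sum>i<n. a i * (w i - z i))) / of_real (?L w))
        \<le> (\<Sum>i<n. norm (b w i - a i))"
      using L by (simp add: norm_divide field_simps sum_distrib_left)
  qed
qed

lemma gradient_imp_caratheodory:
  assumes z: "z \<in> Cn n" and grad: "has_complex_gradient n f a z"
  obtains b where "\<And>w. w \<in> Cn n \<Longrightarrow> f w = f z + (\<Sum>i<n. b w i * (w i - z i))"
    "\<And>i. i < n \<Longrightarrow> ((\<lambda>w. b w i) \<longlongrightarrow> a i) (at z within Cn n)" "\<And>i. b z i = a i"
proof -
  define L where "L = (\<lambda>w. L2_set (\<lambda>i. norm (w i - z i)) {..<n})"
  define r where "r = (\<lambda>w. f w - f z - (\<Sum>i<n. a i * (w i - z i)))"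
  \<comment> \<open>The remainder is distributed over the coordinates in proportion to
    \<open>cnj (w i - z i)\<close>. As the products \<open>(w i - z i) * cnj (w i - z i)\<close> sum
    to the square of \<open>L w\<close>, the pieces add up to \<open>r w\<close>, and each
    coefficient has norm at most \<open>norm (r w) / L w\<close>, which tends to 0.\<close>
  define b where "b = (\<lambda>w i. a i + (if w = z then 0 else r w * cnj (w i - z i) / (of_real (L w))\<^sup>2))"
  have Lpos: "L w > 0" if "w \<in> Cn n" "w \<noteq> z" for w using L2_set_pos_Cn[OF z that] by (simp add: L_def)
  have Lsq: "(\<Sum>i<n. (w i - z i) * cnj (w i - z i)) = (of_real (L w))\<^sup>2" for w
    by (simp add: L_def L2_set_def sum_nonneg del: complex_cnj_diff
        flip: of_real_power complex_norm_square)
  show thesis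
  proof
    fix w assume w: "w \<in> Cn n"
    show "f w = f z + (\<Sum>i<n. b w i * (w i - z i))"
    proof (cases "w = z")
      case False
      have "(\<Sum>i<n. b w i * (w i - z i)) =
          (\<Sum>i<n. a i * (w i - z i)) + r w * (\<Sum>i<n. (w i - z i) * cnj (w i - z i)) / (of_real (L w))\<^sup>2"
        using False
        by (simp add: b_def distrib_left distrib_right sum.distrib sum_distrib_left sum_divide_distrib mult_ac
            del: complex_cnj_diff)
      then show ?thesis using Lpos[OF w False] by (simp only: Lsq) (simp add: r_def)
    qed (simp add: b_def)
  next
    fix i assume i: "i < n"
    have lim: "((\<lambda>w. r w / of_real (L w)) \<longlongrightarrow> 0) (at z within Cn n)"
      using grad by (simp add: has_complex_gradient_def r_def L_def)
    have "((\<lambda>w. b w i - a i) \<longlongrightarrow> 0) (at z within Cn n)"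
    proof (rule Lim_null_comparison[OF _ tendsto_norm_zero[OF lim]], unfold eventually_at_filter,
        intro always_eventually allI impI)
      fix w assume w: "w \<noteq> z" "w \<in> Cn n"
      have le: "norm (w i - z i) \<le> L w" unfolding L_def
        by (rule member_le_L2_set) (use i in auto)
      have L: "L w > 0" using Lpos w by auto
      have "norm (b w i - a i) = norm (r w) * norm (w i - z i) / (L w)\<^sup>2"
        using w(1) L by (simp add: b_def norm_mult norm_divide norm_power del: complex_cnj_diff)
      also have "\<dots> \<le> norm (r w) * L w / (L w)\<^sup>2"
        by (intro divide_right_mono mult_left_mono le) auto
      also have "\<dots> = norm (r w / of_real (L w))"
        using L by (simp add: norm_divide power2_eq_square)
      finally show "norm (b w i - a i) \<le> norm (r w / of_real (L w))" .
    qed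
    then show "((\<lambda>w. b w i) \<longlongrightarrow> a i) (at z within Cn n)" by (simp add: LIM_zero_iff)
  qed (simp add: b_def)
qed

lemma hdiffE:
  assumes "z \<in> Cn n" "hdiff n f z"
  obtains b where "\<And>w. w \<in> Cn n \<Longrightarrow> f w = f z + (\<Sum>i<n. b w i * (w i - z i))"
    "\<And>i. i < n \<Longrightarrow> continuous (at z within Cn n) (\<lambda>w. b w i)"
proof -
  obtain a where "has_complex_gradient n f a z" using assms(2) by (auto simp: hdiff_def)
  from gradient_imp_caratheodory[OF assms(1) this] obtain b where
    "\<And>w. w \<in> Cn n \<Longrightarrow> f w = f z + (\<Sum>i<n. b w i * (w i - z i))"
    "\<And>i. i < n \<Longrightarrow> ((\<lambda>w. b w i) \<longlongrightarrow> a i) (at z within Cn n)" "\<And>i. b z i = a i"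
    by blast
  then show thesis by (intro that) (auto simp: continuous_within)
qed

lemma hdiffI:
  assumes "z \<in> Cn n" "\<And>w. w \<in> Cn n \<Longrightarrow> f w = f z + (\<Sum>i<n. b w i * (w i - z i))"
    "\<And>i. i < n \<Longrightarrow> continuous (at z within Cn n) (\<lambda>w. b w i)"
  shows "hdiff n f z"
  using caratheodory_imp_gradient[of z n f b "b z"] assms unfolding hdiff_def continuous_within
  by blast

text \<open>The filter \<open>at z within Cn n\<close> omits \<open>z\<close> itself, while the
  difference quotient refers to the value there; hence the two hypotheses.\<close>

lemma has_complex_gradient_cong:
  assumes "eventually (\<lambda>w. f w = g w) (at z within Cn n)" "f z = g z"
  shows "has_complex_gradient n f a z \<longleftrightarrow> has_complex_gradient n g a z"
  unfolding has_complex_gradient_def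
  by (rule filterlim_cong) (use assms in \<open>auto elim!: eventually_mono\<close>)

lemma hdiff_cong:
  assumes "eventually (\<lambda>w. f w = g w) (at z within Cn n)" "f z = g z"
  shows "hdiff n f z \<longleftrightarrow> hdiff n g z"
  using has_complex_gradient_cong[OF assms] by (simp add: hdiff_def)

lemma continuous_coordinate: "continuous (at z within S) (\<lambda>w::cvec. w i)"
  using continuous_on_product_coordinates[of i]
  by (metis UNIV_I continuous_on_eq_continuous_within continuous_within_subset subset_UNIV)

lemma hdiff_imp_continuous:
  assumes "z \<in> Cn n" "hdiff n f z"
  shows "continuous (at z within Cn n) f"
proof -
  obtain b where b: "\<And>w. w \<in> Cn n \<Longrightarrow> f w = f z + (\<Sum>i<n. b w i * (w i - z i))"
    "\<And>i. i < n \<Longrightarrow> continuous (at z within Cn n) (\<lambda>w. b w i)"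
    using hdiffE[OF assms] by blast
  have "continuous (at z within Cn n) (\<lambda>w. f z + (\<Sum>i<n. b w i * (w i - z i)))"
    by (intro continuous_add continuous_const continuous_sum continuous_mult continuous_diff
        b(2) continuous_coordinate) auto
  then have "((\<lambda>w. f z + (\<Sum>i<n. b w i * (w i - z i))) \<longlongrightarrow> f z) (at z within Cn n)"
    by (simp add: continuous_within)
  then show ?thesis unfolding continuous_within
    by (rule Lim_transform_eventually) (simp add: eventually_at_filter b(1)[symmetric])
qed

section \<open>Calculus rules\<close>

lemma hdiff_const: "hdiff n (\<lambda>w. c) z"
  unfolding hdiff_def has_complex_gradient_def
  by (rule exI[of _ "\<lambda>_. 0"]) simp

lemma hdiff_coordinate:
  assumes "z \<in> Cn n" shows "hdiff n (\<lambda>w. w j) z"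
proof (rule hdiffI[where b="\<lambda>w i. if i = j then 1 else 0", OF assms])
  fix w assume "w \<in> Cn n"
  \<comment> \<open>For \<open>j \<ge> n\<close> the coordinate is 0 on all of \<open>Cn n\<close>,
    in agreement with the sum, which then has no term with \<open>i = j\<close>.\<close>
  moreover have "(\<Sum>i<n. (if i = j then 1 else 0) * (w i - z i)) = (if j < n then w j - z j else 0)"
    by (subst if_distrib[of "\<lambda>x. x * _"]) (simp add: sum.delta' cong: if_cong)
  ultimately show "w j = z j + (\<Sum>i<n. (if i = j then 1 else 0) * (w i - z i))"
    using assms by (auto simp: Cn_def)
qed auto

lemma hdiff_add:
  assumes z: "z \<in> Cn n" and "hdiff n f z" "hdiff n g z"
  shows "hdiff n (\<lambda>w. f w + g w) z"
proof -
  obtain b where b: "\<And>w. w \<in> Cn n \<Longrightarrow> f w = f z + (\<Sum>i<n. b w i * (w i - z i))"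
    "\<And>i. i < n \<Longrightarrow> continuous (at z within Cn n) (\<lambda>w. b w i)"
    using hdiffE assms by blast
  obtain c where c: "\<And>w. w \<in> Cn n \<Longrightarrow> g w = g z + (\<Sum>i<n. c w i * (w i - z i))"
    "\<And>i. i < n \<Longrightarrow> continuous (at z within Cn n) (\<lambda>w. c w i)"
    using hdiffE assms by blast
  show ?thesis
  proof (rule hdiffI[where b="\<lambda>w i. b w i + c w i", OF z])
    fix w assume "w \<in> Cn n"
    from b(1)[OF this] c(1)[OF this]
    show "f w + g w = f z + g z + (\<Sum>i<n. (b w i + c w i) * (w i - z i))"
      by (simp add: distrib_right sum.distrib)
  qed (intro continuous_intros b c)
qed

lemma hdiff_mult:
  assumes z: "z \<in> Cn n" and f: "hdiff n f z" and g: "hdiff n g z"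
  shows "hdiff n (\<lambda>w. f w * g w) z"
proof -
  obtain b where b: "\<And>w. w \<in> Cn n \<Longrightarrow> f w = f z + (\<Sum>i<n. b w i * (w i - z i))"
    "\<And>i. i < n \<Longrightarrow> continuous (at z within Cn n) (\<lambda>w. b w i)"
    using hdiffE assms by blast
  obtain c where c: "\<And>w. w \<in> Cn n \<Longrightarrow> g w = g z + (\<Sum>i<n. c w i * (w i - z i))"
    "\<And>i. i < n \<Longrightarrow> continuous (at z within Cn n) (\<lambda>w. c w i)"
    using hdiffE assms by blast
  \<comment> \<open>The coefficients come from \<open>f w * g w - f z * g z = (f w - f z) * g w + f
    z * (g w - g z)\<close>; the factor \<open>g w\<close> is why continuity of \<open>g\<close>
    enters.\<close>
  show ?thesis
  proof (rule hdiffI[where b="\<lambda>w i. b w i * g w + f z * c w i", OF z])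
    fix w assume w: "w \<in> Cn n"
    have "(\<Sum>i<n. (b w i * g w + f z * c w i) * (w i - z i)) =
        (\<Sum>i<n. b w i * (w i - z i)) * g w + f z * (\<Sum>i<n. c w i * (w i - z i))"
      by (simp add: sum_distrib_left sum_distrib_right algebra_simps flip: sum.distrib)
    also have "\<dots> = (f w - f z) * g w + f z * (g w - g z)" using b(1)[OF w] c(1)[OF w] by simp
    finally show "f w * g w = f z * g z + (\<Sum>i<n. (b w i * g w + f z * c w i) * (w i - z i))"
      by (simp add: algebra_simps)
  qed (intro continuous_intros b c hdiff_imp_continuous[OF z g])
qed

text \<open>Serves outer functions of one variable such as \<open>p\<close>, \<open>exp\<close>,
  \<open>inverse\<close> and local inverses of \<open>p\<close>: the Caratheodory coefficient
  \<open>c\<close> of \<open>g\<close> is evaluated along \<open>f\<close> and multiplied into the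
  coefficients of \<open>f\<close>.\<close>

lemma hdiff_field_compose:
  assumes z: "z \<in> Cn n" and f: "hdiff n f z" and g: "g field_differentiable at (f z)"
  shows "hdiff n (\<lambda>w. g (f w)) z"
proof -
  obtain b where b: "\<And>w. w \<in> Cn n \<Longrightarrow> f w = f z + (\<Sum>i<n. b w i * (w i - z i))"
    "\<And>i. i < n \<Longrightarrow> continuous (at z within Cn n) (\<lambda>w. b w i)"
    using hdiffE[OF z f] by blast
  obtain c where c: "\<And>y. g y - g (f z) = c y * (y - f z)" "isCont c (f z)"
    using g unfolding field_differentiable_def DERIV_caratheodory_within CARAT_DERIV by metis
  have "continuous (at z within Cn n) (\<lambda>w. c (f w))"
    by (rule continuous_within_compose3[OF c(2) hdiff_imp_continuous[OF z f]])
  then show ?thesis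
  proof (intro hdiffI[where b="\<lambda>w i. c (f w) * b w i", OF z] continuous_mult b(2))
    fix w assume w: "w \<in> Cn n"
    have "(\<Sum>i<n. c (f w) * b w i * (w i - z i)) = c (f w) * (f w - f z)"
      using b(1)[OF w] by (simp add: sum_distrib_left mult.assoc)
    then show "g (f w) = g (f z) + (\<Sum>i<n. c (f w) * b w i * (w i - z i))"
      by (simp flip: c(1))
  qed auto
qed

text \<open>The type \<open>cvec\<close> carries the product topology, in which convergence is
  coordinatewise.\<close>

lemma continuous_within_coordinatewise:
  fixes g :: "'a::t2_space \<Rightarrow> cvec"
  assumes "\<And>j. continuous (at z within S) (\<lambda>w. g w j)"
  shows "continuous (at z within S) g"
  using assms limitin_componentwise[of "\<lambda>_. euclidean" UNIV g "g z" "at z within S"]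
  by (simp add: continuous_within euclidean_product_topology)

lemma hdiff_compose:
  assumes z: "z \<in> Cn n" and gz: "g z \<in> Cn m"
    and gm: "eventually (\<lambda>w. g w \<in> Cn m) (at z within Cn n)"
    and g: "\<And>j. j < m \<Longrightarrow> hdiff n (\<lambda>w. g w j) z"
    and f: "hdiff m f (g z)"
  shows "hdiff n (\<lambda>w. f (g w)) z"
proof -
  \<comment> \<open>\<open>g\<close> is only known to lie in \<open>Cn m\<close> near
    \<open>z\<close>, and only its first \<open>m\<close> coordinates are known to be
    differentiable. The truncation \<open>h\<close> has neither defect and equals \<open>g\<close>
    near \<open>z\<close>.\<close>
  define h where "h = (\<lambda>w j. if j < m then g w j else 0)"
  have hm: "h w \<in> Cn m" for w by (auto simp: h_def Cn_def)
  have hg: "h w = g w" if "g w \<in> Cn m" for w using that by (auto simp: h_def Cn_def)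
  have h: "\<forall>j. hdiff n (\<lambda>w. h w j) z"
  proof
    fix j show "hdiff n (\<lambda>w. h w j) z"
      by (cases "j < m") (simp_all add: h_def hdiff_const g)
  qed
  have "\<forall>j. \<exists>b. (\<forall>w\<in>Cn n. h w j = h z j + (\<Sum>i<n. b w i * (w i - z i))) \<and>
      (\<forall>i<n. continuous (at z within Cn n) (\<lambda>w. b w i))"
  proof
    fix j
    show "\<exists>b. (\<forall>w\<in>Cn n. h w j = h z j + (\<Sum>i<n. b w i * (w i - z i))) \<and>
      (\<forall>i<n. continuous (at z within Cn n) (\<lambda>w. b w i))"
      by (rule hdiffE[OF z h[rule_format, of j]]) blast
  qed
  then obtain b where b: "\<And>j w. w \<in> Cn n \<Longrightarrow> h w j = h z j + (\<Sum>i<n. b j w i * (w i - z i))"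
    "\<And>j i. i < n \<Longrightarrow> continuous (at z within Cn n) (\<lambda>w. b j w i)" by metis
  obtain c where c: "\<And>w. w \<in> Cn m \<Longrightarrow> f w = f (h z) + (\<Sum>i<m. c w i * (w i - h z i))"
    "\<And>i. i < m \<Longrightarrow> continuous (at (h z) within Cn m) (\<lambda>w. c w i)"
    using hdiffE[OF hm, of f z] f unfolding hg[OF gz] by blast
  have ch: "continuous (at z within Cn n) h"
    by (intro continuous_within_coordinatewise hdiff_imp_continuous[OF z] h[rule_format])
  have "continuous (at z within Cn n) (\<lambda>w. c (h w) j)" if "j < m" for j
    by (rule continuous_within_compose2[OF ch], rule continuous_within_subset[OF c(2)[OF that]])
      (use hm in blast)
  then have "hdiff n (\<lambda>w. f (h w)) z"
  proof (intro hdiffI[where b="\<lambda>w i. \<Sum>j<m. c (h w) j * b j w i", OF z] continuous_sum continuous_mult b(2))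
    fix w assume w: "w \<in> Cn n"
    have "(\<Sum>i<n. (\<Sum>j<m. c (h w) j * b j w i) * (w i - z i)) =
        (\<Sum>j<m. c (h w) j * (\<Sum>i<n. b j w i * (w i - z i)))"
      by (simp add: sum_distrib_left sum_distrib_right mult_ac) (rule sum.swap)
    also have "\<dots> = (\<Sum>j<m. c (h w) j * (h w j - h z j))"
      using b(1)[OF w] by simp
    finally show "f (h w) = f (h z) + (\<Sum>i<n. (\<Sum>j<m. c (h w) j * b j w i) * (w i - z i))"
      using c(1)[OF hm, of w] by simp
  qed auto
  moreover have "eventually (\<lambda>w. f (h w) = f (g w)) (at z within Cn n)"
    using gm by (rule eventually_mono) (simp add: hg)
  ultimately show ?thesis using hdiff_cong[of "\<lambda>w. f (h w)" "\<lambda>w. f (g w)" z n] hg[OF gz] by simp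
qed

text \<open>\<open>Cn k\<close> is a subset of \<open>Cn n\<close>, so restricting to a slice keeps
  the function and only shrinks the filter; the terms from \<open>k\<close> on drop out because both
  \<open>w\<close> and \<open>z\<close> vanish there.\<close>

lemma hdiff_restrict:
  assumes z: "z \<in> Cn k" and "k \<le> n" and f: "hdiff n f z"
  shows "hdiff k f z"
proof -
  have sub: "Cn k \<subseteq> Cn n" using \<open>k \<le> n\<close> by (auto simp: Cn_def)
  obtain b where b: "\<And>w. w \<in> Cn n \<Longrightarrow> f w = f z + (\<Sum>i<n. b w i * (w i - z i))"
    "\<And>i. i < n \<Longrightarrow> continuous (at z within Cn n) (\<lambda>w. b w i)"
    using hdiffE[OF _ f] z sub by blast
  show ?thesis
  proof (rule hdiffI[OF z])
    fix w assume w: "w \<in> Cn k"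
    have "(\<Sum>i<n. b w i * (w i - z i)) = (\<Sum>i<k. b w i * (w i - z i))"
      by (rule sum.mono_neutral_right) (use w z \<open>k \<le> n\<close> in \<open>auto simp: Cn_def\<close>)
    then show "f w = f z + (\<Sum>i<k. b w i * (w i - z i))" using b(1)[of w] w sub by auto
  next
    fix i assume "i < k"
    then show "continuous (at z within Cn k) (\<lambda>w. b w i)"
      using b(2) \<open>k \<le> n\<close> by (intro continuous_within_subset[OF _ sub]) auto
  qed
qed

text \<open>The bridge to one complex variable: it makes jointly differentiable functions separately
  holomorphic, and it lets entries of a Jacobian be read off from derivatives along the
  axes.\<close>

lemma gradient_partial:
  assumes z: "z \<in> Cn n" and f: "has_complex_gradient n f a z" and j: "j < n"
  shows "((\<lambda>t. f (z(j := z j + t))) has_field_derivative a j) (at 0)"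
proof -
  obtain b where b: "\<And>w. w \<in> Cn n \<Longrightarrow> f w = f z + (\<Sum>i<n. b w i * (w i - z i))"
    "\<And>i. i < n \<Longrightarrow> ((\<lambda>w. b w i) \<longlongrightarrow> a i) (at z within Cn n)" "\<And>i. b z i = a i"
    using gradient_imp_caratheodory[OF z f] by blast
  define e where "e = (\<lambda>t. z(j := z j + t))"
  have e: "e t \<in> Cn n" for t using z j by (auto simp: e_def Cn_def)
  have "isCont e 0"
  proof (rule continuous_within_coordinatewise)
    fix i show "isCont (\<lambda>t. e t i) 0"
      by (cases "i = j") (auto simp: e_def intro!: continuous_intros)
  qed
  moreover have "continuous (at z within Cn n) (\<lambda>w. b w j)"
    using b(2)[OF j] b(3) by (simp add: continuous_within)
  then have "continuous (at z within range e) (\<lambda>w. b w j)"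
    by (rule continuous_within_subset) (use e in auto)
  ultimately have "isCont (\<lambda>t. b (e t) j) 0"
    using continuous_within_compose2[of 0 UNIV e "\<lambda>w. b w j"] by (simp add: e_def)
  moreover have "f (e t) - f (e 0) = b (e t) j * t" for t
  proof -
    have "(\<Sum>i<n. b (e t) i * (e t i - z i)) = (\<Sum>i<n. if i = j then b (e t) i * t else 0)"
      by (rule sum.cong) (auto simp: e_def)
    then show ?thesis using b(1)[OF e, of t] j by (simp add: e_def)
  qed
  ultimately have "((\<lambda>t. f (e t)) has_field_derivative a j) (at 0)"
    unfolding CARAT_DERIV by (intro exI[of _ "\<lambda>t. b (e t) j"]) (simp add: e_def b(3))
  then show ?thesis by (simp add: e_def)
qed

section \<open>Differentiable functions on manifolds\<close>

lemma topspace_Cn [simp]: "topspace (Cn_topology n) = Cn n"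
  by (simp add: Cn_topology_def)

lemma
  assumes "is_chart T n (U, \<phi>)"
  shows is_chart_openin: "openin T U"
    and is_chart_subset: "U \<subseteq> topspace T"
    and is_chart_inj: "inj_on \<phi> U"
    and is_chart_image: "\<phi> ` U \<subseteq> Cn n"
    and is_chart_continuous: "continuous_map (subtopology T U) (Cn_topology n) \<phi>"
    and is_chart_open_map: "\<And>A. openin T A \<Longrightarrow> A \<subseteq> U \<Longrightarrow> openin (Cn_topology n) (\<phi> ` A)"
    and is_chart_inv_continuous:
      "continuous_map (subtopology (Cn_topology n) (\<phi> ` U)) T (inv_into U \<phi>)"
proof -
  have U: "openin T U" and im: "openin (Cn_topology n) (\<phi> ` U)"
    and hom: "homeomorphic_map (subtopology T U) (subtopology (Cn_topology n) (\<phi> ` U)) \<phi>"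
    using assms by (auto simp: is_chart_def)
  show "openin T U" "U \<subseteq> topspace T" using U openin_subset by auto
  then have top: "topspace (subtopology T U) = U" by auto
  show inj: "inj_on \<phi> U" using homeomorphic_imp_injective_map[OF hom] top by simp
  show sub: "\<phi> ` U \<subseteq> Cn n" using openin_subset[OF im] by simp
  show "continuous_map (subtopology T U) (Cn_topology n) \<phi>"
    using homeomorphic_imp_continuous_map[OF hom] by (simp add: continuous_map_in_subtopology)
  show "openin (Cn_topology n) (\<phi> ` A)" if "openin T A" "A \<subseteq> U" for A
  proof -
    have "openin (subtopology T U) A" using that U openin_open_subtopology by blast
    then have "openin (subtopology (Cn_topology n) (\<phi> ` U)) (\<phi> ` A)"
      using homeomorphic_imp_open_map[OF hom] by (simp add: open_map_def)
    then show ?thesis using im openin_open_subtopology by blast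
  qed
  obtain g where g: "homeomorphic_maps (subtopology T U) (subtopology (Cn_topology n) (\<phi> ` U)) \<phi> g"
    using hom by (auto simp: homeomorphic_map_maps)
  then have "continuous_map (subtopology (Cn_topology n) (\<phi> ` U)) T g"
    by (auto simp: homeomorphic_maps_def continuous_map_in_subtopology)
  then show "continuous_map (subtopology (Cn_topology n) (\<phi> ` U)) T (inv_into U \<phi>)"
  proof (rule continuous_map_eq)
    fix w assume "w \<in> topspace (subtopology (Cn_topology n) (\<phi> ` U))"
    then obtain x where "x \<in> U" "w = \<phi> x" by auto
    then show "g w = inv_into U \<phi> w" using g top inj by (auto simp: homeomorphic_maps_def)
  qed
qed

lemma is_chartI:
  assumes U: "openin T U" and im: "openin (Cn_topology n) (\<phi> ` U)"
    and \<phi>: "continuous_map (subtopology T U) (Cn_topology n) \<phi>"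
    and g: "continuous_map (subtopology (Cn_topology n) (\<phi> ` U)) T g"
    and inv: "\<And>x. x \<in> U \<Longrightarrow> g (\<phi> x) = x"
  shows "is_chart T n (U, \<phi>)"
proof -
  have "homeomorphic_maps (subtopology T U) (subtopology (Cn_topology n) (\<phi> ` U)) \<phi> g"
    using assms openin_subset[OF U] openin_subset[OF im]
    by (auto simp: homeomorphic_maps_def continuous_map_in_subtopology)
  then show ?thesis using U im homeomorphic_map_maps by (auto simp: is_chart_def)
qed

lemma eventually_at_Cn:
  assumes "openin (Cn_topology n) W" "z \<in> W"
  shows "eventually (\<lambda>w. w \<in> W) (at z within Cn n)"
proof -
  obtain S where "open S" "W = Cn n \<inter> S"
    using assms(1) by (auto simp: Cn_topology_def openin_open)
  then show ?thesis using assms(2) by (auto simp: eventually_at_topological)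
qed

text \<open>Carries a neighbourhood of \<open>x\<close> on the manifold over to the filter at
  \<open>\<phi> x\<close>, so that facts holding near \<open>x\<close> can feed the congruence and
  chain rules for \<open>hdiff\<close>.\<close>

lemma is_chart_eventually:
  assumes c: "is_chart T n (U, \<phi>)" and "openin T A" "x \<in> A" "x \<in> U"
  shows "eventually (\<lambda>w. w \<in> \<phi> ` U \<and> inv_into U \<phi> w \<in> A) (at (\<phi> x) within Cn n)"
proof -
  have "openin (Cn_topology n) (\<phi> ` (A \<inter> U))"
    using is_chart_open_map[OF c] is_chart_openin[OF c] assms(2) by blast
  then have "eventually (\<lambda>w. w \<in> \<phi> ` (A \<inter> U)) (at (\<phi> x) within Cn n)"
    using assms by (intro eventually_at_Cn) auto
  then show ?thesis
    by (rule eventually_mono) (use is_chart_inj[OF c] in auto)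
qed

lemma
  assumes "complex_manifold M"
  shows manifold_is_chart: "c \<in> charts M \<Longrightarrow> is_chart (mtop M) (mdim M) c"
    and charts_subset_atlas: "charts M \<subseteq> maximal_atlas M"
  using assms by (auto simp: complex_manifold_def maximal_atlas_def)

lemma manifold_chart_exists:
  assumes "complex_manifold M" "x \<in> points M"
  shows "\<exists>U \<phi>. (U, \<phi>) \<in> charts M \<and> x \<in> U"
proof -
  have "x \<in> (\<Union>c\<in>charts M. fst c)" using assms by (simp add: complex_manifold_def)
  then show ?thesis by force
qed

text \<open>One chart is asked for, since by \<open>mdiff_imp_hdiff\<close> the others follow. The
  notion is pointwise and names no chart, so maps can be treated as expressions in differentiable
  functions.\<close>

definition mdiff :: "'a cmanifold \<Rightarrow> ('a \<Rightarrow> complex) \<Rightarrow> 'a \<Rightarrow> bool" where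
  "mdiff M f x \<longleftrightarrow>
     (\<exists>(U, \<phi>)\<in>charts M. x \<in> U \<and> hdiff (mdim M) (\<lambda>w. f (inv_into U \<phi> w)) (\<phi> x))"

text \<open>Chain rule for the transition map \<open>g\<close>. The chart \<open>\<psi>\<close> may
  come from the maximal atlas, because submanifolds are cut out by charts that need not belong to
  \<open>charts M\<close>.\<close>

lemma mdiff_imp_hdiff:
  assumes M: "complex_manifold M" and f: "mdiff M f x"
    and V: "(V, \<psi>) \<in> maximal_atlas M" "x \<in> V"
  shows "hdiff (mdim M) (\<lambda>w. f (inv_into V \<psi> w)) (\<psi> x)"
proof -
  let ?n = "mdim M"
  obtain U \<phi> where U: "(U, \<phi>) \<in> charts M" "x \<in> U"
    and f': "hdiff ?n (\<lambda>w. f (inv_into U \<phi> w)) (\<phi> x)"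
    using f by (auto simp: mdiff_def)
  have cU: "is_chart (mtop M) ?n (U, \<phi>)" and cV: "is_chart (mtop M) ?n (V, \<psi>)"
    and comp: "compatible_charts ?n (V, \<psi>) (U, \<phi>)"
    using manifold_is_chart[OF M U(1)] V U(1) by (auto simp: maximal_atlas_def)
  define g where "g = (\<lambda>w. \<phi> (inv_into V \<psi> w))"
  have gx: "g (\<psi> x) = \<phi> x" using V is_chart_inj[OF cV] by (simp add: g_def)
  have ev: "eventually (\<lambda>w. w \<in> \<psi> ` V \<and> inv_into V \<psi> w \<in> U) (at (\<psi> x) within Cn ?n)"
    using is_chart_eventually[OF cV is_chart_openin[OF cU] U(2) V(2)] .
  have "hdiff ?n (\<lambda>w. f (inv_into U \<phi> (g w))) (\<psi> x)"
  proof (rule hdiff_compose[where m="?n" and g=g and f="\<lambda>u. f (inv_into U \<phi> u)"])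
    show "\<psi> x \<in> Cn ?n" using is_chart_image[OF cV] V(2) by blast
    show "g (\<psi> x) \<in> Cn ?n" using gx is_chart_image[OF cU] U(2) by auto
    show "eventually (\<lambda>w. g w \<in> Cn ?n) (at (\<psi> x) within Cn ?n)"
      using ev by (rule eventually_mono) (use is_chart_image[OF cU] in \<open>auto simp: g_def\<close>)
    show "hdiff ?n (\<lambda>w. g w j) (\<psi> x)" if "j < ?n" for j
      using comp that U(2) V(2) by (auto simp: compatible_charts_def holomorphic_Cn_def hdiff_def g_def)
  qed (use gx f' in simp)
  moreover have "eventually (\<lambda>w. f (inv_into U \<phi> (g w)) = f (inv_into V \<psi> w)) (at (\<psi> x) within Cn ?n)"
    using ev by (rule eventually_mono) (use is_chart_inj[OF cU] in \<open>auto simp: g_def\<close>)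
  moreover have "f (inv_into U \<phi> (g (\<psi> x))) = f (inv_into V \<psi> (\<psi> x))"
    using gx U(2) V(2) is_chart_inj[OF cU] is_chart_inj[OF cV] by simp
  ultimately show ?thesis
    using hdiff_cong[of "\<lambda>w. f (inv_into U \<phi> (g w))" "\<lambda>w. f (inv_into V \<psi> w)" "\<psi> x" ?n] by simp
qed

lemma mdiff_iff:
  assumes M: "complex_manifold M" and U: "(U, \<phi>) \<in> charts M" "x \<in> U"
  shows "mdiff M f x \<longleftrightarrow> hdiff (mdim M) (\<lambda>w. f (inv_into U \<phi> w)) (\<phi> x)"
  using mdiff_imp_hdiff[OF M] charts_subset_atlas[OF M] U by (fastforce simp: mdiff_def)

lemma chart_point_in_Cn:
  assumes "complex_manifold M" "(U, \<phi>) \<in> charts M" "x \<in> U"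
  shows "\<phi> x \<in> Cn (mdim M)"
  using is_chart_image[OF manifold_is_chart[OF assms(1,2)]] assms(3) by blast

lemma mdiff_atlas_chart:
  assumes M: "complex_manifold M" and V: "(V, \<psi>) \<in> maximal_atlas M" "x \<in> V" and j: "j < mdim M"
  shows "mdiff M (\<lambda>y. \<psi> y j) x"
proof -
  have cV: "is_chart (mtop M) (mdim M) (V, \<psi>)" using V by (simp add: maximal_atlas_def)
  then have "x \<in> points M" using V(2) is_chart_subset by blast
  then obtain U \<phi> where U: "(U, \<phi>) \<in> charts M" "x \<in> U" using manifold_chart_exists[OF M] by blast
  then have "compatible_charts (mdim M) (V, \<psi>) (U, \<phi>)" using V by (auto simp: maximal_atlas_def)
  then show ?thesis using U V j
    by (auto simp: mdiff_iff[OF M U] compatible_charts_def holomorphic_Cn_def hdiff_def)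
qed

lemma mdiff_cong:
  assumes M: "complex_manifold M" and A: "openin (mtop M) A" "x \<in> A"
    and eq: "\<And>y. y \<in> A \<Longrightarrow> f y = g y"
  shows "mdiff M f x \<longleftrightarrow> mdiff M g x"
proof -
  have "x \<in> points M" using A openin_subset by blast
  then obtain U \<phi> where U: "(U, \<phi>) \<in> charts M" "x \<in> U" using manifold_chart_exists[OF M] by blast
  note c = manifold_is_chart[OF M U(1)]
  have "eventually (\<lambda>w. f (inv_into U \<phi> w) = g (inv_into U \<phi> w)) (at (\<phi> x) within Cn (mdim M))"
    using is_chart_eventually[OF c A U(2)] by (rule eventually_mono) (use eq in auto)
  then show ?thesis unfolding mdiff_iff[OF M U]
    by (rule hdiff_cong) (use U(2) A(2) eq is_chart_inj[OF c] in auto)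
qed

lemma mdiff_compose:
  assumes M: "complex_manifold M" and A: "openin (mtop M) A" "x \<in> A"
    and gA: "\<And>y. y \<in> A \<Longrightarrow> g y \<in> Cn m"
    and g: "\<And>j. j < m \<Longrightarrow> mdiff M (\<lambda>y. g y j) x"
    and f: "hdiff m f (g x)"
  shows "mdiff M (\<lambda>y. f (g y)) x"
proof -
  have "x \<in> points M" using A openin_subset by blast
  then obtain U \<phi> where U: "(U, \<phi>) \<in> charts M" "x \<in> U" using manifold_chart_exists[OF M] by blast
  note c = manifold_is_chart[OF M U(1)]
  show ?thesis unfolding mdiff_iff[OF M U]
  proof (rule hdiff_compose[where m=m and g="\<lambda>w. g (inv_into U \<phi> w)"])
    show "eventually (\<lambda>w. g (inv_into U \<phi> w) \<in> Cn m) (at (\<phi> x) within Cn (mdim M))"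
      using is_chart_eventually[OF c A U(2)] by (rule eventually_mono) (use gA in auto)
  qed (use chart_point_in_Cn[OF M U] U A gA f is_chart_inj[OF c] g[unfolded mdiff_iff[OF M U]] in auto)
qed

lemma
  assumes M: "complex_manifold M" and x: "x \<in> points M"
  shows mdiff_const: "mdiff M (\<lambda>y. a) x"
    and mdiff_add: "mdiff M f x \<Longrightarrow> mdiff M g x \<Longrightarrow> mdiff M (\<lambda>y. f y + g y) x"
    and mdiff_mult: "mdiff M f x \<Longrightarrow> mdiff M g x \<Longrightarrow> mdiff M (\<lambda>y. f y * g y) x"
    and mdiff_field_compose:
      "mdiff M f x \<Longrightarrow> h field_differentiable at (f x) \<Longrightarrow> mdiff M (\<lambda>y. h (f y)) x"
proof -
  obtain U \<phi> where U: "(U, \<phi>) \<in> charts M" "x \<in> U" using manifold_chart_exists[OF M x] by blast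
  note iff = mdiff_iff[OF M U] and z = chart_point_in_Cn[OF M U]
  have inv: "inv_into U \<phi> (\<phi> x) = x" using is_chart_inj[OF manifold_is_chart[OF M U(1)]] U(2) by simp
  show "mdiff M (\<lambda>y. a) x" unfolding iff by (rule hdiff_const)
  show "mdiff M f x \<Longrightarrow> mdiff M g x \<Longrightarrow> mdiff M (\<lambda>y. f y + g y) x"
    unfolding iff by (rule hdiff_add[OF z])
  show "mdiff M f x \<Longrightarrow> mdiff M g x \<Longrightarrow> mdiff M (\<lambda>y. f y * g y) x"
    unfolding iff by (rule hdiff_mult[OF z])
  show "mdiff M f x \<Longrightarrow> h field_differentiable at (f x) \<Longrightarrow> mdiff M (\<lambda>y. h (f y)) x"
    unfolding iff by (rule hdiff_field_compose[OF z]) (simp_all add: inv)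
qed

lemma mdiff_diff:
  assumes "complex_manifold M" "x \<in> points M" "mdiff M f x" "mdiff M g x"
  shows "mdiff M (\<lambda>y. f y - g y) x"
  using mdiff_add[OF assms(1,2,3) mdiff_mult[OF assms(1,2) mdiff_const[OF assms(1,2), of "-1"] assms(4)]]
  by simp

lemma mdiff_imp_continuous_map:
  assumes M: "complex_manifold M" and f: "\<And>x. x \<in> points M \<Longrightarrow> mdiff M f x"
  shows "continuous_map (mtop M) euclidean f"
  unfolding continuous_map_def
proof (intro conjI allI impI)
  fix S :: "complex set" assume "openin euclidean S"
  then have S: "open S" by simp
  show "openin (mtop M) {x \<in> points M. f x \<in> S}"
  proof (subst openin_subopen, clarify)
    fix x assume x: "x \<in> points M" "f x \<in> S"
    obtain U \<phi> where U: "(U, \<phi>) \<in> charts M" "x \<in> U" using manifold_chart_exists[OF M x(1)] by blast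
    note c = manifold_is_chart[OF M U(1)] and z = chart_point_in_Cn[OF M U]
    have inv: "inv_into U \<phi> (\<phi> y) = y" if "y \<in> U" for y using is_chart_inj[OF c] that by simp
    have "continuous (at (\<phi> x) within Cn (mdim M)) (\<lambda>w. f (inv_into U \<phi> w))"
      using f[OF x(1)] unfolding mdiff_iff[OF M U] by (rule hdiff_imp_continuous[OF z])
    then obtain A where A: "open A" "\<phi> x \<in> A" "\<And>w. w \<in> Cn (mdim M) \<Longrightarrow> w \<in> A \<Longrightarrow> f (inv_into U \<phi> w) \<in> S"
      using S x(2) inv[OF U(2)] unfolding continuous_within_topological by (auto simp: Ball_def)
    have "openin (subtopology (mtop M) U) {y \<in> topspace (subtopology (mtop M) U). \<phi> y \<in> Cn (mdim M) \<inter> A}"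
      using is_chart_continuous[OF c]
      by (rule openin_continuous_map_preimage) (auto simp: Cn_topology_def A(1) openin_open_Int)
    then have "openin (mtop M) {y \<in> topspace (subtopology (mtop M) U). \<phi> y \<in> Cn (mdim M) \<inter> A}"
      using is_chart_openin[OF c] openin_open_subtopology by blast
    moreover have "f y \<in> S" if "y \<in> U" "\<phi> y \<in> Cn (mdim M) \<inter> A" for y
      using A(3)[of "\<phi> y"] that inv by auto
    ultimately show "\<exists>T. openin (mtop M) T \<and> x \<in> T \<and> T \<subseteq> {x \<in> points M. f x \<in> S}"
      using x(1) U(2) z A(2) by (intro exI[of _ "{y \<in> topspace (subtopology (mtop M) U). \<phi> y \<in> Cn (mdim M) \<inter> A}"]) auto
  qed
qed auto

text \<open>\<open>holomorphic_map\<close> asks for a pair of charts around each point and for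
  holomorphy on the whole overlap \<open>{x \<in> U. f x \<in> V}\<close>. Since
  \<open>mdiff\<close> is independent of the chart, the coordinate functions can be tested point by
  point instead.\<close>

lemma holomorphic_mapI:
  assumes M: "complex_manifold M" and N: "complex_manifold N"
    and cont: "continuous_map (mtop M) (mtop N) f"
    and diff: "\<And>x V \<psi> j. x \<in> points M \<Longrightarrow> (V, \<psi>) \<in> charts N \<Longrightarrow> f x \<in> V \<Longrightarrow> j < mdim N \<Longrightarrow>
      mdiff M (\<lambda>y. \<psi> (f y) j) x"
  shows "holomorphic_map M N f"
  unfolding holomorphic_map_def
proof (intro conjI ballI cont)
  fix a assume a: "a \<in> points M"
  obtain U \<phi> where U: "(U, \<phi>) \<in> charts M" "a \<in> U" using manifold_chart_exists[OF M a] by blast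
  have "f a \<in> points N" using cont a continuous_map_image_subset_topspace by blast
  then obtain V \<psi> where V: "(V, \<psi>) \<in> charts N" "f a \<in> V" using manifold_chart_exists[OF N] by blast
  note c = manifold_is_chart[OF M U(1)]
  have "holomorphic_Cn (mdim M) (mdim N) (\<phi> ` {x \<in> U. f x \<in> V}) (\<lambda>z. \<psi> (f (inv_into U \<phi> z)))"
    unfolding holomorphic_Cn_def
  proof (intro ballI conjI allI impI)
    fix z assume "z \<in> \<phi> ` {x \<in> U. f x \<in> V}"
    then obtain x where x: "x \<in> U" "f x \<in> V" "z = \<phi> x" by blast
    have inv: "inv_into U \<phi> z = x" using x is_chart_inj[OF c] by simp
    show "\<psi> (f (inv_into U \<phi> z)) \<in> Cn (mdim N)" using chart_point_in_Cn[OF N V(1)] x inv by simp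
    fix j assume "j < mdim N"
    then have "mdiff M (\<lambda>y. \<psi> (f y) j) x"
      using diff V(1) x is_chart_subset[OF c] by blast
    then show "\<exists>a. has_complex_gradient (mdim M) (\<lambda>w. \<psi> (f (inv_into U \<phi> w)) j) a z"
      using mdiff_iff[OF M U(1) x(1)] x(3) by (simp add: hdiff_def)
  qed
  then show "\<exists>(U, \<phi>)\<in>charts M. \<exists>(V, \<psi>)\<in>charts N. a \<in> U \<and> f a \<in> V \<and>
      holomorphic_Cn (mdim M) (mdim N) (\<phi> ` {x \<in> U. f x \<in> V}) (\<lambda>z. \<psi> (f (inv_into U \<phi> z)))"
    using U V by (intro bexI[OF _ U(1)] bexI[OF _ V(1)] case_prodI conjI)
qed

lemma mdiff_comp_chart:
  assumes M: "complex_manifold M" and N: "complex_manifold N"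
    and cont: "continuous_map (mtop M) (mtop N) f" and x: "x \<in> points M"
    and V: "(V, \<psi>) \<in> charts N" "f x \<in> V"
    and diff: "\<And>j. j < mdim N \<Longrightarrow> mdiff M (\<lambda>y. \<psi> (f y) j) x"
    and h: "mdiff N h (f x)"
  shows "mdiff M (\<lambda>y. h (f y)) x"
proof -
  note c = manifold_is_chart[OF N V(1)]
  \<comment> \<open>Continuity of \<open>f\<close> makes \<open>A\<close> open, and on
    \<open>A\<close> the composite of \<open>h\<close> with \<open>f\<close> is \<open>h\<close>
    read in the chart \<open>\<psi>\<close>, composed with the coordinates of
    \<open>f\<close>.\<close>
  define A where "A = {y \<in> points M. f y \<in> V}"
  have A: "openin (mtop M) A" "x \<in> A"
    using openin_continuous_map_preimage[OF cont is_chart_openin[OF c]] x V by (auto simp: A_def)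
  have "mdiff M (\<lambda>y. h (inv_into V \<psi> (\<psi> (f y)))) x"
    by (rule mdiff_compose[OF M A])
      (use diff h[unfolded mdiff_iff[OF N V]] chart_point_in_Cn[OF N V(1)] in \<open>auto simp: A_def\<close>)
  moreover have "h (inv_into V \<psi> (\<psi> (f y))) = h (f y)" if "y \<in> A" for y
    using that is_chart_inj[OF c] by (simp add: A_def)
  ultimately show ?thesis by (subst mdiff_cong[OF M A, symmetric])
qed

text \<open>The way in which holomorphy of a map is used: it transports differentiable functions
  back from the target, whichever charts witnessed it.\<close>

lemma holomorphic_map_pullback:
  assumes M: "complex_manifold M" and N: "complex_manifold N"
    and f: "holomorphic_map M N f" and x: "x \<in> points M" and h: "mdiff N h (f x)"
  shows "mdiff M (\<lambda>y. h (f y)) x"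
proof -
  obtain U \<phi> V \<psi> where U: "(U, \<phi>) \<in> charts M" "x \<in> U" and V: "(V, \<psi>) \<in> charts N" "f x \<in> V"
    and hol: "holomorphic_Cn (mdim M) (mdim N) (\<phi> ` {x \<in> U. f x \<in> V}) (\<lambda>z. \<psi> (f (inv_into U \<phi> z)))"
    using f x unfolding holomorphic_map_def by (elim conjE ballE) auto
  have "mdiff M (\<lambda>y. \<psi> (f y) j) x" if "j < mdim N" for j
    using hol that U V by (auto simp: mdiff_iff[OF M U] holomorphic_Cn_def hdiff_def)
  moreover have "continuous_map (mtop M) (mtop N) f" using f by (simp add: holomorphic_map_def)
  ultimately show ?thesis using mdiff_comp_chart[OF M N] x V h by blast
qed

lemma holomorphic_map_atlas:
  assumes M: "complex_manifold M" and N: "complex_manifold N"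
    and f: "holomorphic_map M N f" and x: "x \<in> points M"
    and V: "(V, \<psi>) \<in> maximal_atlas N" "f x \<in> V" "j < mdim N"
  shows "mdiff M (\<lambda>y. \<psi> (f y) j) x"
  using holomorphic_map_pullback[OF M N f x mdiff_atlas_chart[OF N V]] .

section \<open>Constructions of manifolds\<close>

lemma continuous_map_Cn_iff:
  "continuous_map T (Cn_topology n) f \<longleftrightarrow>
     f ` topspace T \<subseteq> Cn n \<and> (\<forall>i. continuous_map T euclidean (\<lambda>x. f x i))"
  unfolding Cn_topology_def
  by (auto simp: continuous_map_in_subtopology continuous_map_componentwise_UNIV
      simp flip: euclidean_product_topology)

lemma second_countable_euclidean:
  "second_countable (euclidean :: 'a::second_countable_topology topology)"
proof -
  obtain B :: "'a set set" where "countable B" "\<And>C. C \<in> B \<Longrightarrow> open C"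
    "\<And>S. open S \<Longrightarrow> \<exists>U. U \<subseteq> B \<and> S = \<Union>U"
    using univ_second_countable by blast
  moreover from this(3) have "\<exists>V\<in>B. x \<in> V \<and> V \<subseteq> U" if "open U" "x \<in> U" for U x
    using that by (metis Sup_upper UnionE subsetD)
  ultimately show ?thesis unfolding second_countable_def by (intro exI[of _ B]) auto
qed

lemma second_countable_prod_topology:
  assumes "second_countable X" "second_countable Y"
  shows "second_countable (prod_topology X Y)"
proof -
  obtain B where B: "countable B" "\<forall>V\<in>B. openin X V"
    "\<forall>U x. openin X U \<and> x \<in> U \<longrightarrow> (\<exists>V\<in>B. x \<in> V \<and> V \<subseteq> U)"
    using assms(1) unfolding second_countable_def by blast
  obtain C where C: "countable C" "\<forall>V\<in>C. openin Y V"
    "\<forall>U x. openin Y U \<and> x \<in> U \<longrightarrow> (\<exists>V\<in>C. x \<in> V \<and> V \<subseteq> U)"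
    using assms(2) unfolding second_countable_def by blast
  show ?thesis unfolding second_countable_def
  proof (intro exI[of _ "(\<lambda>(U, V). U \<times> V) ` (B \<times> C)"] conjI allI impI ballI)
    show "countable ((\<lambda>(U, V). U \<times> V) ` (B \<times> C))" using B(1) C(1) by auto
    show "openin (prod_topology X Y) V" if "V \<in> (\<lambda>(U, V). U \<times> V) ` (B \<times> C)" for V
      using that B(2) C(2) by (auto simp: openin_prod_Times_iff)
    fix W z assume "openin (prod_topology X Y) W \<and> z \<in> W"
    moreover obtain x y where z: "z = (x, y)" by (cases z)
    ultimately obtain U V where UV: "openin X U" "openin Y V" "x \<in> U" "y \<in> V" "U \<times> V \<subseteq> W"
      unfolding openin_prod_topology_alt by blast
    obtain U' where U': "U' \<in> B" "x \<in> U'" "U' \<subseteq> U" using B(3) UV by blast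
    obtain V' where V': "V' \<in> C" "y \<in> V'" "V' \<subseteq> V" using C(3) UV by blast
    show "\<exists>V\<in>(\<lambda>(U, V). U \<times> V) ` (B \<times> C). z \<in> V \<and> V \<subseteq> W"
      by (rule bexI[of _ "U' \<times> V'"]) (use U' V' UV z in auto)
  qed
qed

text \<open>Restricting a chart changes the set in \<open>inv_into\<close>; this keeps the chart
  expressions over the smaller domain equal to the old ones.\<close>

lemma inv_into_subset:
  assumes "inj_on \<phi> U" "A \<subseteq> U" "w \<in> \<phi> ` A"
  shows "inv_into A \<phi> w = inv_into U \<phi> w"
  using assms by (smt (verit) f_inv_into_f inj_on_subset inv_into_f_f image_iff subsetD)

lemma hdiff_cong_openin:
  assumes "openin (Cn_topology n) W" "z \<in> W" "\<And>w. w \<in> W \<Longrightarrow> f w = g w"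
  shows "hdiff n f z \<longleftrightarrow> hdiff n g z"
  by (rule hdiff_cong) (use assms eventually_mono[OF eventually_at_Cn[OF assms(1,2)]] in auto)


subsection \<open>A single global chart\<close>

text \<open>An explicit inverse \<open>g\<close> in place of \<open>inv_into\<close> makes
  computations on \<open>Cn n\<close>, on the line and on three-space direct.\<close>

locale global_chart =
  fixes T :: "'a topology" and n :: nat and \<phi> :: "'a \<Rightarrow> cvec" and g :: "cvec \<Rightarrow> 'a"
  assumes haus: "Hausdorff_space T" and sc: "second_countable T"
    and cont: "continuous_map T (Cn_topology n) \<phi>" and cont_inv: "continuous_map (Cn_topology n) T g"
    and left_inv: "\<And>x. x \<in> topspace T \<Longrightarrow> g (\<phi> x) = x" and right_inv: "\<And>w. w \<in> Cn n \<Longrightarrow> \<phi> (g w) = w"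
begin

abbreviation "M \<equiv> \<lparr>mtop = T, mdim = n, charts = {(topspace T, \<phi>)}\<rparr>"

lemma image: "\<phi> ` topspace T = Cn n"
proof -
  have "g w \<in> topspace T" if "w \<in> Cn n" for w
    using continuous_map_image_subset_topspace[OF cont_inv] that by auto
  then show ?thesis
    using continuous_map_image_subset_topspace[OF cont] right_inv by (force simp: image_iff)
qed

lemma inv_into_chart: "w \<in> Cn n \<Longrightarrow> inv_into (topspace T) \<phi> w = g w"
  using image left_inv right_inv by (metis f_inv_into_f inv_into_into)

lemma manifold: "complex_manifold M"
proof -
  have c: "is_chart T n (topspace T, \<phi>)"
    by (rule is_chartI[where g=g])
      (use cont cont_inv left_inv in \<open>auto simp: image simp flip: topspace_Cn\<close>)
  have "hdiff n (\<lambda>w. \<phi> (inv_into (topspace T) \<phi> w) j) z" if z: "z \<in> Cn n" for z j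
    by (subst hdiff_cong_openin[of n "Cn n" z _ "\<lambda>w. w j"])
      (use z hdiff_coordinate in \<open>auto simp: inv_into_chart right_inv simp flip: topspace_Cn\<close>)
  then have "holomorphic_Cn n n (Cn n) (\<lambda>w. \<phi> (inv_into (topspace T) \<phi> w))"
    by (auto simp: holomorphic_Cn_def hdiff_def inv_into_chart right_inv)
  then have "compatible_charts n (topspace T, \<phi>) (topspace T, \<phi>)"
    by (simp add: compatible_charts_def image)
  then show ?thesis using haus sc c by (simp add: complex_manifold_def)
qed

lemma mdiff_eq:
  assumes "x \<in> topspace T"
  shows "mdiff M f x \<longleftrightarrow> hdiff n (\<lambda>w. f (g w)) (\<phi> x)"
proof -
  have "mdiff M f x \<longleftrightarrow> hdiff n (\<lambda>w. f (inv_into (topspace T) \<phi> w)) (\<phi> x)"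
    using assms by (simp add: mdiff_def)
  also have "\<dots> \<longleftrightarrow> hdiff n (\<lambda>w. f (g w)) (\<phi> x)"
    by (rule hdiff_cong_openin[of n "Cn n"]) (use assms image inv_into_chart in \<open>auto simp flip: topspace_Cn\<close>)
  finally show ?thesis .
qed

end

lemma continuous_map_coordinate: "continuous_map (Cn_topology n) euclidean (\<lambda>w. w i)"
  using continuous_map_Cn_iff[of "Cn_topology n" n "\<lambda>w. w"] by simp

interpretation complex_space: global_chart "Cn_topology n" n id id
  for n
  by unfold_locales
    (auto simp: Cn_topology_def second_countable_euclidean Hausdorff_space_subtopology
      intro!: second_countable_subtopology)

interpretation complex_line: global_chart euclidean 1 "\<lambda>z i. if i = 0 then z else 0" "\<lambda>w. w 0"
proof
  show "continuous_map euclidean (Cn_topology 1) (\<lambda>z i. if i = 0 then z else 0)"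
  proof (subst continuous_map_Cn_iff, intro conjI allI)
    fix i show "continuous_map euclidean euclidean (\<lambda>z::complex. if i = (0::nat) then z else 0)"
      by (cases "i = 0") auto
  qed (auto simp: Cn_def)
qed (auto simp: second_countable_euclidean continuous_map_coordinate Cn_def)

abbreviation coord3 :: "complex \<times> complex \<times> complex \<Rightarrow> cvec" where
  "coord3 \<equiv> \<lambda>(u, v, x) i. if i = 0 then u else if i = 1 then v else if i = 2 then x else 0"

interpretation complex_3space: global_chart euclidean 3 coord3 "\<lambda>w. (w 0, w 1, w 2)"
proof
  show "continuous_map euclidean (Cn_topology 3) coord3"
    by (auto simp: continuous_map_Cn_iff Cn_def split_beta if_distrib intro!: continuous_intros)
  show "continuous_map (Cn_topology 3) euclidean (\<lambda>w. (w 0, w 1, w 2))"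
    by (auto simp: continuous_map_coordinate continuous_map_pairedI simp flip: euclidean_product_topology prod_topology_euclidean)
  show "coord3 (w 0, w 1, w 2) = w" if "w \<in> Cn 3" for w
    using that by (auto simp: Cn_def fun_eq_iff numeral_3_eq_3 not_less_eq_eq less_Suc_eq)
qed (auto simp: second_countable_euclidean)

subsection \<open>Products\<close>

definition take_vec :: "nat \<Rightarrow> cvec \<Rightarrow> cvec" where
  "take_vec n w = (\<lambda>i. if i < n then w i else 0)"

definition drop_vec :: "nat \<Rightarrow> cvec \<Rightarrow> cvec" where
  "drop_vec n w = (\<lambda>i. w (i + n))"

lemma take_vec_Cn: "take_vec n w \<in> Cn n"
  by (simp add: take_vec_def Cn_def)

lemma drop_vec_Cn: "w \<in> Cn (n + m) \<Longrightarrow> drop_vec n w \<in> Cn m"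
  by (simp add: drop_vec_def Cn_def)

lemma append_vec_Cn: "w \<in> Cn m \<Longrightarrow> append_vec n z w \<in> Cn (n + m)"
  by (auto simp: append_vec_def Cn_def)

lemma take_append_vec: "z \<in> Cn n \<Longrightarrow> take_vec n (append_vec n z w) = z"
  by (auto simp: append_vec_def take_vec_def Cn_def)

lemma drop_append_vec: "drop_vec n (append_vec n z w) = w"
  by (auto simp: append_vec_def drop_vec_def)

lemma append_take_drop_vec: "append_vec n (take_vec n w) (drop_vec n w) = w"
  by (auto simp: append_vec_def drop_vec_def take_vec_def)

lemma continuous_map_take_vec: "continuous_map (Cn_topology (n + m)) (Cn_topology n) (take_vec n)"
  unfolding continuous_map_Cn_iff
proof (intro conjI allI)
  fix i show "continuous_map (Cn_topology (n + m)) euclidean (\<lambda>w. take_vec n w i)"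
    by (cases "i < n") (simp_all add: take_vec_def continuous_map_coordinate)
qed (use take_vec_Cn in auto)

lemma continuous_map_drop_vec: "continuous_map (Cn_topology (n + m)) (Cn_topology m) (drop_vec n)"
  by (auto simp: continuous_map_Cn_iff drop_vec_def[abs_def] continuous_map_coordinate)
    (simp add: Cn_def)

lemma hdiff_take_vec:
  assumes z: "z \<in> Cn (n + m)" and h: "hdiff n h (take_vec n z)"
  shows "hdiff (n + m) (\<lambda>w. h (take_vec n w)) z"
  by (rule hdiff_compose[where m=n and g="take_vec n" and f=h])
    (use assms in \<open>auto simp: take_vec_Cn hdiff_coordinate, simp add: take_vec_def hdiff_coordinate\<close>)

lemma hdiff_drop_vec:
  assumes z: "z \<in> Cn (n + m)" and h: "hdiff m h (drop_vec n z)"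
  shows "hdiff (n + m) (\<lambda>w. h (drop_vec n w)) z"
proof (rule hdiff_compose[where m=m and g="drop_vec n" and f=h])
  show "eventually (\<lambda>w. drop_vec n w \<in> Cn m) (at z within Cn (n + m))"
    by (auto simp: eventually_at_filter drop_vec_Cn)
  show "hdiff (n + m) (\<lambda>w. drop_vec n w j) z" for j
    using z by (simp add: drop_vec_def hdiff_coordinate)
qed (use assms in \<open>auto simp: drop_vec_Cn\<close>)

text \<open>The map inside \<open>product_manifold\<close>, named so that its image and inverse can
  be described once for arbitrary charts.\<close>

definition product_chart :: "nat \<Rightarrow> ('a \<Rightarrow> cvec) \<Rightarrow> ('b \<Rightarrow> cvec) \<Rightarrow> 'a \<times> 'b \<Rightarrow> cvec" where
  "product_chart n \<phi> \<psi> = (\<lambda>(a, b). append_vec n (\<phi> a) (\<psi> b))"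

context
  fixes S :: "'a topology" and T :: "'b topology" and n m U V \<phi> \<psi>
  assumes U: "is_chart S n (U, \<phi>)" and V: "is_chart T m (V, \<psi>)"
begin

text \<open>Written as a preimage under \<open>take_vec\<close> and \<open>drop_vec\<close>, the
  image is visibly open.\<close>

lemma product_chart_image:
  "product_chart n \<phi> \<psi> ` (U \<times> V) = {w \<in> Cn (n + m). take_vec n w \<in> \<phi> ` U \<and> drop_vec n w \<in> \<psi> ` V}"
proof (intro Set.set_eqI iffI)
  fix w assume "w \<in> product_chart n \<phi> \<psi> ` (U \<times> V)"
  then show "w \<in> {w \<in> Cn (n + m). take_vec n w \<in> \<phi> ` U \<and> drop_vec n w \<in> \<psi> ` V}"
    using is_chart_image[OF U] is_chart_image[OF V]
    by (auto simp: product_chart_def image_subset_iff append_vec_Cn take_append_vec drop_append_vec)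
next
  fix w assume "w \<in> {w \<in> Cn (n + m). take_vec n w \<in> \<phi> ` U \<and> drop_vec n w \<in> \<psi> ` V}"
  then obtain a b where "a \<in> U" "b \<in> V" "take_vec n w = \<phi> a" "drop_vec n w = \<psi> b" by blast
  then show "w \<in> product_chart n \<phi> \<psi> ` (U \<times> V)"
    using append_take_drop_vec[of n w] by (force simp: product_chart_def)
qed

lemma inj_on_product_chart: "inj_on (product_chart n \<phi> \<psi>) (U \<times> V)"
proof (rule inj_on_inverseI[where g="\<lambda>w. (inv_into U \<phi> (take_vec n w), inv_into V \<psi> (drop_vec n w))"])
  fix x assume "x \<in> U \<times> V"
  then show "(inv_into U \<phi> (take_vec n (product_chart n \<phi> \<psi> x)),
      inv_into V \<psi> (drop_vec n (product_chart n \<phi> \<psi> x))) = x"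
    using is_chart_inj[OF U] is_chart_inj[OF V] is_chart_image[OF U]
    by (auto simp: product_chart_def take_append_vec drop_append_vec image_subset_iff)
qed

lemma inv_into_product_chart:
  assumes "w \<in> product_chart n \<phi> \<psi> ` (U \<times> V)"
  shows "inv_into (U \<times> V) (product_chart n \<phi> \<psi>) w =
    (inv_into U \<phi> (take_vec n w), inv_into V \<psi> (drop_vec n w))"
proof -
  obtain a b where ab: "a \<in> U" "b \<in> V" "w = product_chart n \<phi> \<psi> (a, b)" using assms by auto
  then have "take_vec n w = \<phi> a" "drop_vec n w = \<psi> b"
    using is_chart_image[OF U]
    by (auto simp: product_chart_def take_append_vec drop_append_vec image_subset_iff)
  moreover have "inv_into (U \<times> V) (product_chart n \<phi> \<psi>) w = (a, b)"
    using ab inj_on_product_chart by (simp add: inv_into_f_f)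
  ultimately show ?thesis using ab is_chart_inj[OF U] is_chart_inj[OF V] by simp
qed

lemma is_chart_product: "is_chart (prod_topology S T) (n + m) (U \<times> V, product_chart n \<phi> \<psi>)"
proof (rule is_chartI)
  let ?g = "\<lambda>w. (inv_into U \<phi> (take_vec n w), inv_into V \<psi> (drop_vec n w))"
  let ?P = "subtopology (prod_topology S T) (U \<times> V)"
  let ?Q = "subtopology (Cn_topology (n + m)) (product_chart n \<phi> \<psi> ` (U \<times> V))"
  show "openin (prod_topology S T) (U \<times> V)"
    using is_chart_openin[OF U] is_chart_openin[OF V] by (simp add: openin_prod_Times_iff)
  have oU: "openin (Cn_topology n) (\<phi> ` U)" and oV: "openin (Cn_topology m) (\<psi> ` V)"
    using U V by (auto simp: is_chart_def)
  have "{w \<in> Cn (n + m). take_vec n w \<in> \<phi> ` U \<and> drop_vec n w \<in> \<psi> ` V} =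
      {w \<in> topspace (Cn_topology (n + m)). take_vec n w \<in> \<phi> ` U} \<inter>
      {w \<in> topspace (Cn_topology (n + m)). drop_vec n w \<in> \<psi> ` V}" by auto
  then show "openin (Cn_topology (n + m)) (product_chart n \<phi> \<psi> ` (U \<times> V))"
    unfolding product_chart_image
    by (simp only:) (intro openin_Int openin_continuous_map_preimage[OF continuous_map_take_vec oU]
        openin_continuous_map_preimage[OF continuous_map_drop_vec oV])
  have P: "?P = prod_topology (subtopology S U) (subtopology T V)" by (simp add: subtopology_Times)
  have c1: "continuous_map ?P (Cn_topology n) (\<lambda>x. \<phi> (fst x))"
    unfolding P using continuous_map_compose[OF continuous_map_fst is_chart_continuous[OF U]]
    by (simp add: o_def)
  have c2: "continuous_map ?P (Cn_topology m) (\<lambda>x. \<psi> (snd x))"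
    unfolding P using continuous_map_compose[OF continuous_map_snd is_chart_continuous[OF V]]
    by (simp add: o_def)
  show "continuous_map ?P (Cn_topology (n + m)) (product_chart n \<phi> \<psi>)"
    unfolding continuous_map_Cn_iff
  proof (intro conjI allI)
    show "product_chart n \<phi> \<psi> ` topspace ?P \<subseteq> Cn (n + m)"
      using product_chart_image by auto
    fix i show "continuous_map ?P euclidean (\<lambda>x. product_chart n \<phi> \<psi> x i)"
      using c1 c2 unfolding continuous_map_Cn_iff
      by (cases "i < n") (simp_all add: product_chart_def append_vec_def split_beta)
  qed
  have "continuous_map ?Q (subtopology (Cn_topology n) (\<phi> ` U)) (take_vec n)"
    using continuous_map_from_subtopology[OF continuous_map_take_vec]
    by (auto simp: continuous_map_in_subtopology product_chart_image)
  moreover have "continuous_map ?Q (subtopology (Cn_topology m) (\<psi> ` V)) (drop_vec n)"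
    using continuous_map_from_subtopology[OF continuous_map_drop_vec]
    by (auto simp: continuous_map_in_subtopology product_chart_image)
  ultimately show "continuous_map ?Q (prod_topology S T) ?g"
    using continuous_map_compose[OF _ is_chart_inv_continuous[OF U]]
      continuous_map_compose[OF _ is_chart_inv_continuous[OF V]]
    by (auto simp: continuous_map_pairwise o_def)
  fix x assume x: "x \<in> U \<times> V"
  show "?g (product_chart n \<phi> \<psi> x) = x"
    using inv_into_product_chart[of "product_chart n \<phi> \<psi> x"] inj_on_product_chart x by auto
qed

lemma hdiff_product_chart:
  assumes ab: "a \<in> U" "b \<in> V"
  shows hdiff_product_chart_fst: "hdiff n (\<lambda>w. f (inv_into U \<phi> w)) (\<phi> a) \<Longrightarrow>
      hdiff (n + m) (\<lambda>w. f (fst (inv_into (U \<times> V) (product_chart n \<phi> \<psi>) w))) (product_chart n \<phi> \<psi> (a, b))"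
    and hdiff_product_chart_snd: "hdiff m (\<lambda>w. h (inv_into V \<psi> w)) (\<psi> b) \<Longrightarrow>
      hdiff (n + m) (\<lambda>w. h (snd (inv_into (U \<times> V) (product_chart n \<phi> \<psi>) w))) (product_chart n \<phi> \<psi> (a, b))"
proof -
  let ?z = "product_chart n \<phi> \<psi> (a, b)"
  have z: "?z \<in> product_chart n \<phi> \<psi> ` (U \<times> V)" "?z \<in> Cn (n + m)"
    using ab product_chart_image by auto
  have tz: "take_vec n ?z = \<phi> a" "drop_vec n ?z = \<psi> b"
    using ab is_chart_image[OF U]
    by (auto simp: product_chart_def take_append_vec drop_append_vec image_subset_iff)
  have o: "openin (Cn_topology (n + m)) (product_chart n \<phi> \<psi> ` (U \<times> V))"
    using is_chart_product by (simp add: is_chart_def)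
  show "hdiff n (\<lambda>w. f (inv_into U \<phi> w)) (\<phi> a) \<Longrightarrow>
      hdiff (n + m) (\<lambda>w. f (fst (inv_into (U \<times> V) (product_chart n \<phi> \<psi>) w))) ?z"
    by (subst hdiff_cong_openin[OF o z(1), where g="\<lambda>w. f (inv_into U \<phi> (take_vec n w))"])
      (use hdiff_take_vec[OF z(2), of "\<lambda>w. f (inv_into U \<phi> w)"] in \<open>auto simp: inv_into_product_chart tz\<close>)
  show "hdiff m (\<lambda>w. h (inv_into V \<psi> w)) (\<psi> b) \<Longrightarrow>
      hdiff (n + m) (\<lambda>w. h (snd (inv_into (U \<times> V) (product_chart n \<phi> \<psi>) w))) ?z"
    by (subst hdiff_cong_openin[OF o z(1), where g="\<lambda>w. h (inv_into V \<psi> (drop_vec n w))"])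
      (use hdiff_drop_vec[OF z(2), of "\<lambda>w. h (inv_into V \<psi> w)"] in \<open>auto simp: inv_into_product_chart tz\<close>)
qed

end

lemma product_charts:
  "charts (product_manifold M N) =
     {(U \<times> V, product_chart (mdim M) \<phi> \<psi>) | U \<phi> V \<psi>. (U, \<phi>) \<in> charts M \<and> (V, \<psi>) \<in> charts N}"
  by (auto simp: product_manifold_def product_chart_def image_iff split_beta) force+

lemma holomorphic_Cn_product_charts:
  assumes M: "complex_manifold M" and N: "complex_manifold N"
    and U: "(U, \<phi>) \<in> charts M" and U': "(U', \<phi>') \<in> charts M"
    and V: "(V, \<psi>) \<in> charts N" and V': "(V', \<psi>') \<in> charts N"
  shows "holomorphic_Cn (mdim M + mdim N) (mdim M + mdim N)
    (product_chart (mdim M) \<phi> \<psi> ` ((U \<times> V) \<inter> (U' \<times> V')))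
    (\<lambda>z. product_chart (mdim M) \<phi>' \<psi>' (inv_into (U \<times> V) (product_chart (mdim M) \<phi> \<psi>) z))"
  unfolding holomorphic_Cn_def
proof (intro ballI conjI allI impI)
  let ?n = "mdim M" and ?m = "mdim N"
  note cU = manifold_is_chart[OF M U] and cV = manifold_is_chart[OF N V]
  fix z assume "z \<in> product_chart ?n \<phi> \<psi> ` ((U \<times> V) \<inter> (U' \<times> V'))"
  then obtain a b where ab: "a \<in> U" "a \<in> U'" "b \<in> V" "b \<in> V'" and z: "z = product_chart ?n \<phi> \<psi> (a, b)"
    by auto
  have inv: "inv_into (U \<times> V) (product_chart ?n \<phi> \<psi>) z = (a, b)"
    using inj_on_product_chart[OF cU cV] ab z by simp
  show "product_chart ?n \<phi>' \<psi>' (inv_into (U \<times> V) (product_chart ?n \<phi> \<psi>) z) \<in> Cn (?n + ?m)"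
    unfolding inv using append_vec_Cn chart_point_in_Cn[OF N V' ab(4)] by (auto simp: product_chart_def)
  fix j assume j: "j < ?n + ?m"
  \<comment> \<open>Each coordinate of the product chart depends on one factor only, so the
    transition map splits.\<close>
  have "hdiff (?n + ?m) (\<lambda>w. product_chart ?n \<phi>' \<psi>' (inv_into (U \<times> V) (product_chart ?n \<phi> \<psi>) w) j) z"
  proof (cases "j < ?n")
    case True
    have "hdiff ?n (\<lambda>w. \<phi>' (inv_into U \<phi> w) j) (\<phi> a)"
      using mdiff_atlas_chart[OF M subsetD[OF charts_subset_atlas[OF M] U'] ab(2) True]
      by (simp add: mdiff_iff[OF M U ab(1)])
    from hdiff_product_chart_fst[OF cU cV ab(1,3) this] True
    show ?thesis by (simp add: z product_chart_def append_vec_def split_beta)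
  next
    case False
    then have "j - ?n < ?m" using j by simp
    then have "hdiff ?m (\<lambda>w. \<psi>' (inv_into V \<psi> w) (j - ?n)) (\<psi> b)"
      using mdiff_atlas_chart[OF N subsetD[OF charts_subset_atlas[OF N] V'] ab(4)]
      by (simp add: mdiff_iff[OF N V ab(3)])
    from hdiff_product_chart_snd[OF cU cV ab(1,3) this] False
    show ?thesis by (simp add: z product_chart_def append_vec_def split_beta)
  qed
  then show "\<exists>a. has_complex_gradient (?n + ?m)
      (\<lambda>w. product_chart ?n \<phi>' \<psi>' (inv_into (U \<times> V) (product_chart ?n \<phi> \<psi>) w) j) a z"
    by (simp add: hdiff_def)
qed

lemma product_manifold_sel [simp]:
  "mtop (product_manifold M N) = prod_topology (mtop M) (mtop N)"
  "mdim (product_manifold M N) = mdim M + mdim N"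
  by (simp_all add: product_manifold_def)

lemma complex_manifold_product:
  assumes M: "complex_manifold M" and N: "complex_manifold N"
  shows "complex_manifold (product_manifold M N)"
  unfolding complex_manifold_def
proof (intro conjI ballI)
  show "Hausdorff_space (mtop (product_manifold M N))" "second_countable (mtop (product_manifold M N))"
    using M N by (auto simp: complex_manifold_def Hausdorff_space_prod_topology second_countable_prod_topology)
  show "is_chart (mtop (product_manifold M N)) (mdim (product_manifold M N)) c"
    if "c \<in> charts (product_manifold M N)" for c
    using that by (auto simp: product_charts intro!: is_chart_product manifold_is_chart[OF M] manifold_is_chart[OF N])
  show "(\<Union>c\<in>charts (product_manifold M N). fst c) = points (product_manifold M N)"
  proof (intro equalityI subsetI)
    fix x assume "x \<in> (\<Union>c\<in>charts (product_manifold M N). fst c)"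
    then show "x \<in> points (product_manifold M N)"
      using is_chart_subset[OF manifold_is_chart[OF M]] is_chart_subset[OF manifold_is_chart[OF N]]
      by (auto simp: product_charts; blast)
  next
    fix x assume "x \<in> points (product_manifold M N)"
    then obtain a b where x: "x = (a, b)" and ab: "a \<in> points M" "b \<in> points N" by auto
    obtain U \<phi> V \<psi> where "(U, \<phi>) \<in> charts M" "(V, \<psi>) \<in> charts N" "a \<in> U" "b \<in> V"
      using manifold_chart_exists[OF M ab(1)] manifold_chart_exists[OF N ab(2)] by blast
    then show "x \<in> (\<Union>c\<in>charts (product_manifold M N). fst c)"
      unfolding product_charts x by (intro UN_I[of "(U \<times> V, product_chart (mdim M) \<phi> \<psi>)"]) auto
  qed
  show "compatible_charts (mdim (product_manifold M N)) c d"
    if cd: "c \<in> charts (product_manifold M N)" "d \<in> charts (product_manifold M N)" for c d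
  proof -
    obtain U \<phi> V \<psi> where c: "c = (U \<times> V, product_chart (mdim M) \<phi> \<psi>)"
      "(U, \<phi>) \<in> charts M" "(V, \<psi>) \<in> charts N" using cd(1) by (auto simp: product_charts)
    obtain U' \<phi>' V' \<psi>' where d: "d = (U' \<times> V', product_chart (mdim M) \<phi>' \<psi>')"
      "(U', \<phi>') \<in> charts M" "(V', \<psi>') \<in> charts N" using cd(2) by (auto simp: product_charts)
    show ?thesis
      using holomorphic_Cn_product_charts[OF M N c(2) d(2) c(3) d(3)]
        holomorphic_Cn_product_charts[OF M N d(2) c(2) d(3) c(3)]
      by (simp add: compatible_charts_def c(1) d(1) Int_commute)
  qed
qed

section \<open>Holomorphic maps from and into products\<close>

lemma
  assumes M: "complex_manifold M" and N: "complex_manifold N"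
    and z: "z \<in> points (product_manifold M N)"
  shows mdiff_fst: "mdiff M f (fst z) \<Longrightarrow> mdiff (product_manifold M N) (\<lambda>y. f (fst y)) z"
    and mdiff_snd: "mdiff N h (snd z) \<Longrightarrow> mdiff (product_manifold M N) (\<lambda>y. h (snd y)) z"
proof -
  obtain a b where z': "z = (a, b)" "a \<in> points M" "b \<in> points N" using z by auto
  obtain U \<phi> V \<psi> where U: "(U, \<phi>) \<in> charts M" "a \<in> U" and V: "(V, \<psi>) \<in> charts N" "b \<in> V"
    using manifold_chart_exists[OF M z'(2)] manifold_chart_exists[OF N z'(3)] by blast
  have UV: "(U \<times> V, product_chart (mdim M) \<phi> \<psi>) \<in> charts (product_manifold M N)" "z \<in> U \<times> V"
    using U V z' by (auto simp: product_charts)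
  note iff = mdiff_iff[OF complex_manifold_product[OF M N] UV]
  show "mdiff M f (fst z) \<Longrightarrow> mdiff (product_manifold M N) (\<lambda>y. f (fst y)) z"
    using hdiff_product_chart_fst[OF manifold_is_chart[OF M U(1)] manifold_is_chart[OF N V(1)] U(2) V(2)]
    unfolding iff by (simp add: z' mdiff_iff[OF M U])
  show "mdiff N h (snd z) \<Longrightarrow> mdiff (product_manifold M N) (\<lambda>y. h (snd y)) z"
    using hdiff_product_chart_snd[OF manifold_is_chart[OF M U(1)] manifold_is_chart[OF N V(1)] U(2) V(2)]
    unfolding iff by (simp add: z' mdiff_iff[OF N V])
qed

lemma holomorphic_map_fst:
  assumes "complex_manifold M" "complex_manifold N"
  shows "holomorphic_map (product_manifold M N) M fst"
proof (rule holomorphic_mapI)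
  fix x V \<psi> j assume "x \<in> points (product_manifold M N)" "(V, \<psi>) \<in> charts M" "fst x \<in> V" "j < mdim M"
  then show "mdiff (product_manifold M N) (\<lambda>y. \<psi> (fst y) j) x"
    using mdiff_fst[OF assms, of x "\<lambda>y. \<psi> y j"] mdiff_atlas_chart[OF assms(1)]
      charts_subset_atlas[OF assms(1)] by blast
qed (use assms in \<open>auto simp: complex_manifold_product continuous_map_fst\<close>)

lemma holomorphic_map_pair:
  assumes L: "complex_manifold L" and M: "complex_manifold M" and N: "complex_manifold N"
    and f: "holomorphic_map L M f" and g: "holomorphic_map L N g"
  shows "holomorphic_map L (product_manifold M N) (\<lambda>x. (f x, g x))"
proof (rule holomorphic_mapI)
  show "continuous_map (mtop L) (mtop (product_manifold M N)) (\<lambda>x. (f x, g x))"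
    using f g by (simp add: holomorphic_map_def continuous_map_pairedI)
  fix x W \<xi> j
  assume x: "x \<in> points L" and W: "(W, \<xi>) \<in> charts (product_manifold M N)" "(f x, g x) \<in> W"
    and j: "j < mdim (product_manifold M N)"
  obtain U \<phi> V \<psi> where c: "W = U \<times> V" "\<xi> = product_chart (mdim M) \<phi> \<psi>"
    "(U, \<phi>) \<in> charts M" "(V, \<psi>) \<in> charts N" using W(1) by (auto simp: product_charts)
  show "mdiff L (\<lambda>y. \<xi> (f y, g y) j) x"
  proof (cases "j < mdim M")
    case True
    then have "mdiff L (\<lambda>y. \<phi> (f y) j) x"
      using holomorphic_map_atlas[OF L M f x subsetD[OF charts_subset_atlas[OF M] c(3)]] W c by auto
    then show ?thesis using True by (simp add: c product_chart_def append_vec_def)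
  next
    case False
    then have "mdiff L (\<lambda>y. \<psi> (g y) (j - mdim M)) x"
      using holomorphic_map_atlas[OF L N g x subsetD[OF charts_subset_atlas[OF N] c(4)]] W c j by auto
    then show ?thesis using False by (simp add: c product_chart_def append_vec_def)
  qed
qed (use assms in \<open>auto simp: complex_manifold_product\<close>)

lemma holomorphic_map_id:
  assumes "complex_manifold M"
  shows "holomorphic_map M M (\<lambda>x. x)"
proof (rule holomorphic_mapI)
  fix x V \<psi> j assume "x \<in> points M" "(V, \<psi>) \<in> charts M" "x \<in> V" "j < mdim M"
  then show "mdiff M (\<lambda>y. \<psi> y j) x"
    using mdiff_atlas_chart[OF assms] charts_subset_atlas[OF assms] by blast
qed (use assms in auto)

subsection \<open>Submanifolds\<close>

lemma open_submanifold_sel [simp]: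
  "mtop (open_submanifold M W) = subtopology (mtop M) W"
  "mdim (open_submanifold M W) = mdim M"
  by (simp_all add: open_submanifold_def)

lemma is_chart_restrict:
  assumes c: "is_chart T n (U, \<phi>)" and W: "openin T W"
  shows "is_chart (subtopology T W) n (U \<inter> W, \<phi>)"
proof (rule is_chartI)
  show "openin (subtopology T W) (U \<inter> W)"
    using is_chart_openin[OF c] by (auto simp: openin_subtopology)
  show "openin (Cn_topology n) (\<phi> ` (U \<inter> W))"
    using is_chart_open_map[OF c, of "U \<inter> W"] is_chart_openin[OF c] W by auto
  have "subtopology (subtopology T W) (U \<inter> W) = subtopology (subtopology T U) W"
    by (simp add: subtopology_subtopology Int_ac)
  then show "continuous_map (subtopology (subtopology T W) (U \<inter> W)) (Cn_topology n) \<phi>"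
    using is_chart_continuous[OF c] by (simp add: continuous_map_from_subtopology)
  have "subtopology (Cn_topology n) (\<phi> ` (U \<inter> W)) =
      subtopology (subtopology (Cn_topology n) (\<phi> ` U)) (\<phi> ` (U \<inter> W))"
    by (simp add: subtopology_subtopology image_Int_subset Int_absorb1 Int_absorb2 image_mono)
  then show "continuous_map (subtopology (Cn_topology n) (\<phi> ` (U \<inter> W))) (subtopology T W) (inv_into U \<phi>)"
    using continuous_map_from_subtopology[OF is_chart_inv_continuous[OF c]] is_chart_inj[OF c]
    by (auto simp: continuous_map_in_subtopology dest: inj_onD)
qed (use is_chart_inj[OF c] in auto)

context
  fixes M :: "'a cmanifold" and W
  assumes M: "complex_manifold M" and W: "openin (mtop M) W"
begin

lemma open_submanifold_hdiff:
  assumes U: "(U, \<phi>) \<in> charts M" "x \<in> U" "x \<in> W"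
  shows "hdiff (mdim M) (\<lambda>w. f (inv_into (U \<inter> W) \<phi> w)) (\<phi> x) \<longleftrightarrow> mdiff M f x"
proof -
  note c = manifold_is_chart[OF M U(1)]
  have "openin (Cn_topology (mdim M)) (\<phi> ` (U \<inter> W))"
    using is_chart_restrict[OF c W] by (simp add: is_chart_def)
  then have "hdiff (mdim M) (\<lambda>w. f (inv_into (U \<inter> W) \<phi> w)) (\<phi> x) \<longleftrightarrow>
      hdiff (mdim M) (\<lambda>w. f (inv_into U \<phi> w)) (\<phi> x)"
    by (rule hdiff_cong_openin) (use U inv_into_subset[OF is_chart_inj[OF c], of "U \<inter> W"] in auto)
  then show ?thesis by (simp add: mdiff_iff[OF M U(1,2)])
qed

lemma mdiff_open_submanifold:
  assumes "x \<in> W"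
  shows "mdiff (open_submanifold M W) f x \<longleftrightarrow> mdiff M f x"
proof -
  have "x \<in> points M" using W assms openin_subset by blast
  then obtain U \<phi> where U: "(U, \<phi>) \<in> charts M" "x \<in> U" using manifold_chart_exists[OF M] by blast
  have "mdiff (open_submanifold M W) f x \<longleftrightarrow> (\<exists>(U, \<phi>)\<in>charts M. x \<in> U \<and>
      hdiff (mdim M) (\<lambda>w. f (inv_into (U \<inter> W) \<phi> w)) (\<phi> x))"
    using assms by (auto simp: mdiff_def open_submanifold_def split_beta)
  also have "\<dots> \<longleftrightarrow> mdiff M f x"
    using U open_submanifold_hdiff[OF _ _ assms] by auto
  finally show ?thesis .
qed

lemma complex_manifold_open_submanifold: "complex_manifold (open_submanifold M W)"
  unfolding complex_manifold_def
proof (intro conjI ballI)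
  show "Hausdorff_space (mtop (open_submanifold M W))" "second_countable (mtop (open_submanifold M W))"
    using M by (auto simp: complex_manifold_def Hausdorff_space_subtopology second_countable_subtopology)
  show "is_chart (mtop (open_submanifold M W)) (mdim (open_submanifold M W)) c"
    if "c \<in> charts (open_submanifold M W)" for c
    using that is_chart_restrict[OF manifold_is_chart[OF M] W] by (auto simp: open_submanifold_def)
  show "(\<Union>c\<in>charts (open_submanifold M W). fst c) = points (open_submanifold M W)"
  proof -
    have "(\<Union>c\<in>charts (open_submanifold M W). fst c) = (\<Union>c\<in>charts M. fst c) \<inter> W"
      by (auto simp: open_submanifold_def split_beta)
    then show ?thesis using M by (simp add: complex_manifold_def)
  qed
  have hol: "holomorphic_Cn (mdim M) (mdim M) (\<phi> ` (U \<inter> W \<inter> (V \<inter> W))) (\<lambda>z. \<psi> (inv_into (U \<inter> W) \<phi> z))"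
    if U: "(U, \<phi>) \<in> charts M" and V: "(V, \<psi>) \<in> charts M" for U \<phi> V \<psi>
    unfolding holomorphic_Cn_def
  proof (intro ballI conjI allI impI)
    fix z assume "z \<in> \<phi> ` (U \<inter> W \<inter> (V \<inter> W))"
    then obtain x where x: "x \<in> U" "x \<in> V" "x \<in> W" "z = \<phi> x" by blast
    have inv: "inv_into (U \<inter> W) \<phi> z = x"
      using x inj_on_subset[OF is_chart_inj[OF manifold_is_chart[OF M U]], of "U \<inter> W"] by auto
    show "\<psi> (inv_into (U \<inter> W) \<phi> z) \<in> Cn (mdim M)"
      using chart_point_in_Cn[OF M V x(2)] by (simp add: inv)
    fix j assume "j < mdim M"
    then have "mdiff M (\<lambda>y. \<psi> y j) x"
      using mdiff_atlas_chart[OF M subsetD[OF charts_subset_atlas[OF M] V] x(2)] by blast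
    then show "\<exists>a. has_complex_gradient (mdim M) (\<lambda>w. \<psi> (inv_into (U \<inter> W) \<phi> w) j) a z"
      using open_submanifold_hdiff[OF U x(1,3), of "\<lambda>y. \<psi> y j"] x(4) by (simp add: hdiff_def)
  qed
  show "compatible_charts (mdim (open_submanifold M W)) c d"
    if cd: "c \<in> charts (open_submanifold M W)" "d \<in> charts (open_submanifold M W)" for c d
  proof -
    obtain U \<phi> V \<psi> where "c = (U \<inter> W, \<phi>)" "(U, \<phi>) \<in> charts M" "d = (V \<inter> W, \<psi>)" "(V, \<psi>) \<in> charts M"
      using cd by (auto simp: open_submanifold_def)
    then show ?thesis using hol[of U \<phi> V \<psi>] hol[of V \<psi> U \<phi>]
      by (simp add: compatible_charts_def Int_commute)
  qed
qed

end

text \<open>Lets a trivialisation over the whole base be literally the identity of the total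
  space.\<close>

lemma open_submanifold_points:
  assumes "complex_manifold M" shows "open_submanifold M (points M) = M"
proof -
  have "(\<lambda>(U, \<phi>). (U \<inter> points M, \<phi>)) c = c" if "c \<in> charts M" for c
    using is_chart_subset[of "mtop M" "mdim M" "fst c" "snd c"] manifold_is_chart[OF assms that]
    by (auto simp: split_beta prod_eq_iff)
  then have "(\<lambda>(U, \<phi>). (U \<inter> points M, \<phi>)) ` charts M = (\<lambda>c. c) ` charts M"
    by (intro image_cong) auto
  then show ?thesis by (simp add: open_submanifold_def)
qed

lemma embedded_submanifold_sel [simp]:
  "mtop (embedded_submanifold M k S) = subtopology (mtop M) S"
  "mdim (embedded_submanifold M k S) = k"
  by (simp_all add: embedded_submanifold_def)

text \<open>\<open>embedded_submanifold\<close> merely collects the slice charts there are; the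
  assumption \<open>slice\<close> says that they cover, and this makes the result a
  manifold.\<close>

locale embedded =
  fixes M :: "'a cmanifold" and k S
  assumes M: "complex_manifold M" and k: "k \<le> mdim M"
    and slice: "\<And>x. x \<in> points M \<Longrightarrow> x \<in> S \<Longrightarrow>
      \<exists>U \<phi>. (U, \<phi>) \<in> maximal_atlas M \<and> \<phi> ` (U \<inter> S) = \<phi> ` U \<inter> Cn k \<and> x \<in> U"
begin

abbreviation "E \<equiv> embedded_submanifold M k S"

lemma charts_E: "c \<in> charts E \<longleftrightarrow>
    (\<exists>U \<phi>. c = (U \<inter> S, \<phi>) \<and> (U, \<phi>) \<in> maximal_atlas M \<and> \<phi> ` (U \<inter> S) = \<phi> ` U \<inter> Cn k)"
  by (auto simp: embedded_submanifold_def)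

lemma Cn_subset: "Cn k \<subseteq> Cn (mdim M)"
  using k by (auto simp: Cn_def)

context
  fixes U \<phi> assumes U: "(U, \<phi>) \<in> maximal_atlas M" "\<phi> ` (U \<inter> S) = \<phi> ` U \<inter> Cn k"
begin

lemma slice_is_chart: "is_chart (mtop M) (mdim M) (U, \<phi>)"
  using U by (simp add: maximal_atlas_def)

lemma is_chart_E: "is_chart (mtop E) k (U \<inter> S, \<phi>)"
proof (rule is_chartI)
  note c = slice_is_chart
  have "openin (Cn_topology (mdim M)) (\<phi> ` U)" using c by (simp add: is_chart_def)
  then obtain O' where O': "open O'" "\<phi> ` U = Cn (mdim M) \<inter> O'"
    by (auto simp: Cn_topology_def openin_open)
  show "openin (mtop E) (U \<inter> S)"
    using is_chart_openin[OF c] by (auto simp: openin_subtopology)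
  have "\<phi> ` (U \<inter> S) = Cn k \<inter> O'" using U(2) O'(2) Cn_subset by auto
  then show "openin (Cn_topology k) (\<phi> ` (U \<inter> S))"
    using O'(1) by (auto simp: Cn_topology_def openin_open)
  have "subtopology (mtop E) (U \<inter> S) = subtopology (subtopology (mtop M) U) S"
    by (simp add: subtopology_subtopology Int_ac)
  moreover have "\<phi> ` (points M \<inter> U \<inter> S) \<subseteq> Cn k" using U(2) by auto
  ultimately show "continuous_map (subtopology (mtop E) (U \<inter> S)) (Cn_topology k) \<phi>"
    using continuous_map_from_subtopology[OF is_chart_continuous[OF c], of S]
    by (simp add: continuous_map_Cn_iff Int_ac)
  \<comment> \<open>\<open>Cn k\<close> and \<open>Cn (mdim M)\<close> both inherit their topology
    from the space of all sequences, so the image carries the same topology in either.\<close>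
  have "subtopology (Cn_topology k) (\<phi> ` (U \<inter> S)) =
      subtopology (subtopology (Cn_topology (mdim M)) (\<phi> ` U)) (\<phi> ` (U \<inter> S))"
    using Cn_subset U(2) by (auto simp: subtopology_subtopology Cn_topology_def intro!: arg_cong[of _ _ "subtopology euclidean"])
  then show "continuous_map (subtopology (Cn_topology k) (\<phi> ` (U \<inter> S))) (mtop E) (inv_into U \<phi>)"
    using continuous_map_from_subtopology[OF is_chart_inv_continuous[OF c]] is_chart_inj[OF c]
    by (auto simp: continuous_map_in_subtopology dest: inj_onD)
qed (use is_chart_inj[OF slice_is_chart] in auto)

lemma mdiff_imp_hdiff_E:
  assumes f: "mdiff M f x" and x: "x \<in> U" "x \<in> S"
  shows "hdiff k (\<lambda>w. f (inv_into (U \<inter> S) \<phi> w)) (\<phi> x)"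
proof -
  have "\<phi> x \<in> Cn k" using U(2) x by blast
  then have "hdiff k (\<lambda>w. f (inv_into U \<phi> w)) (\<phi> x)"
    using hdiff_restrict[OF _ k mdiff_imp_hdiff[OF M f U(1) x(1)]] by blast
  moreover have "openin (Cn_topology k) (\<phi> ` (U \<inter> S))" using is_chart_E by (simp add: is_chart_def)
  then have "hdiff k (\<lambda>w. f (inv_into (U \<inter> S) \<phi> w)) (\<phi> x) \<longleftrightarrow> hdiff k (\<lambda>w. f (inv_into U \<phi> w)) (\<phi> x)"
    by (rule hdiff_cong_openin)
      (use x inv_into_subset[OF is_chart_inj[OF slice_is_chart], of "U \<inter> S"] in auto)
  ultimately show ?thesis by simp
qed

end

text \<open>Through this the ambient coordinates become differentiable functions on the
  surface.\<close>

lemma mdiff_E: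
  assumes "mdiff M f x" "x \<in> points M" "x \<in> S"
  shows "mdiff E f x"
proof -
  obtain U \<phi> where U: "(U, \<phi>) \<in> maximal_atlas M" "\<phi> ` (U \<inter> S) = \<phi> ` U \<inter> Cn k" "x \<in> U"
    using slice[OF assms(2,3)] by blast
  have "(U \<inter> S, \<phi>) \<in> charts E" using U charts_E by blast
  then show ?thesis unfolding mdiff_def
    by (rule bexI[rotated]) (use mdiff_imp_hdiff_E[OF U(1,2) assms(1) U(3)] U(3) assms(3) in auto)
qed

lemma manifold: "complex_manifold E"
  unfolding complex_manifold_def
proof (intro conjI ballI)
  show "Hausdorff_space (mtop E)" "second_countable (mtop E)"
    using M by (auto simp: complex_manifold_def Hausdorff_space_subtopology second_countable_subtopology)
  show "is_chart (mtop E) (mdim E) c" if "c \<in> charts E" for c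
    using that is_chart_E by (auto simp: charts_E)
  show "(\<Union>c\<in>charts E. fst c) = points E"
  proof (intro equalityI subsetI)
    fix x assume "x \<in> (\<Union>c\<in>charts E. fst c)"
    then obtain U \<phi> where "(U, \<phi>) \<in> maximal_atlas M" "\<phi> ` (U \<inter> S) = \<phi> ` U \<inter> Cn k" "x \<in> U" "x \<in> S"
      by (auto simp: charts_E)
    then show "x \<in> points E" using is_chart_subset[OF slice_is_chart[of U \<phi>]] by auto
  next
    fix x assume "x \<in> points E"
    then obtain U \<phi> where "(U, \<phi>) \<in> maximal_atlas M" "\<phi> ` (U \<inter> S) = \<phi> ` U \<inter> Cn k" "x \<in> U" "x \<in> S"
      using slice[of x] by auto
    then show "x \<in> (\<Union>c\<in>charts E. fst c)" using charts_E by (intro UN_I[of "(U \<inter> S, \<phi>)"]) auto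
  qed
  \<comment> \<open>Transition maps between slice charts: an ambient chart coordinate is
    differentiable on \<open>M\<close>, and \<open>mdiff_imp_hdiff_E\<close> restricts it to the
    slice.\<close>
  have hol: "holomorphic_Cn k k (\<phi> ` (U \<inter> S \<inter> (V \<inter> S))) (\<lambda>z. \<psi> (inv_into (U \<inter> S) \<phi> z))"
    if U: "(U, \<phi>) \<in> maximal_atlas M" "\<phi> ` (U \<inter> S) = \<phi> ` U \<inter> Cn k"
      and V: "(V, \<psi>) \<in> maximal_atlas M" "\<psi> ` (V \<inter> S) = \<psi> ` V \<inter> Cn k" for U \<phi> V \<psi>
    unfolding holomorphic_Cn_def
  proof (intro ballI conjI allI impI)
    fix z assume "z \<in> \<phi> ` (U \<inter> S \<inter> (V \<inter> S))"
    then obtain x where x: "x \<in> U" "x \<in> V" "x \<in> S" "z = \<phi> x" by blast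
    have inv: "inv_into (U \<inter> S) \<phi> z = x"
      using x inj_on_subset[OF is_chart_inj[OF slice_is_chart[OF U]], of "U \<inter> S"] by auto
    show "\<psi> (inv_into (U \<inter> S) \<phi> z) \<in> Cn k" unfolding inv using V(2) x by blast
    fix j assume "j < k"
    then have "mdiff M (\<lambda>y. \<psi> y j) x"
      using mdiff_atlas_chart[OF M V(1) x(2)] k by simp
    then show "\<exists>a. has_complex_gradient k (\<lambda>w. \<psi> (inv_into (U \<inter> S) \<phi> w) j) a z"
      using mdiff_imp_hdiff_E[OF U _ x(1,3), of "\<lambda>y. \<psi> y j"] x(4) by (simp add: hdiff_def)
  qed
  show "compatible_charts (mdim E) c d" if cd: "c \<in> charts E" "d \<in> charts E" for c d
  proof -
    obtain U \<phi> V \<psi> where "c = (U \<inter> S, \<phi>)" "(U, \<phi>) \<in> maximal_atlas M" "\<phi> ` (U \<inter> S) = \<phi> ` U \<inter> Cn k"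
      "d = (V \<inter> S, \<psi>)" "(V, \<psi>) \<in> maximal_atlas M" "\<psi> ` (V \<inter> S) = \<psi> ` V \<inter> Cn k"
      using cd unfolding charts_E by blast
    then show ?thesis using hol[of U \<phi> V \<psi>] hol[of V \<psi> U \<phi>]
      by (simp add: compatible_charts_def Int_commute)
  qed
qed

end

section \<open>The ambient spaces and the torus\<close>

lemma hdiff_diff:
  assumes "z \<in> Cn n" "hdiff n f z" "hdiff n g z"
  shows "hdiff n (\<lambda>w. f w - g w) z"
  using hdiff_add[OF assms(1,2) hdiff_mult[OF assms(1) hdiff_const[of n "-1"] assms(3)]] by simp

lemma hdiff_divide:
  assumes "z \<in> Cn n" "hdiff n f z" "hdiff n g z" "g z \<noteq> 0"
  shows "hdiff n (\<lambda>w. f w / g w) z"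
proof -
  have "inverse field_differentiable at (g z)"
    using field_differentiable_inverse[of id "g z" UNIV] assms(4) by (simp add: field_differentiable_ident id_def)
  then show ?thesis unfolding divide_inverse
    by (intro hdiff_mult assms hdiff_field_compose[where g=inverse])
qed

lemma complex_space_sel [simp]:
  "mtop (complex_space n) = Cn_topology n" "mdim (complex_space n) = n" "charts (complex_space n) = {(Cn n, id)}"
  by (simp_all add: complex_space_def)

lemma complex_manifold_complex_space: "complex_manifold (complex_space n)"
  using complex_space.manifold[of n] by (simp add: complex_space_def)

lemma mdiff_complex_space: "z \<in> Cn n \<Longrightarrow> mdiff (complex_space n) f z \<longleftrightarrow> hdiff n f z"
  using complex_space.mdiff_eq[of z n f] by (simp add: complex_space_def)

lemma continuous_map_CnI:
  assumes "complex_manifold M" "\<And>x. x \<in> points M \<Longrightarrow> f x \<in> Cn n"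
    "\<And>x j. x \<in> points M \<Longrightarrow> j < n \<Longrightarrow> mdiff M (\<lambda>y. f y j) x"
  shows "continuous_map (mtop M) (Cn_topology n) f"
  unfolding continuous_map_Cn_iff
proof (intro conjI allI)
  fix i show "continuous_map (mtop M) euclidean (\<lambda>x. f x i)"
  proof (cases "i < n")
    case True
    then show ?thesis by (intro mdiff_imp_continuous_map assms)
  next
    case False
    \<comment> \<open>From \<open>n\<close> on nothing is assumed about differentiability, but the
      coordinates are 0 there.\<close>
    have "continuous_map (mtop M) euclidean (\<lambda>_. 0 :: complex)" by simp
    then show ?thesis
      by (rule continuous_map_eq) (use assms(2) False in \<open>simp add: Cn_def\<close>)
  qed
qed (use assms in auto)

lemma holomorphic_map_complex_spaceI:
  assumes "complex_manifold M" "\<And>x. x \<in> points M \<Longrightarrow> f x \<in> Cn n"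
    "\<And>x j. x \<in> points M \<Longrightarrow> j < n \<Longrightarrow> mdiff M (\<lambda>y. f y j) x"
  shows "holomorphic_map M (complex_space n) f"
  by (rule holomorphic_mapI) (use assms in \<open>auto simp: complex_manifold_complex_space continuous_map_CnI\<close>)

lemma complex_manifold_complex_line: "complex_manifold complex_line"
  using complex_line.manifold by (simp add: complex_line_def)

lemma complex_line_sel [simp]:
  "mtop complex_line = euclidean" "mdim complex_line = 1"
  "charts complex_line = {(UNIV, \<lambda>z i. if i = 0 then z else 0)}"
  by (simp_all add: complex_line_def)

lemma mdiff_complex_line: "mdiff complex_line f z \<longleftrightarrow> hdiff 1 (\<lambda>w. f (w 0)) (\<lambda>i. if i = 0 then z else 0)"
  using complex_line.mdiff_eq[of z f] by (simp add: complex_line_def)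

lemma holomorphic_map_complex_lineI:
  assumes "complex_manifold M" "\<And>x. x \<in> points M \<Longrightarrow> mdiff M f x"
  shows "holomorphic_map M complex_line f"
  by (rule holomorphic_mapI)
    (use assms in \<open>auto simp: complex_manifold_complex_line mdiff_imp_continuous_map\<close>)

lemma holomorphic_map_complex_lineD:
  assumes "complex_manifold M" "holomorphic_map M complex_line f" "x \<in> points M"
  shows "mdiff M f x"
proof -
  have "mdiff complex_line (\<lambda>z. z) (f x)"
    unfolding mdiff_complex_line by (rule hdiff_coordinate) (simp add: Cn_def)
  then show ?thesis
    using holomorphic_map_pullback[OF assms(1) complex_manifold_complex_line assms(2,3)] by blast
qed

section \<open>The multiplicative group as a complex Lie group\<close>

lemma open_nonzero: "openin (mtop complex_line) (UNIV - {0})"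
  by (simp add: open_delete)

lemma complex_manifold_Cstar: "complex_manifold Cstar_manifold"
  unfolding Cstar_manifold_def
  by (rule complex_manifold_open_submanifold[OF complex_manifold_complex_line open_nonzero])

lemma Cstar_sel [simp]:
  "mtop Cstar_manifold = top_of_set (UNIV - {0})" "mdim Cstar_manifold = 1" "carrier Cstar = UNIV - {0}"
  "s \<otimes>\<^bsub>Cstar\<^esub> t = s * t" "\<one>\<^bsub>Cstar\<^esub> = 1"
  "charts Cstar_manifold = {(UNIV - {0}, \<lambda>z i. if i = 0 then z else 0)}"
  by (simp_all add: Cstar_manifold_def Cstar_def open_submanifold_def)

lemma mdiff_Cstar: "z \<noteq> 0 \<Longrightarrow> mdiff Cstar_manifold (\<lambda>z. z) z"
  unfolding Cstar_manifold_def
  by (subst mdiff_open_submanifold[OF complex_manifold_complex_line open_nonzero])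
    (auto simp: mdiff_complex_line Cn_def intro!: hdiff_coordinate)

lemma holomorphic_map_CstarI:
  assumes "complex_manifold M" "\<And>x. x \<in> points M \<Longrightarrow> mdiff M f x" "\<And>x. x \<in> points M \<Longrightarrow> f x \<noteq> 0"
  shows "holomorphic_map M Cstar_manifold f"
  by (rule holomorphic_mapI)
    (use assms in \<open>auto simp: complex_manifold_Cstar mdiff_imp_continuous_map continuous_map_in_subtopology\<close>)

lemma mdiff_inverse:
  assumes "complex_manifold M" "x \<in> points M" "mdiff M f x" "f x \<noteq> 0"
  shows "mdiff M (\<lambda>y. inverse (f y)) x"
  by (rule mdiff_field_compose[OF assms(1-3), of inverse])
    (use field_differentiable_inverse[of id "f x" UNIV] assms(4) in \<open>simp add: field_differentiable_ident id_def\<close>)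

lemma complex_lie_group_Cstar: "complex_lie_group Cstar Cstar_manifold"
proof -
  note L = complex_manifold_Cstar and LL = complex_manifold_product[OF complex_manifold_Cstar complex_manifold_Cstar]
  have gr: "group Cstar"
  proof (rule groupI)
    fix x assume "x \<in> carrier Cstar"
    then show "\<exists>y\<in>carrier Cstar. y \<otimes>\<^bsub>Cstar\<^esub> x = \<one>\<^bsub>Cstar\<^esub>" by (intro bexI[of _ "inverse x"]) auto
  qed auto
  have inv: "inv\<^bsub>Cstar\<^esub> x = inverse x" if "x \<noteq> 0" for x
    using group.inv_equality[OF gr, of "inverse x" x] that by simp
  have "holomorphic_map (product_manifold Cstar_manifold Cstar_manifold) Cstar_manifold (\<lambda>(s, t). s \<otimes>\<^bsub>Cstar\<^esub> t)"
    unfolding split_beta Cstar_sel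
  proof (rule holomorphic_map_CstarI[OF LL])
    fix x assume x: "x \<in> points (product_manifold Cstar_manifold Cstar_manifold)"
    have "mdiff Cstar_manifold (\<lambda>z. z) (fst x)" "mdiff Cstar_manifold (\<lambda>z. z) (snd x)"
      using x by (auto intro: mdiff_Cstar)
    then show "mdiff (product_manifold Cstar_manifold Cstar_manifold) (\<lambda>x. fst x * snd x) x"
      using mdiff_mult[OF LL x mdiff_fst[OF L L x] mdiff_snd[OF L L x]] by blast
  qed auto
  moreover have "holomorphic_map Cstar_manifold Cstar_manifold (m_inv Cstar)"
  proof (rule holomorphic_map_CstarI[OF L])
    fix x assume x: "x \<in> points Cstar_manifold"
    have o: "openin (mtop Cstar_manifold) (points Cstar_manifold)" by (rule openin_topspace)
    have "mdiff Cstar_manifold inverse x"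
      using mdiff_inverse[OF L x mdiff_Cstar] x by simp
    then show "mdiff Cstar_manifold (m_inv Cstar) x"
      by (subst mdiff_cong[OF L o x, where g=inverse]) (auto simp: inv)
  qed (auto simp: inv)
  ultimately show ?thesis using gr L by (simp add: complex_lie_group_def)
qed

section \<open>Three-space and its maximal atlas\<close>

lemma complex_3space_sel [simp]:
  "mtop complex_3space = euclidean" "mdim complex_3space = 3" "charts complex_3space = {(UNIV, coord3)}"
  by (simp_all add: complex_3space_def)

lemma complex_manifold_complex_3space: "complex_manifold complex_3space"
  using complex_3space.manifold by (simp add: complex_3space_def)

lemma mdiff_complex_3space:
  "mdiff complex_3space f z \<longleftrightarrow> hdiff 3 (\<lambda>w. f (w 0, w 1, w 2)) (coord3 z)"
  using complex_3space.mdiff_eq[of z f] by (simp add: complex_3space_def)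

lemma coord3_Cn: "coord3 z \<in> Cn 3"
  by (auto simp: Cn_def split_beta)

lemma coord3_Cn2: "coord3 (a, b, c) \<in> Cn 2 \<longleftrightarrow> c = 0"
proof
  assume "coord3 (a, b, c) \<in> Cn 2"
  then have "coord3 (a, b, c) 2 = 0" unfolding Cn_def by blast
  then show "c = 0" by simp
qed (auto simp: Cn_def)

lemma coord3_of_Cn: "w \<in> Cn 3 \<Longrightarrow> coord3 (w 0, w 1, w 2) = w"
  using complex_3space.right_inv by blast

lemma less_3_cases: "j < 3 \<Longrightarrow> j = 0 \<or> j = 1 \<or> j = (2::nat)"
  by auto

lemma continuous_map_tripleI:
  assumes M: "complex_manifold M"
    and f: "\<And>x. x \<in> points M \<Longrightarrow> mdiff M (\<lambda>y. fst (f y)) x"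
      "\<And>x. x \<in> points M \<Longrightarrow> mdiff M (\<lambda>y. fst (snd (f y))) x"
      "\<And>x. x \<in> points M \<Longrightarrow> mdiff M (\<lambda>y. snd (snd (f y))) x"
  shows "continuous_map (mtop M) (euclidean :: (complex \<times> complex \<times> complex) topology) f"
proof -
  have "continuous_map (mtop M) euclidean (\<lambda>y. (fst (f y), fst (snd (f y)), snd (snd (f y))))"
    unfolding prod_topology_euclidean[symmetric]
    by (intro continuous_map_pairedI mdiff_imp_continuous_map[OF M] f)
  then show ?thesis by simp
qed

text \<open>Differentiability of the coordinates is assumed at all points because the chain rule
  uses continuity of \<open>f\<close>, which is obtained globally.\<close>

lemma mdiff_comp_triple:
  assumes M: "complex_manifold M" and x: "x \<in> points M"
    and f: "\<And>x. x \<in> points M \<Longrightarrow> mdiff M (\<lambda>y. fst (f y)) x"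
      "\<And>x. x \<in> points M \<Longrightarrow> mdiff M (\<lambda>y. fst (snd (f y))) x"
      "\<And>x. x \<in> points M \<Longrightarrow> mdiff M (\<lambda>y. snd (snd (f y))) x"
    and h: "mdiff complex_3space h (f x)"
  shows "mdiff M (\<lambda>y. h (f y)) x"
proof (rule mdiff_comp_chart[OF M complex_manifold_complex_3space])
  show "continuous_map (mtop M) (mtop complex_3space) f"
    using continuous_map_tripleI[OF M f] by simp
  show "(UNIV, coord3) \<in> charts complex_3space" "f x \<in> UNIV" by auto
  fix j assume "j < mdim complex_3space"
  then show "mdiff M (\<lambda>y. coord3 (f y) j) x"
    using f[OF x] by (auto simp: split_beta dest!: less_3_cases)
qed (fact x h)+

text \<open>Recognises a chart from an explicit inverse \<open>g\<close>. Continuity in both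
  directions comes from differentiability on \<open>U\<close> and on its image, and compatibility
  has only to be checked against \<open>coord3\<close>.\<close>

lemma chart_3space:
  assumes U: "open U" and \<phi>: "\<And>z. z \<in> U \<Longrightarrow> \<phi> z \<in> Cn 3"
    and \<phi>d: "\<And>z j. z \<in> U \<Longrightarrow> j < 3 \<Longrightarrow> mdiff complex_3space (\<lambda>y. \<phi> y j) z"
    and W: "openin (Cn_topology 3) (\<phi> ` U)" and inv: "\<And>z. z \<in> U \<Longrightarrow> g (\<phi> z) = z"
    and g: "\<And>w. w \<in> \<phi> ` U \<Longrightarrow> hdiff 3 (\<lambda>w. fst (g w)) w"
      "\<And>w. w \<in> \<phi> ` U \<Longrightarrow> hdiff 3 (\<lambda>w. fst (snd (g w))) w"
      "\<And>w. w \<in> \<phi> ` U \<Longrightarrow> hdiff 3 (\<lambda>w. snd (snd (g w))) w"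
  shows "(U, \<phi>) \<in> maximal_atlas complex_3space"
proof -
  note C = complex_manifold_complex_3space
  have oU: "openin (mtop complex_3space) U" using U by simp
  have oW: "openin (mtop (complex_space 3)) (\<phi> ` U)" using W by simp
  have chart: "is_chart euclidean 3 (U, \<phi>)"
  proof (rule is_chartI[where g=g])
    have "continuous_map (mtop (open_submanifold complex_3space U)) (Cn_topology 3) \<phi>"
      by (rule continuous_map_CnI[OF complex_manifold_open_submanifold[OF C oU]])
        (use \<phi> \<phi>d in \<open>auto simp: mdiff_open_submanifold[OF C oU]\<close>)
    then show "continuous_map (top_of_set U) (Cn_topology 3) \<phi>" by simp
    have "continuous_map (mtop (open_submanifold (complex_space 3) (\<phi> ` U))) euclidean g"
      by (rule continuous_map_tripleI[OF complex_manifold_open_submanifold[OF complex_manifold_complex_space oW]])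
        (use g \<phi> in \<open>auto simp: mdiff_open_submanifold[OF complex_manifold_complex_space oW] mdiff_complex_space\<close>)
    then show "continuous_map (subtopology (Cn_topology 3) (\<phi> ` U)) euclidean g" by simp
  qed (use U W inv in auto)
  have inj: "inj_on \<phi> U" using is_chart_inj[OF chart] .
  have "holomorphic_Cn 3 3 (\<phi> ` U) (\<lambda>z. coord3 (inv_into U \<phi> z))"
    unfolding holomorphic_Cn_def
  proof (intro ballI conjI allI impI coord3_Cn)
    fix z j assume z: "z \<in> \<phi> ` U" and j: "j < (3::nat)"
    have "hdiff 3 (\<lambda>w. coord3 (inv_into U \<phi> w) j) z \<longleftrightarrow> hdiff 3 (\<lambda>w. coord3 (g w) j) z"
      by (rule hdiff_cong_openin[OF W z]) (use inj inv in auto)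
    moreover have "hdiff 3 (\<lambda>w. coord3 (g w) j) z"
      using less_3_cases[OF j] g[OF z] by (auto simp: split_beta)
    ultimately show "\<exists>a. has_complex_gradient 3 (\<lambda>w. coord3 (inv_into U \<phi> w) j) a z"
      by (simp add: hdiff_def)
  qed
  moreover have "holomorphic_Cn 3 3 (coord3 ` U) (\<lambda>z. \<phi> (inv_into UNIV coord3 z))"
    unfolding holomorphic_Cn_def
  proof (intro ballI conjI allI impI)
    fix z assume "z \<in> coord3 ` U"
    then obtain x where x: "x \<in> U" "z = coord3 x" by blast
    have c: "(UNIV, coord3) \<in> charts complex_3space" by simp
    then have "inv_into UNIV coord3 z = x"
      using is_chart_inj[OF manifold_is_chart[OF C c]] x(2) by simp
    then show "\<phi> (inv_into UNIV coord3 z) \<in> Cn 3" using \<phi>[OF x(1)] by simp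
    fix j :: nat assume "j < 3"
    then show "\<exists>a. has_complex_gradient 3 (\<lambda>w. \<phi> (inv_into UNIV coord3 w) j) a z"
      using \<phi>d[OF x(1)] mdiff_iff[OF C c, of x "\<lambda>y. \<phi> y j"] x(2) by (simp add: hdiff_def)
  qed
  ultimately show ?thesis using chart
    by (simp add: maximal_atlas_def compatible_charts_def)
qed

section \<open>Division by a coordinate\<close>

definition vec2 :: "complex \<Rightarrow> complex \<Rightarrow> cvec" where
  "vec2 u v = (\<lambda>i. if i = 0 then u else if i = 1 then v else 0)"

lemma vec2_simps [simp]: "vec2 u v 0 = u" "vec2 u v (Suc 0) = v" "vec2 u v \<in> Cn 2"
  by (auto simp: vec2_def Cn_def)

lemma vec2_of_Cn: "w \<in> Cn 2 \<Longrightarrow> vec2 (w 0) (w 1) = w"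
  by (rule Cn_eqI[of _ 2]) (auto simp: less_2_cases_iff)

lemma vec2_update: "(vec2 u v)(0 := u') = vec2 u' v" "(vec2 u v)(Suc 0 := v') = vec2 u v'"
  by (auto simp: vec2_def)

lemma continuous_on_vec2: "continuous_on S (\<lambda>x. vec2 (fst x) (snd x))"
proof (rule continuous_on_coordinatewise_then_product)
  fix i show "continuous_on S (\<lambda>x. vec2 (fst x) (snd x) i)"
    by (cases "i = 0"; cases "i = 1") (auto simp: vec2_def intro!: continuous_intros)
qed

text \<open>Taylor's formula of order one. The constant involves \<open>\<phi>\<close> only through
  its bound \<open>M\<close>, so the estimate is uniform over a family; it will be applied to all
  the functions \<open>v \<mapsto> f (vec2 u v)\<close> at once.\<close>

lemma second_order_remainder:
  assumes hol: "\<phi> holomorphic_on ball a (2 * d)" and d: "d > 0"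
    and M: "\<And>z. z \<in> ball a (2 * d) \<Longrightarrow> norm (\<phi> z) \<le> M" and z: "norm (z - a) \<le> d / 2"
  shows "norm (\<phi> z - \<phi> a - deriv \<phi> a * (z - a)) \<le> 8 * M / d\<^sup>2 * norm (z - a) ^ 2"
proof -
  have ball: "ball x (d / 2) \<subseteq> ball a (2 * d)" "cball x (d / 2) \<subseteq> ball a (2 * d)" "x \<in> ball a (2 * d)"
    if "x \<in> cball a (d / 2)" for x
    using that d by (auto simp: dist_norm) (smt (verit) dist_commute dist_norm dist_triangle)+
  have "norm ((deriv ^^ 0) \<phi> z - (\<Sum>i\<le>1. (deriv ^^ i) \<phi> a * (z - a) ^ i / fact i))
      \<le> 8 * M / d\<^sup>2 * norm (z - a) ^ Suc 1 / fact 1"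
  proof (rule complex_Taylor[where f="\<lambda>i. (deriv ^^ i) \<phi>" and S="cball a (d / 2)"])
    fix i x assume x: "x \<in> cball a (d / 2)"
    have "(deriv ^^ i) \<phi> holomorphic_on ball a (2 * d)"
      by (rule holomorphic_higher_deriv[OF hol]) simp
    then show "((deriv ^^ i) \<phi> has_field_derivative (deriv ^^ Suc i) \<phi> x) (at x within cball a (d / 2))"
      using ball(3)[OF x] by (auto intro: holomorphic_derivI)
    \<comment> \<open>Cauchy's estimate on a disc of radius \<open>d / 2\<close>; its right-hand
      side is \<open>8 * M / d^2\<close>, the constant of the lemma.\<close>
    have "norm ((deriv ^^ 2) \<phi> x) \<le> fact 2 * M / (d / 2) ^ 2"
    proof (rule Cauchy_inequality)
      show "\<phi> holomorphic_on ball x (d / 2)" using hol ball(1)[OF x] holomorphic_on_subset by blast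
      show "continuous_on (cball x (d / 2)) \<phi>"
        using hol ball(2)[OF x] holomorphic_on_imp_continuous_on continuous_on_subset by blast
      fix y assume "norm (x - y) = d / 2"
      then have "y \<in> ball a (2 * d)" using ball(2)[OF x] by (auto simp: dist_norm)
      then show "norm (\<phi> y) \<le> M" by (rule M)
    qed (use d in simp)
    then show "norm ((deriv ^^ Suc 1) \<phi> x) \<le> 8 * M / d\<^sup>2"
      by (simp add: numeral_2_eq_2 power_divide)
  qed (use z d in \<open>auto simp: dist_norm norm_minus_commute\<close>)
  then show ?thesis by (simp add: numeral_2_eq_2 algebra_simps)
qed

definition quotient_at_0 :: "(complex \<Rightarrow> complex) \<Rightarrow> complex \<Rightarrow> complex" where
  "quotient_at_0 \<phi> u = (if u = 0 then deriv \<phi> 0 else (\<phi> u - \<phi> 0) / u)"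

text \<open>The derivative at 0 fills in the removable singularity of the quotient.\<close>

lemma quotient_at_0_holomorphic:
  assumes "\<phi> holomorphic_on S" "open S"
  shows "quotient_at_0 \<phi> holomorphic_on S"
  using pole_lemma_open[OF assms, of 0, unfolded diff_zero] by (simp add: quotient_at_0_def[abs_def])

lemma quotient_at_0_mult: "u * quotient_at_0 \<phi> u = \<phi> u - \<phi> 0"
  by (simp add: quotient_at_0_def)

text \<open>Cauchy's estimate on discs of radius \<open>r / 4\<close> bounds the derivative by
  \<open>4 * B / r\<close> near 0, and the mean value inequality carries this bound to the quotient.
  The dependence on \<open>B\<close> is linear, so a small remainder has a small quotient.\<close>

lemma quotient_at_0_bound:
  assumes hol: "\<phi> holomorphic_on ball 0 r" and r: "r > 0"
    and B: "\<And>u. u \<in> ball 0 r \<Longrightarrow> norm (\<phi> u) \<le> B" and u: "norm u < r / 4"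
  shows "norm (quotient_at_0 \<phi> u) \<le> 4 * B / r"
proof -
  have deriv_le: "norm (deriv \<phi> x) \<le> 4 * B / r" if x: "x \<in> ball 0 (r / 4)" for x
  proof -
    have sub: "cball x (r / 4) \<subseteq> ball 0 r" using x r by (auto simp: dist_norm) (smt (verit) dist_norm dist_triangle norm_triangle_ineq4 norm_minus_commute norm_triangle_sub)
    have "norm ((deriv ^^ 1) \<phi> x) \<le> fact 1 * B / (r / 4) ^ 1"
    proof (rule Cauchy_inequality)
      show "\<phi> holomorphic_on ball x (r / 4)"
        using hol sub ball_subset_cball holomorphic_on_subset by (metis subset_trans)
      show "continuous_on (cball x (r / 4)) \<phi>"
        using hol sub holomorphic_on_imp_continuous_on continuous_on_subset by blast
      fix y assume "norm (x - y) = r / 4"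
      then have "y \<in> ball 0 r" using sub by (auto simp: dist_norm)
      then show "norm (\<phi> y) \<le> B" by (rule B)
    qed (use r in simp)
    then show ?thesis by (simp add: field_simps)
  qed
  show ?thesis
  proof (cases "u = 0")
    case True
    then show ?thesis using deriv_le[of 0] r by (simp add: quotient_at_0_def)
  next
    case False
    have "norm (\<phi> u - \<phi> 0) \<le> 4 * B / r * norm (u - 0)"
    proof (rule field_differentiable_bound[where f'="deriv \<phi>" and S="ball 0 (r / 4)"])
      fix x assume x: "x \<in> ball (0::complex) (r / 4)"
      have "x \<in> ball 0 r" using x r by auto
      then show "(\<phi> has_field_derivative deriv \<phi> x) (at x within ball 0 (r / 4))"
        using hol by (auto intro: holomorphic_derivI)
    qed (use deriv_le u r in auto)
    then show ?thesis using False by (simp add: quotient_at_0_def norm_divide divide_le_eq)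
  qed
qed

lemma hdiff_partial:
  assumes "hdiff 2 f (vec2 u v)"
  shows "(\<lambda>z. f (vec2 z v)) field_differentiable (at u)" "(\<lambda>z. f (vec2 u z)) field_differentiable (at v)"
proof -
  obtain a where a: "has_complex_gradient 2 f a (vec2 u v)" using assms by (auto simp: hdiff_def)
  have "((\<lambda>z. f (vec2 (u + z) v)) has_field_derivative a 0) (at 0)"
    using gradient_partial[OF _ a, of 0] by (simp add: vec2_update)
  then show "(\<lambda>z. f (vec2 z v)) field_differentiable (at u)"
    unfolding field_differentiable_def using DERIV_at_within_shift[of "\<lambda>z. f (vec2 z v)" "a 0" u 0 UNIV] by auto
  have "((\<lambda>z. f (vec2 u (v + z))) has_field_derivative a 1) (at 0)"
    using gradient_partial[OF _ a, of 1] by (simp add: vec2_update)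
  then show "(\<lambda>z. f (vec2 u z)) field_differentiable (at v)"
    unfolding field_differentiable_def using DERIV_at_within_shift[of "\<lambda>z. f (vec2 u z)" "a 1" v 0 UNIV] by auto
qed

text \<open>One factor \<open>norm (w j - z j)\<close> is absorbed by the Euclidean norm in the
  denominator and the other tends to 0, so the gradient is 0.\<close>

lemma hdiff_of_second_order:
  assumes z: "z \<in> Cn n" and j: "j < n" and fz: "f z = 0"
    and bound: "eventually (\<lambda>w. norm (f w) \<le> C * norm (w j - z j) ^ 2) (at z within Cn n)"
  shows "hdiff n f z"
proof -
  let ?L = "\<lambda>w. L2_set (\<lambda>i. norm (w i - z i)) {..<n}"
  have c: "((\<lambda>w. w j) \<longlongrightarrow> z j) (at z within Cn n)"
    using continuous_coordinate[of z "Cn n" j] by (simp add: continuous_within)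
  have lim: "((\<lambda>w. \<bar>C\<bar> * norm (w j - z j)) \<longlongrightarrow> \<bar>C\<bar> * norm (z j - z j)) (at z within Cn n)"
    by (intro tendsto_intros c)
  have "((\<lambda>w. f w / of_real (?L w)) \<longlongrightarrow> 0) (at z within Cn n)"
  proof (rule Lim_null_comparison)
    have "eventually (\<lambda>w. w \<in> Cn n \<and> w \<noteq> z) (at z within Cn n)" by (simp add: eventually_at_filter)
    then show "eventually (\<lambda>w. norm (f w / of_real (?L w)) \<le> \<bar>C\<bar> * norm (w j - z j)) (at z within Cn n)"
      using bound
    proof eventually_elim
      fix w assume w: "w \<in> Cn n \<and> w \<noteq> z" and b: "norm (f w) \<le> C * norm (w j - z j) ^ 2"
      have L: "?L w > 0" using L2_set_pos_Cn[OF z] w by blast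
      have le: "norm (w j - z j) \<le> ?L w" by (rule member_le_L2_set) (use j in auto)
      have "norm (f w) \<le> \<bar>C\<bar> * norm (w j - z j) ^ 2"
        using b by (smt (verit) mult_right_mono zero_le_power2)
      also have "\<dots> \<le> \<bar>C\<bar> * norm (w j - z j) * ?L w"
        using mult_left_mono[OF le, of "\<bar>C\<bar> * norm (w j - z j)"] by (simp add: power2_eq_square mult.assoc)
      finally show "norm (f w / of_real (?L w)) \<le> \<bar>C\<bar> * norm (w j - z j)"
        using L by (simp add: norm_divide divide_le_eq)
    qed
  qed (use lim in simp)
  then have "has_complex_gradient n f (\<lambda>_. 0) z" by (simp add: has_complex_gradient_def fz)
  then show ?thesis by (auto simp: hdiff_def)
qed

text \<open>\<open>quotient_at_0\<close> is bounded on bounded holomorphic functions and \<open>v \<mapsto> f (\<cdot>, v)\<close> is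
  differentiable in the supremum norm, so applying \<open>quotient_at_0\<close> in the first variable keeps
  differentiability in the second.\<close>

lemma hdiff_quotient_0:
  assumes r: "r > 0" and f: "\<And>u v. norm u < r \<Longrightarrow> norm (v - b) < r \<Longrightarrow> hdiff 2 f (vec2 u v)"
  shows "hdiff 2 (\<lambda>w. quotient_at_0 (\<lambda>u. f (vec2 u (w 1))) (w 0)) (vec2 0 b)"
proof -
  \<comment> \<open>With \<open>2 * d = r / 2\<close> the closed bidisc below lies inside the region
    where \<open>f\<close> is differentiable, so compactness bounds \<open>f\<close> on it.\<close>
  define d where "d = r / 4"
  have d: "d > 0" using r by (simp add: d_def)
  define F where "F = (\<lambda>x. f (vec2 (fst x) (snd x)))"
  have "continuous_on (cball 0 (2 * d) \<times> cball b (2 * d)) F"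
    unfolding F_def
  proof (rule continuous_on_compose2[OF _ continuous_on_vec2])
    show "continuous_on ((\<lambda>x. vec2 (fst x) (snd x)) ` (cball 0 (2 * d) \<times> cball b (2 * d))) f"
      unfolding continuous_on_eq_continuous_within
    proof clarsimp
      fix u v :: complex assume "norm u \<le> 2 * d" "dist b v \<le> 2 * d"
      then have "hdiff 2 f (vec2 u v)" using f[of u v] r by (simp add: d_def dist_norm norm_minus_commute)
      then show "continuous (at (vec2 u v) within (\<lambda>x. vec2 (fst x) (snd x)) ` (cball 0 (2 * d) \<times> cball b (2 * d))) f"
        by (intro continuous_within_subset[OF hdiff_imp_continuous]) auto
    qed
  qed auto
  then have "bounded (F ` (cball 0 (2 * d) \<times> cball b (2 * d)))"
    by (intro compact_imp_bounded compact_continuous_image compact_Times) auto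
  then obtain M where M': "\<forall>x\<in>F ` (cball 0 (2 * d) \<times> cball b (2 * d)). norm x \<le> M"
    unfolding bounded_iff by blast
  have M: "norm (f (vec2 u v)) \<le> M" if "u \<in> cball 0 (2 * d)" "v \<in> cball b (2 * d)" for u v
    using bspec[OF M' imageI[OF SigmaI[OF that]]] by (simp add: F_def)
  define \<phi> where "\<phi> = (\<lambda>v u. f (vec2 u v))"
  define D where "D = (\<lambda>u. deriv (\<lambda>v. f (vec2 u v)) b)"
  have hu: "\<phi> v holomorphic_on ball 0 (2 * d)" if "v \<in> ball b (2 * d)" for v
    unfolding \<phi>_def holomorphic_on_def
    by (intro ballI field_differentiable_at_within[OF hdiff_partial(1)] f)
      (use that r in \<open>simp_all add: d_def dist_norm norm_minus_commute\<close>)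
  have hv: "(\<lambda>v. f (vec2 u v)) holomorphic_on ball b (2 * d)" if "u \<in> ball 0 (2 * d)" for u
    unfolding holomorphic_on_def
    by (intro ballI field_differentiable_at_within[OF hdiff_partial(2)] f)
      (use that r in \<open>simp_all add: d_def dist_norm norm_minus_commute\<close>)
  \<comment> \<open>Splits \<open>\<phi> v\<close> at \<open>v = b\<close> into value, linear term
    and remainder, all as functions of \<open>u\<close>. The remainder is of second order in
    \<open>v - b\<close>, uniformly in \<open>u\<close>.\<close>
  define R where "R = (\<lambda>v u. \<phi> v u - \<phi> b u - D u * (v - b))"
  have R: "norm (R v u) \<le> 8 * M / d\<^sup>2 * norm (v - b) ^ 2"
    if "norm (v - b) \<le> d / 2" "u \<in> ball 0 (2 * d)" for u v
    unfolding R_def \<phi>_def D_def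
    using that M by (intro second_order_remainder[OF hv d]) auto
  \<comment> \<open>\<open>D\<close> is a derivative in the other variable, so its holomorphy in
    \<open>u\<close> is not immediate. The estimate for \<open>R\<close> shows that the difference
    quotients in \<open>v\<close>, which are holomorphic in \<open>u\<close>, converge to it
    uniformly.\<close>
  have hD: "D holomorphic_on ball 0 (2 * d)"
  proof (rule holomorphic_uniform_sequence)
    \<comment> \<open>Nonzero increments tending to 0 and of size at most \<open>d / 2\<close>,
      where the estimate for \<open>R\<close> is valid.\<close>
    define h where "h = (\<lambda>n. of_real (d / 2 / real (Suc n)) :: complex)"
    have h: "h n \<noteq> 0" "norm (h n) \<le> d / 2" "norm (h n) = d / 2 / real (Suc n)" for n
      using d by (auto simp: h_def norm_divide divide_le_eq simp del: of_nat_Suc)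
    show "(\<lambda>u. (\<phi> (b + h n) u - \<phi> b u) / h n) holomorphic_on ball 0 (2 * d)" for n
      using h(1,2)[of n] d by (intro holomorphic_intros hu) (simp_all add: dist_norm)
    have est: "norm ((\<phi> (b + h n) u - \<phi> b u) / h n - D u) \<le> 8 * M / d\<^sup>2 * norm (h n)"
      if "u \<in> ball 0 (2 * d)" for n u
    proof -
      have "(\<phi> (b + h n) u - \<phi> b u) / h n - D u = R (b + h n) u / h n"
        using h(1)[of n] by (simp add: R_def field_simps)
      moreover have "norm (R (b + h n) u) \<le> 8 * M / d\<^sup>2 * norm (h n) ^ 2"
        using R[of "b + h n" u] h(2) that by simp
      ultimately show ?thesis using h(1)[of n]
        by (simp add: norm_divide divide_le_eq power2_eq_square mult.assoc)
    qed
    have lim: "(\<lambda>n. 8 * M / d\<^sup>2 * norm (h n)) \<longlonglongrightarrow> 8 * M / d\<^sup>2 * 0"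
      unfolding h(3) by (intro tendsto_mult tendsto_const LIMSEQ_Suc[OF lim_const_over_n])
    show "\<exists>e>0. cball x e \<subseteq> ball 0 (2 * d) \<and>
        uniform_limit (cball x e) (\<lambda>n u. (\<phi> (b + h n) u - \<phi> b u) / h n) D sequentially"
      if x: "x \<in> ball 0 (2 * d)" for x
    proof -
      obtain e where e: "e > 0" "cball x e \<subseteq> ball 0 (2 * d)"
        using x open_contains_cball open_ball by blast
      have "uniform_limit (cball x e) (\<lambda>n u. (\<phi> (b + h n) u - \<phi> b u) / h n) D sequentially"
      proof (rule uniform_limitI)
        fix \<epsilon> :: real assume "\<epsilon> > 0"
        then have "eventually (\<lambda>n. 8 * M / d\<^sup>2 * norm (h n) < \<epsilon>) sequentially"
          using order_tendstoD(2)[OF lim, of \<epsilon>] by simp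
        then show "eventually (\<lambda>n. \<forall>u\<in>cball x e. dist ((\<phi> (b + h n) u - \<phi> b u) / h n) (D u) < \<epsilon>) sequentially"
        proof eventually_elim
          case (elim n)
          show ?case
          proof
            fix u assume "u \<in> cball x e"
            with e(2) have "u \<in> ball 0 (2 * d)" by blast
            from order.strict_trans1[OF est[OF this] elim]
            show "dist ((\<phi> (b + h n) u - \<phi> b u) / h n) (D u) < \<epsilon>" by (simp only: dist_norm)
          qed
        qed
      qed
      then show ?thesis using e by blast
    qed
  qed simp
  have hR: "R v holomorphic_on ball 0 (2 * d)" if "v \<in> ball b (2 * d)" for v
    unfolding R_def using that d by (intro holomorphic_intros hu hD) auto
  define Q where "Q = quotient_at_0"
  \<comment> \<open>\<open>Q\<close> is linear in the function it acts on and is applied to the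
    splitting that defines \<open>R\<close>. For \<open>u = 0\<close> this is linearity of the
    derivative, which is where holomorphy of \<open>D\<close> is used.\<close>
  have add: "Q (\<phi> v) u = Q (\<phi> b) u + Q D u * (v - b) + Q (R v) u"
    if v: "v \<in> ball b (2 * d)" for u v
  proof (cases "u = 0")
    case True
    have 0: "(0::complex) \<in> ball 0 (2 * d)" using d by simp
    have fd: "\<And>g. g holomorphic_on ball 0 (2 * d) \<Longrightarrow> g field_differentiable (at 0)"
      using 0 holomorphic_on_imp_differentiable_at by blast
    have fds: "\<phi> v field_differentiable (at 0)" "\<phi> b field_differentiable (at 0)" "D field_differentiable (at 0)"
      using fd hu hD v d by auto
    have "deriv (R v) 0 = deriv (\<phi> v) 0 - deriv (\<phi> b) 0 - deriv D 0 * (v - b)"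
      unfolding R_def
      by (rule DERIV_imp_deriv) (use fds in \<open>auto intro!: derivative_eq_intros simp: field_differentiable_derivI\<close>)
    then show ?thesis using True by (simp add: Q_def quotient_at_0_def)
  next
    case False
    then show ?thesis by (simp add: Q_def quotient_at_0_def R_def field_simps)
  qed
  have Qd: "Q g field_differentiable (at 0)" if "g holomorphic_on ball 0 (2 * d)" for g
    using quotient_at_0_holomorphic[OF that] d unfolding Q_def
    by (intro holomorphic_on_imp_differentiable_at[of _ "ball 0 (2 * d)"]) auto
  have z: "vec2 0 b \<in> Cn 2" by simp
  have d1: "hdiff 2 (\<lambda>w. Q (\<phi> b) (w 0)) (vec2 0 b)"
    by (rule hdiff_field_compose[OF z hdiff_coordinate[OF z]]) (use Qd hu d in simp)
  have d2: "hdiff 2 (\<lambda>w. Q D (w 0)) (vec2 0 b)"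
    by (rule hdiff_field_compose[OF z hdiff_coordinate[OF z]]) (use Qd hD in simp)
  \<comment> \<open>The constant is that of \<open>quotient_at_0_bound\<close> for radius
    \<open>2 * d\<close>, applied to the bound for \<open>R\<close>. The former asks for
    \<open>norm u < 2 * d / 4\<close>, the latter for \<open>norm (v - b) \<le> d / 2\<close>; hence
    the two neighbourhoods of size \<open>d / 2\<close>.\<close>
  have d3: "hdiff 2 (\<lambda>w. Q (R (w 1)) (w 0)) (vec2 0 b)"
  proof (rule hdiff_of_second_order[where j=1 and C="4 * (8 * M / d\<^sup>2) / (2 * d)"])
    have "R b = (\<lambda>u. 0)" by (simp add: R_def)
    then show "Q (R (vec2 0 b 1)) (vec2 0 b 0) = 0" by (simp add: Q_def quotient_at_0_def)
    have e0: "eventually (\<lambda>w. dist (w 0) 0 < d / 2) (at (vec2 0 b) within Cn 2)"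
      using tendstoD[OF continuous_coordinate[of "vec2 0 b" "Cn 2" 0, unfolded continuous_within], of "d / 2"] d
      by simp
    have e1: "eventually (\<lambda>w. dist (w 1) b < d / 2) (at (vec2 0 b) within Cn 2)"
      using tendstoD[OF continuous_coordinate[of "vec2 0 b" "Cn 2" 1, unfolded continuous_within], of "d / 2"] d
      by simp
    show "eventually (\<lambda>w. norm (Q (R (w 1)) (w 0)) \<le> 4 * (8 * M / d\<^sup>2) / (2 * d) * norm (w 1 - vec2 0 b 1) ^ 2)
        (at (vec2 0 b) within Cn 2)"
      using e0 e1
    proof eventually_elim
      fix w :: cvec assume w: "dist (w 0) 0 < d / 2" "dist (w 1) b < d / 2"
      have "norm (Q (R (w 1)) (w 0)) \<le> 4 * (8 * M / d\<^sup>2 * norm (w 1 - b) ^ 2) / (2 * d)"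
        unfolding Q_def
        by (rule quotient_at_0_bound) (use w d hR[of "w 1"] R[of "w 1"] in \<open>auto simp: dist_norm norm_minus_commute\<close>)
      then show "norm (Q (R (w 1)) (w 0)) \<le> 4 * (8 * M / d\<^sup>2) / (2 * d) * norm (w 1 - vec2 0 b 1) ^ 2"
        by simp
    qed
  qed auto
  have sum: "hdiff 2 (\<lambda>w. Q (\<phi> b) (w 0) + Q D (w 0) * (w 1 - b) + Q (R (w 1)) (w 0)) (vec2 0 b)"
    by (intro hdiff_add hdiff_mult hdiff_diff hdiff_const hdiff_coordinate z d1 d2 d3)
  have "eventually (\<lambda>w. dist (w 1) b < 2 * d) (at (vec2 0 b) within Cn 2)"
    using tendstoD[OF continuous_coordinate[of "vec2 0 b" "Cn 2" 1, unfolded continuous_within], of "2 * d"] d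
    by simp
  then have "eventually (\<lambda>w. Q (\<phi> (w 1)) (w 0) = Q (\<phi> b) (w 0) + Q D (w 0) * (w 1 - b) + Q (R (w 1)) (w 0))
      (at (vec2 0 b) within Cn 2)"
    by (rule eventually_mono) (use add in \<open>auto simp: dist_commute\<close>)
  then have "hdiff 2 (\<lambda>w. Q (\<phi> (w 1)) (w 0)) (vec2 0 b)"
    by (subst hdiff_cong) (use sum add[of b] d in auto)
  then show ?thesis by (simp add: Q_def \<phi>_def)
qed

text \<open>Where the first coordinate is nonzero the function is locally an ordinary quotient; only
  the line on which it vanishes calls for \<open>hdiff_quotient_0\<close>.\<close>

lemma hdiff_quotient:
  assumes r: "r > 0" and f: "\<And>u v. norm u < r \<Longrightarrow> norm (v - b) < r \<Longrightarrow> hdiff 2 f (vec2 u v)"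
    and a: "norm a < r"
  shows "hdiff 2 (\<lambda>w. quotient_at_0 (\<lambda>u. f (vec2 u (w 1))) (w 0)) (vec2 a b)"
proof (cases "a = 0")
  case True
  then show ?thesis using hdiff_quotient_0[OF r f] by simp
next
  case False
  have z: "vec2 a b \<in> Cn 2" "vec2 0 b \<in> Cn 2" by simp_all
  have f0: "hdiff 2 (\<lambda>w. f (vec2 0 (w 1))) (vec2 a b)"
    by (rule hdiff_field_compose[OF z(1) hdiff_coordinate[OF z(1)], of "\<lambda>z. f (vec2 0 z)"])
      (use hdiff_partial(2)[OF f[of 0 b]] r in simp)
  have "hdiff 2 (\<lambda>w. (f w - f (vec2 0 (w 1))) / w 0) (vec2 a b)"
    using f[of a b] a r False by (intro hdiff_divide hdiff_diff hdiff_coordinate z f0) auto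
  moreover have "eventually (\<lambda>w. w 0 \<noteq> 0 \<and> w \<in> Cn 2) (at (vec2 a b) within Cn 2)"
  proof (rule eventually_conj)
    show "eventually (\<lambda>w. w 0 \<noteq> 0) (at (vec2 a b) within Cn 2)"
      using tendsto_imp_eventually_ne[OF continuous_coordinate[of "vec2 a b" "Cn 2" 0, unfolded continuous_within]] False
      by simp
  qed (simp add: eventually_at_filter)
  then have "eventually (\<lambda>w. quotient_at_0 (\<lambda>u. f (vec2 u (w 1))) (w 0) = (f w - f (vec2 0 (w 1))) / w 0)
      (at (vec2 a b) within Cn 2)"
    by (rule eventually_mono) (simp add: quotient_at_0_def vec2_of_Cn[simplified])
  ultimately show ?thesis
    by (subst hdiff_cong) (use False in \<open>auto simp: quotient_at_0_def\<close>)
qed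

section \<open>The surface\<close>

abbreviation surface_points :: "(complex \<Rightarrow> complex) \<Rightarrow> (complex \<times> complex \<times> complex) set" where
  "surface_points p \<equiv> {(u, v, x). u * v - p x = 0}"

definition mdiff3 :: "'a cmanifold \<Rightarrow> ('a \<Rightarrow> complex \<times> complex \<times> complex) \<Rightarrow> 'a \<Rightarrow> bool" where
  "mdiff3 M f x \<longleftrightarrow> mdiff M (\<lambda>y. fst (f y)) x \<and> mdiff M (\<lambda>y. fst (snd (f y))) x \<and>
     mdiff M (\<lambda>y. snd (snd (f y))) x"

lemma coord3_triple_Cn: "coord3 (a, b, c) \<in> Cn 3"
  by (rule coord3_Cn)

lemma mdiff3_complex_3space: "mdiff3 complex_3space (\<lambda>z. z) z"
  by (simp add: mdiff3_def mdiff_complex_3space hdiff_coordinate coord3_Cn)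

lemma mdiff3_snd:
  assumes "complex_manifold M" "complex_manifold N" "z \<in> points (product_manifold M N)" "mdiff3 N f (snd z)"
  shows "mdiff3 (product_manifold M N) (\<lambda>y. f (snd y)) z"
  using assms(4) mdiff_snd[OF assms(1-3), of "\<lambda>y. fst (f y)"]
    mdiff_snd[OF assms(1-3), of "\<lambda>y. fst (snd (f y))"] mdiff_snd[OF assms(1-3), of "\<lambda>y. snd (snd (f y))"]
  by (simp add: mdiff3_def)

text \<open>The \<open>q(x, w)\<close> of the overview: \<open>(p (x + w) - p x) / w\<close>, with
  the value \<open>deriv p x\<close> at \<open>w = 0\<close>.\<close>

definition translation_quotient :: "(complex \<Rightarrow> complex) \<Rightarrow> complex \<Rightarrow> complex \<Rightarrow> complex" where
  "translation_quotient p x w = quotient_at_0 (\<lambda>u. p (x + u)) w"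

lemma translation_quotient_mult: "w * translation_quotient p x w = p (x + w) - p x"
  using quotient_at_0_mult[of w "\<lambda>u. p (x + u)"] by (simp add: translation_quotient_def)

definition shear_v :: "(complex \<Rightarrow> complex) \<Rightarrow> complex \<Rightarrow> complex \<times> complex \<times> complex \<Rightarrow> complex \<times> complex \<times> complex" where
  "shear_v p a = (\<lambda>(u, v, x). (u, v + a * translation_quotient p x (a * u), x + a * u))"

definition shear_u :: "(complex \<Rightarrow> complex) \<Rightarrow> complex \<Rightarrow> complex \<times> complex \<times> complex \<Rightarrow> complex \<times> complex \<times> complex" where
  "shear_u p b = (\<lambda>(u, v, x). (u + b * translation_quotient p x (b * v), v, x + b * v))"

text \<open>Multiplied by \<open>u\<close>, the increment of \<open>v\<close> becomes
  \<open>p (x + a * u) - p x\<close>, which is exactly the change of \<open>p x\<close>; likewise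
  with \<open>u\<close> and \<open>v\<close> exchanged.\<close>

lemma shear_surface:
  assumes "z \<in> surface_points p"
  shows "shear_v p a z \<in> surface_points p" "shear_u p a z \<in> surface_points p"
  using assms translation_quotient_mult[of "a * fst z" p "snd (snd z)"]
    translation_quotient_mult[of "a * fst (snd z)" p "snd (snd z)"]
  by (auto simp: shear_v_def shear_u_def split_beta algebra_simps)

lemma shear_0 [simp]: "shear_v p 0 z = z" "shear_u p 0 z = z"
  by (auto simp: shear_v_def shear_u_def split_beta)

lemma torus_action_surface: "t \<noteq> 0 \<Longrightarrow> z \<in> surface_points p \<Longrightarrow> torus_action t z \<in> surface_points p"
  by (simp add: torus_action_def split_beta field_simps)

lemma torus_action_1 [simp]: "torus_action 1 z = z"
  by (auto simp: torus_action_def split_beta)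

lemma torus_action_mult: "torus_action (s * t) z = torus_action s (torus_action t z)"
  by (simp add: torus_action_def split_beta)

text \<open>The products \<open>a * u\<close> and \<open>b * v\<close> do not change when parameter
  and point are transformed together, so neither do the shift of \<open>x\<close> and the arguments
  of the quotient. The factor \<open>a\<close> or \<open>b\<close> in front of the quotient supplies
  the weight of the coordinate to which it is added.\<close>

lemma shear_equivariant:
  assumes "t \<noteq> 0"
  shows "shear_v p (inverse t * a) (torus_action t z) = torus_action t (shear_v p a z)"
    and "shear_u p (t * b) (torus_action t z) = torus_action t (shear_u p b z)"
proof -
  have eq: "inverse t * a * (t * u) = a * u" "t * b * (inverse t * u) = b * u" for u
    using assms by (simp_all add: field_simps)
  show "shear_v p (inverse t * a) (torus_action t z) = torus_action t (shear_v p a z)"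
    by (simp only: shear_v_def torus_action_def split_beta fst_conv snd_conv eq)
      (simp add: algebra_simps)
  show "shear_u p (t * b) (torus_action t z) = torus_action t (shear_u p b z)"
    by (simp only: shear_u_def torus_action_def split_beta fst_conv snd_conv eq)
      (simp add: algebra_simps)
qed

lemma mdiff3_torus_action:
  assumes M: "complex_manifold M" "x \<in> points M" and "mdiff3 M f x" "mdiff M t x" "t x \<noteq> 0"
  shows "mdiff3 M (\<lambda>y. torus_action (t y) (f y)) x"
  using assms by (simp add: mdiff3_def torus_action_def split_beta mdiff_mult[OF M] mdiff_inverse[OF M])

locale smooth_surface =
  fixes p :: "complex \<Rightarrow> complex"
  assumes hol: "p holomorphic_on UNIV" and simple: "\<And>z. p z = 0 \<Longrightarrow> deriv p z \<noteq> 0"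
begin

lemma p_differentiable: "p field_differentiable (at x)"
  using hol holomorphic_on_imp_differentiable_at by blast

lemma translation_quotient_0: "translation_quotient p x 0 = deriv p x"
  using deriv_shift_0[of p x] by (simp add: translation_quotient_def quotient_at_0_def o_def)

lemma mdiff_translation_quotient:
  assumes M: "complex_manifold M" and x: "x \<in> points M" and f: "mdiff M f x" and g: "mdiff M g x"
  shows "mdiff M (\<lambda>y. translation_quotient p (f y) (g y)) x"
proof -
  \<comment> \<open>The divisor comes first and the base point second, as
    \<open>hdiff_quotient\<close> divides by coordinate 0. Since \<open>p\<close> is entire, any
    radius exceeding \<open>norm (g x)\<close> will do.\<close>
  have "hdiff 2 (\<lambda>w. quotient_at_0 (\<lambda>u. p (vec2 u (w 1) 1 + vec2 u (w 1) 0)) (w 0)) (vec2 (g x) (f x))"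
    by (rule hdiff_quotient[where r="norm (g x) + 1" and f="\<lambda>w. p (w 1 + w 0)"])
      (auto intro!: hdiff_field_compose[OF _ hdiff_add p_differentiable] hdiff_coordinate add_nonneg_pos)
  then have "mdiff M (\<lambda>y. quotient_at_0 (\<lambda>u. p (vec2 (g y) (f y) 1 + u)) (vec2 (g y) (f y) 0)) x"
  proof (intro mdiff_compose[OF M openin_topspace x, where g="\<lambda>y. vec2 (g y) (f y)" and m=2
        and f="\<lambda>w. quotient_at_0 (\<lambda>u. p (w 1 + u)) (w 0)"])
    fix j :: nat assume "j < 2"
    then show "mdiff M (\<lambda>y. vec2 (g y) (f y) j) x" using f g by (auto simp: less_2_cases_iff)
  qed auto
  then show ?thesis by (simp add: translation_quotient_def)
qed

lemma mdiff3_shear: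
  assumes M: "complex_manifold M" "x \<in> points M" and "mdiff3 M f x" "mdiff M a x"
  shows "mdiff3 M (\<lambda>y. shear_v p (a y) (f y)) x" "mdiff3 M (\<lambda>y. shear_u p (a y) (f y)) x"
  using assms
  by (simp_all add: mdiff3_def shear_v_def shear_u_def split_beta
      mdiff_add[OF M] mdiff_mult[OF M] mdiff_translation_quotient[OF M])

subsection \<open>Slice charts\<close>

abbreviation "S \<equiv> surface_points p"

abbreviation defect :: "complex \<times> complex \<times> complex \<Rightarrow> complex" where
  "defect \<equiv> \<lambda>z. fst z * fst (snd z) - p (snd (snd z))"

lemma mdiff_defect: "mdiff complex_3space defect z"
proof -
  note M = complex_manifold_complex_3space
  have z: "z \<in> points complex_3space" by simp
  show ?thesis using mdiff3_complex_3space[of z] unfolding mdiff3_def split_beta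
    by (intro mdiff_diff[OF M z] mdiff_mult[OF M z] mdiff_field_compose[OF M z _ p_differentiable]) auto
qed

lemma hdiff_p: "z \<in> Cn n \<Longrightarrow> hdiff n f z \<Longrightarrow> hdiff n (\<lambda>w. p (f w)) z"
  by (rule hdiff_field_compose[OF _ _ p_differentiable])

text \<open>The third coordinate \<open>defect\<close> vanishes exactly on the surface, so the slice
  condition holds for every choice of the first two coordinates and is shared by all the charts
  below.\<close>

lemma slice_defect:
  "(\<lambda>z. coord3 (a z, b z, defect z)) ` (U \<inter> S) = (\<lambda>z. coord3 (a z, b z, defect z)) ` U \<inter> Cn 2"
proof -
  have "coord3 (a z, b z, defect z) \<in> Cn 2 \<longleftrightarrow> z \<in> S" for z
    unfolding coord3_Cn2 by (auto simp: split_beta)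
  then show ?thesis by blast
qed

text \<open>Where \<open>u \<noteq> 0\<close> the equation \<open>u * v - p x = c\<close> can be
  solved for \<open>v\<close>, which yields the inverse of the chart.\<close>

lemma chart_u: "({z. fst z \<noteq> 0}, \<lambda>z. coord3 (fst z, snd (snd z), defect z)) \<in> maximal_atlas complex_3space"
    (is "(?U, ?\<phi>) \<in> _")
proof (rule chart_3space[where g="\<lambda>w. (w 0, (w 2 + p (w 1)) / w 0, w 1)"])
  have im: "?\<phi> ` ?U = {w \<in> topspace (Cn_topology 3). w 0 \<in> - {0}}"
  proof (intro Set.set_eqI iffI)
    fix w assume w: "w \<in> {w \<in> topspace (Cn_topology 3). w 0 \<in> - {0}}"
    then show "w \<in> ?\<phi> ` ?U" using coord3_of_Cn[of w]
      by (intro image_eqI[of _ _ "(w 0, (w 2 + p (w 1)) / w 0, w 1)"]) auto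
  qed (auto simp: coord3_triple_Cn[simplified])
  show "openin (Cn_topology 3) (?\<phi> ` ?U)" unfolding im
    by (rule openin_continuous_map_preimage[OF continuous_map_coordinate]) auto
  show "hdiff 3 (\<lambda>w. fst (w 0, (w 2 + p (w 1)) / w 0, w 1)) w"
    "hdiff 3 (\<lambda>w. fst (snd (w 0, (w 2 + p (w 1)) / w 0, w 1))) w"
    "hdiff 3 (\<lambda>w. snd (snd (w 0, (w 2 + p (w 1)) / w 0, w 1))) w" if "w \<in> ?\<phi> ` ?U" for w
    using that unfolding im by (auto intro!: hdiff_coordinate hdiff_divide hdiff_add hdiff_p)
  show "open ?U" by (intro open_Collect_neq continuous_intros)
  show "mdiff complex_3space (\<lambda>y. ?\<phi> y j) z" if "j < 3" for j z
    using less_3_cases[OF that] mdiff_defect[of z] mdiff3_complex_3space[of z]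
    by (auto simp: mdiff3_def split_beta)
qed (use coord3_Cn in auto)

lemma chart_v: "({z. fst (snd z) \<noteq> 0}, \<lambda>z. coord3 (fst (snd z), snd (snd z), defect z)) \<in> maximal_atlas complex_3space"
    (is "(?U, ?\<phi>) \<in> _")
proof (rule chart_3space[where g="\<lambda>w. ((w 2 + p (w 1)) / w 0, w 0, w 1)"])
  have im: "?\<phi> ` ?U = {w \<in> topspace (Cn_topology 3). w 0 \<in> - {0}}"
  proof (intro Set.set_eqI iffI)
    fix w assume w: "w \<in> {w \<in> topspace (Cn_topology 3). w 0 \<in> - {0}}"
    then show "w \<in> ?\<phi> ` ?U" using coord3_of_Cn[of w]
      by (intro image_eqI[of _ _ "((w 2 + p (w 1)) / w 0, w 0, w 1)"]) auto
  qed (auto simp: coord3_triple_Cn[simplified])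
  show "openin (Cn_topology 3) (?\<phi> ` ?U)" unfolding im
    by (rule openin_continuous_map_preimage[OF continuous_map_coordinate]) auto
  show "hdiff 3 (\<lambda>w. fst ((w 2 + p (w 1)) / w 0, w 0, w 1)) w"
    "hdiff 3 (\<lambda>w. fst (snd ((w 2 + p (w 1)) / w 0, w 0, w 1))) w"
    "hdiff 3 (\<lambda>w. snd (snd ((w 2 + p (w 1)) / w 0, w 0, w 1))) w" if "w \<in> ?\<phi> ` ?U" for w
    using that unfolding im by (auto intro!: hdiff_coordinate hdiff_divide hdiff_add hdiff_p)
  show "open ?U" by (intro open_Collect_neq continuous_intros)
  show "mdiff complex_3space (\<lambda>y. ?\<phi> y j) z" if "j < 3" for j z
    using less_3_cases[OF that] mdiff_defect[of z] mdiff3_complex_3space[of z]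
    by (auto simp: mdiff3_def split_beta)
qed (use coord3_Cn in auto)

text \<open>Near a fixed point one cannot divide by \<open>u\<close> or \<open>v\<close>, but
  \<open>u * v - p x = c\<close> can be solved for \<open>x\<close> with a local inverse
  \<open>q\<close> of \<open>p\<close>. This leaves \<open>u\<close> and \<open>v\<close> as
  coordinates on the surface; the open mapping theorem makes the image of the chart open.\<close>

lemma chart_0:
  assumes B: "open B" and inj: "inj_on p B"
  shows "({z. snd (snd z) \<in> B}, \<lambda>z. coord3 (fst z, fst (snd z), defect z)) \<in> maximal_atlas complex_3space"
    (is "(?U, ?\<phi>) \<in> _")
proof -
  have holB: "p holomorphic_on B" using hol holomorphic_on_subset by blast
  obtain q where q: "q holomorphic_on p ` B" "\<And>z. z \<in> B \<Longrightarrow> q (p z) = z"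
    using holomorphic_has_inverse[OF holB B inj] by metis
  have opB: "open (p ` B)" using open_mapping_thm3[OF holB B inj] .
  let ?d = "\<lambda>w::cvec. w 0 * w 1 - w 2"
  show ?thesis
  proof (rule chart_3space[where g="\<lambda>w. (w 0, w 1, q (?d w))"])
    have im: "?\<phi> ` ?U = {w \<in> topspace (Cn_topology 3). ?d w \<in> p ` B}"
    proof (intro Set.set_eqI iffI)
      fix w assume w: "w \<in> {w \<in> topspace (Cn_topology 3). ?d w \<in> p ` B}"
      then obtain b where b: "b \<in> B" "?d w = p b" by blast
      then have "w 0 * w 1 - p b = w 2" by (simp add: algebra_simps)
      then show "w \<in> ?\<phi> ` ?U" using coord3_of_Cn[of w] w b(1)
        by (intro image_eqI[of _ _ "(w 0, w 1, b)"]) auto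
    qed (auto simp: coord3_triple_Cn[simplified])
    have hd: "hdiff 3 ?d w" if "w \<in> Cn 3" for w
      using that by (intro hdiff_diff hdiff_mult hdiff_coordinate)
    have "continuous_map (mtop (complex_space 3)) euclidean ?d"
      by (rule mdiff_imp_continuous_map[OF complex_manifold_complex_space])
        (use hd mdiff_complex_space[of _ 3 ?d] in simp)
    then show "openin (Cn_topology 3) (?\<phi> ` ?U)" unfolding im
      using opB by (intro openin_continuous_map_preimage[where f="?d"]) auto
    fix w assume "w \<in> ?\<phi> ` ?U"
    then have w: "w \<in> Cn 3" "?d w \<in> p ` B" unfolding im by auto
    have "q field_differentiable (at (?d w))"
      using q(1) w(2) opB holomorphic_on_imp_differentiable_at by blast
    then show "hdiff 3 (\<lambda>w. fst (w 0, w 1, q (?d w))) w"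
      "hdiff 3 (\<lambda>w. fst (snd (w 0, w 1, q (?d w)))) w"
      "hdiff 3 (\<lambda>w. snd (snd (w 0, w 1, q (?d w)))) w"
      using w(1) hdiff_field_compose[OF w(1) hd[OF w(1)], of q] by (simp_all add: hdiff_coordinate)
  next
    have "?U = (\<lambda>z. snd (snd z)) -` B" by auto
    then show "open ?U" using B by (auto intro!: open_vimage continuous_intros)
    show "mdiff complex_3space (\<lambda>y. ?\<phi> y j) z" if "j < 3" for j z
      using less_3_cases[OF that] mdiff_defect[of z] mdiff3_complex_3space[of z]
      by (auto simp: mdiff3_def split_beta)
  qed (use coord3_Cn q(2) in auto)
qed

lemma locally_injective:
  assumes "deriv p x \<noteq> 0"
  obtains r where "r > 0" "inj_on p (ball x r)"
  using has_complex_derivative_locally_injective[OF hol _ _ assms] by auto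

lemma embedded_surface: "embedded complex_3space 2 S"
proof
  fix z assume z: "z \<in> S"
  obtain u v x where uvx: "z = (u, v, x)" by (cases z) auto
  consider "u \<noteq> 0" | "v \<noteq> 0" | "u = 0" "v = 0" by blast
  then show "\<exists>U \<phi>. (U, \<phi>) \<in> maximal_atlas complex_3space \<and> \<phi> ` (U \<inter> S) = \<phi> ` U \<inter> Cn 2 \<and> z \<in> U"
  proof cases
    case 1
    then show ?thesis using uvx
      by (intro exI conjI) (rule chart_u, rule slice_defect, simp)
  next
    case 2
    then show ?thesis using uvx
      by (intro exI conjI) (rule chart_v, rule slice_defect, simp)
  next
    case 3
    \<comment> \<open>On the surface \<open>u = v = 0\<close> forces \<open>p x = 0\<close>; here
      the simplicity of the zeros enters.\<close>
    then have "deriv p x \<noteq> 0" using z uvx simple by auto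
    then obtain r where r: "r > 0" "inj_on p (ball x r)" by (rule locally_injective)
    show ?thesis using uvx r(1)
      by (intro exI conjI) (rule chart_0[OF open_ball r(2)], rule slice_defect, simp)
  qed
qed (simp_all add: complex_manifold_complex_3space)

sublocale embedded complex_3space 2 S
  by (rule embedded_surface)

section \<open>The surface as a manifold\<close>

lemma surface_eq: "surface p = E"
  by (simp add: surface_def)

lemma surface_sel [simp]: "mtop (surface p) = top_of_set S" "mdim (surface p) = 2"
  by (simp_all add: surface_def)

lemma complex_manifold_surface: "complex_manifold (surface p)"
  using manifold by (simp add: surface_eq)

lemma mdiff3_surface: "z \<in> S \<Longrightarrow> mdiff3 (surface p) (\<lambda>z. z) z"
  using mdiff3_complex_3space[of z] mdiff_E[of _ z] by (simp add: mdiff3_def surface_eq)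

text \<open>Charts of the surface are restrictions of ambient ones, so holomorphy into the surface
  can be tested on the three ambient coordinates.\<close>

lemma holomorphic_map_surfaceI:
  assumes M: "complex_manifold M" and S: "\<And>x. x \<in> points M \<Longrightarrow> f x \<in> S"
    and f: "\<And>x. x \<in> points M \<Longrightarrow> mdiff3 M f x"
  shows "holomorphic_map M (surface p) f"
proof (rule holomorphic_mapI[OF M complex_manifold_surface])
  note f' = f[unfolded mdiff3_def]
  have "continuous_map (mtop M) euclidean f"
    by (rule continuous_map_tripleI[OF M]) (use f' in auto)
  then show "continuous_map (mtop M) (mtop (surface p)) f"
    using S by (auto simp: continuous_map_in_subtopology)
  fix x V \<psi> j
  assume x: "x \<in> points M" and V: "(V, \<psi>) \<in> charts (surface p)" "f x \<in> V" and j: "j < mdim (surface p)"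
  obtain U where U: "V = U \<inter> S" "(U, \<psi>) \<in> maximal_atlas complex_3space"
    using V(1) charts_E by (auto simp: surface_eq)
  have "mdiff complex_3space (\<lambda>y. \<psi> y j) (f x)"
    using mdiff_atlas_chart[OF complex_manifold_complex_3space U(2)] V(2) U(1) j by simp
  then show "mdiff M (\<lambda>y. \<psi> (f y) j) x"
    using mdiff_comp_triple[OF M x] f' by blast
qed

end


section \<open>The fixed points\<close>

lemma vec2_eq_coord3: "coord3 (u, v, 0) = vec2 u v"
  by (auto simp: vec2_def)

text \<open>\<open>vec2\<close> is continuous from the product of two complex planes, and there
  every neighbourhood of the origin contains a polydisc.\<close>

lemma openin_Cn2_polydisc:
  assumes W: "openin (Cn_topology 2) W" "vec2 0 0 \<in> W"
  obtains r where "r > 0" "\<And>u v. norm u < r \<Longrightarrow> norm v < r \<Longrightarrow> vec2 u v \<in> W"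
proof -
  obtain O' where O': "open O'" "W = Cn 2 \<inter> O'"
    using W(1) by (auto simp: Cn_topology_def openin_open)
  have "open ((\<lambda>x. vec2 (fst x) (snd x)) -` O')"
    using continuous_on_vec2[of UNIV] O'(1) by (simp add: open_vimage)
  then obtain A B where AB: "open A" "open B" "(0, 0) \<in> A \<times> B" "A \<times> B \<subseteq> (\<lambda>x. vec2 (fst x) (snd x)) -` O'"
    using W(2) O'(2) open_prod_elim[of "(\<lambda>x. vec2 (fst x) (snd x)) -` O'" "(0, 0)"] by auto
  obtain r1 r2 where r: "r1 > 0" "ball 0 r1 \<subseteq> A" "r2 > 0" "ball 0 r2 \<subseteq> B"
    using AB open_contains_ball by (metis mem_Sigma_iff)
  show thesis
  proof (rule that[of "min r1 r2"])
    fix u v :: complex assume "norm u < min r1 r2" "norm v < min r1 r2"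
    then have "(u, v) \<in> A \<times> B" using r by (auto simp: subset_iff)
    then show "vec2 u v \<in> W" using AB(4) O'(2) by auto
  qed (use r in auto)
qed

lemma holomorphic_nearI:
  assumes X: "complex_manifold X" and W: "openin (mtop X) W" "a \<in> W"
    and f: "\<And>x. x \<in> W \<Longrightarrow> mdiff X f x"
  shows "holomorphic_near X a f"
  unfolding holomorphic_near_def
proof (intro exI[of _ W] conjI)
  show "holomorphic_map (open_submanifold X W) complex_line f"
    by (rule holomorphic_map_complex_lineI[OF complex_manifold_open_submanifold[OF X W(1)]])
      (use f in \<open>auto simp: mdiff_open_submanifold[OF X W(1)]\<close>)
qed (fact W)+

lemma holomorphic_nearE:
  assumes X: "complex_manifold X" and "holomorphic_near X a f"
  obtains W where "openin (mtop X) W" "a \<in> W" "\<And>x. x \<in> W \<Longrightarrow> mdiff X f x"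
proof -
  obtain W where W: "openin (mtop X) W" "a \<in> W" "holomorphic_map (open_submanifold X W) complex_line f"
    using assms(2) by (auto simp: holomorphic_near_def)
  have "mdiff X f x" if "x \<in> W" for x
    using holomorphic_map_complex_lineD[OF complex_manifold_open_submanifold[OF X W(1)] W(3), of x]
      that openin_subset[OF W(1)] mdiff_open_submanifold[OF X W(1) that] by auto
  then show thesis using that W by blast
qed

text \<open>At a fixed point every difference \<open>h (act t x) - h x\<close> is 0.\<close>

lemma fixed_point_ideal_vanishes:
  assumes "f \<in> fixed_point_ideal G X act a" "a \<in> fixed_points G X act"
  shows "f a = 0"
  using assms by (auto simp: fixed_point_ideal_def fixed_points_def)

context smooth_surface
begin

abbreviation "X \<equiv> surface p"

text \<open>In the coordinates \<open>u\<close>, \<open>v\<close> one divides in two stages: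
  \<open>F(u, v) - F(0, v)\<close> by \<open>u\<close> and \<open>F(0, v) - F(0, 0)\<close> by
  \<open>v\<close>. Only the first quotient depends on both variables and needs
  \<open>hdiff_quotient\<close>.\<close>

lemma Hadamard_at_fixed_point:
  assumes x0: "p x0 = 0" and f: "holomorphic_near X (0, 0, x0) f" and f0: "f (0, 0, x0) = 0"
  obtains W g0 g1 where "openin (mtop X) W" "(0, 0, x0) \<in> W"
    "\<And>y. y \<in> W \<Longrightarrow> mdiff X g0 y" "\<And>y. y \<in> W \<Longrightarrow> mdiff X g1 y"
    "\<And>y. y \<in> W \<Longrightarrow> f y = g0 y * fst y + g1 y * fst (snd y)"
proof -
  let ?a = "(0, 0, x0) :: complex \<times> complex \<times> complex"
  note X = complex_manifold_surface
  obtain W where W: "openin (mtop X) W" "?a \<in> W" "\<And>y. y \<in> W \<Longrightarrow> mdiff X f y"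
    using holomorphic_nearE[OF X f] by blast
  obtain r0 where r0: "r0 > 0" "inj_on p (ball x0 r0)" using locally_injective simple[OF x0] by blast
  define U where "U = {z :: complex \<times> complex \<times> complex. snd (snd z) \<in> ball x0 r0}"
  define \<psi> where "\<psi> = (\<lambda>z. coord3 (fst z, fst (snd z), defect z))"
  have atlas: "(U, \<psi>) \<in> maximal_atlas complex_3space"
    unfolding U_def \<psi>_def by (rule chart_0[OF open_ball r0(2)])
  have slice: "\<psi> ` (U \<inter> S) = \<psi> ` U \<inter> Cn 2" unfolding \<psi>_def by (rule slice_defect)
  have V: "(U \<inter> S, \<psi>) \<in> charts X" using atlas slice charts_E by (auto simp: surface_eq)
  note c = manifold_is_chart[OF X V]
  have \<psi>: "\<psi> y = vec2 (fst y) (fst (snd y))" if "y \<in> S" for y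
    using that by (auto simp: \<psi>_def vec2_eq_coord3[symmetric] split_beta)
  define A where "A = W \<inter> (U \<inter> S)"
  have A: "openin (mtop X) A" using W(1) is_chart_openin[OF c] by (auto simp: A_def)
  have aS: "?a \<in> S" using x0 by simp
  have aA: "?a \<in> A" using W(2) r0(1) aS by (simp add: A_def U_def)
  have "openin (Cn_topology (mdim X)) (\<psi> ` A)"
    by (rule is_chart_open_map[OF c A]) (unfold A_def, blast)
  then have "openin (Cn_topology 2) (\<psi> ` A)" by (simp only: surface_sel)
  moreover have "vec2 0 0 \<in> \<psi> ` A" using aA \<psi>[OF aS] by force
  ultimately obtain r where r: "r > 0" "\<And>u v. norm u < r \<Longrightarrow> norm v < r \<Longrightarrow> vec2 u v \<in> \<psi> ` A"
    by (rule openin_Cn2_polydisc) blast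
  define F where "F = (\<lambda>w. f (inv_into (U \<inter> S) \<psi> w))"
  have FA: "F (\<psi> y) = f y" if "y \<in> A" for y
    using that is_chart_inj[OF c] by (simp add: F_def A_def)
  have F: "hdiff 2 F (vec2 u v)" if uv: "norm u < r" "norm v < r" for u v
  proof -
    obtain y where y: "y \<in> A" "\<psi> y = vec2 u v" using r(2)[OF uv] by (metis imageE)
    then show ?thesis using W(3)[of y] mdiff_iff[OF X V, of y f] by (simp add: A_def F_def)
  qed
  \<comment> \<open>Halving the radius leaves room: for \<open>v\<close> in the smaller disc, the
    disc of radius \<open>r / 2\<close> around \<open>v\<close> still lies in the domain on which
    \<open>F\<close> is known to be differentiable.\<close>
  define W' where "W' = A \<inter> {y \<in> topspace (mtop X). fst y \<in> ball 0 (r / 2)} \<inter>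
      {y \<in> topspace (mtop X). fst (snd y) \<in> ball 0 (r / 2)}"
  have cts: "continuous_map (mtop X) euclidean (fst :: complex \<times> complex \<times> complex \<Rightarrow> complex)"
    "continuous_map (mtop X) euclidean (\<lambda>y :: complex \<times> complex \<times> complex. fst (snd y))"
    by (auto intro!: continuous_map_from_subtopology continuous_intros)
  have W': "openin (mtop X) W'" unfolding W'_def
    by (intro openin_Int A openin_continuous_map_preimage[OF cts(1)] openin_continuous_map_preimage[OF cts(2)])
      simp_all
  define g0 where "g0 = (\<lambda>y::complex \<times> complex \<times> complex. quotient_at_0 (\<lambda>u. F (vec2 u (fst (snd y)))) (fst y))"
  define g1 where "g1 = (\<lambda>y::complex \<times> complex \<times> complex. quotient_at_0 (\<lambda>v. F (vec2 0 v)) (fst (snd y)))"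
  show thesis
  proof (rule that[of W' g0 g1])
    show "openin (mtop X) W'" by (rule W')
    show "?a \<in> W'" using aA r(1) aS by (simp add: W'_def)
    fix y assume y: "y \<in> W'"
    then have yA: "y \<in> A" and yS: "y \<in> S" and ny: "norm (fst y) < r / 2" "norm (fst (snd y)) < r / 2"
      by (auto simp: W'_def A_def)
    have yX: "y \<in> points X" using yS by simp
    have d: "mdiff X fst y" "mdiff X (\<lambda>y. fst (snd y)) y"
      using mdiff3_surface[OF yS] by (auto simp: mdiff3_def)
    have "hdiff 2 (\<lambda>w. quotient_at_0 (\<lambda>u. F (vec2 u (w 1))) (w 0)) (vec2 (fst y) (fst (snd y)))"
    proof (rule hdiff_quotient[where r="r / 2"])
      fix u v :: complex assume uv: "norm u < r / 2" "norm (v - fst (snd y)) < r / 2"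
      have "norm v \<le> norm (v - fst (snd y)) + norm (fst (snd y))" by norm
      then show "hdiff 2 F (vec2 u v)" using uv ny r(1) by (intro F) linarith+
    qed (use r ny in auto)
    then have "mdiff X (\<lambda>y. quotient_at_0 (\<lambda>u. F (vec2 u (vec2 (fst y) (fst (snd y)) 1))) (vec2 (fst y) (fst (snd y)) 0)) y"
    proof (intro mdiff_compose[OF X openin_topspace yX, where g="\<lambda>y. vec2 (fst y) (fst (snd y))" and m=2
          and f="\<lambda>w. quotient_at_0 (\<lambda>u. F (vec2 u (w 1))) (w 0)"])
      fix j :: nat assume "j < 2"
      then show "mdiff X (\<lambda>y. vec2 (fst y) (fst (snd y)) j) y" using d by (auto simp: less_2_cases_iff)
    qed auto
    then show "mdiff X g0 y" by (simp add: g0_def)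
    have "(\<lambda>v. F (vec2 0 v)) holomorphic_on ball 0 r"
      unfolding holomorphic_on_def
      by (intro ballI field_differentiable_at_within[OF hdiff_partial(2)] F) (use r in auto)
    then have "quotient_at_0 (\<lambda>v. F (vec2 0 v)) field_differentiable (at (fst (snd y)))"
      using quotient_at_0_holomorphic[of _ "ball 0 r"] ny r(1)
      by (intro holomorphic_on_imp_differentiable_at[of _ "ball 0 r"]) auto
    then show "mdiff X g1 y" unfolding g1_def by (rule mdiff_field_compose[OF X yX d(2)])
    have "f y = F (vec2 (fst y) (fst (snd y)))" using FA[OF yA] \<psi>[OF yS] by simp
    moreover have "F (vec2 0 0) = 0" using FA[OF aA] \<psi>[OF aS] f0 by simp
    ultimately show "f y = g0 y * fst y + g1 y * fst (snd y)"
      using quotient_at_0_mult[of "fst y" "\<lambda>u. F (vec2 u (fst (snd y)))"]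
        quotient_at_0_mult[of "fst (snd y)" "\<lambda>v. F (vec2 0 v)"]
      by (simp add: g0_def g1_def mult.commute)
  qed
qed

lemma reduced:
  assumes "a \<in> fixed_points Cstar X torus_action"
  shows "reduced_fixed_point Cstar X torus_action a"
  unfolding reduced_fixed_point_def
proof (intro conjI allI impI, fact, elim conjE)
  fix f :: "complex \<times> complex \<times> complex \<Rightarrow> complex" and n :: nat
  assume f: "holomorphic_near X a f" and fn: "(\<lambda>x. f x ^ n) \<in> fixed_point_ideal Cstar X torus_action a"
  note X = complex_manifold_surface
  have "a \<in> (\<lambda>x. (0, 0, x)) ` {x. p x = 0}" using assms by (simp only: fixed_points_surface)
  then obtain x0 where x0: "p x0 = 0" and a: "a = (0, 0, x0)" by blast
  \<comment> \<open>For \<open>n = 0\<close> the hypothesis would put 1 into the ideal, so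
    \<open>f a ^ n = 0\<close> rules this case out as well.\<close>
  have "f a = 0" using fixed_point_ideal_vanishes[OF fn assms] by simp
  then obtain W g0 g1 where W: "openin (mtop X) W" "a \<in> W"
    "\<And>y. y \<in> W \<Longrightarrow> mdiff X g0 y" "\<And>y. y \<in> W \<Longrightarrow> mdiff X g1 y"
    "\<And>y. y \<in> W \<Longrightarrow> f y = g0 y * fst y + g1 y * fst (snd y)"
    using Hadamard_at_fixed_point[OF x0] f unfolding a by blast
  have WS: "W \<subseteq> S" using openin_subset[OF W(1)] by simp
  define g where "g = (\<lambda>k::nat. if k = 0 then g0 else g1)"
  define h where "h = (\<lambda>k::nat. if k = 0 then (\<lambda>y::complex \<times> complex \<times> complex. fst y) else (\<lambda>y. fst (snd y)))"
  \<comment> \<open>Chosen so that the differences are the coordinates themselves: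
    \<open>2 * u - u = u\<close> and \<open>inverse (1 / 2) * v - v = v\<close>.\<close>
  define t where "t = (\<lambda>k::nat. if k = 0 then 2 else 1 / 2 :: complex)"
  have near: "holomorphic_near X a (g k) \<and> holomorphic_near X a (h k) \<and> t k \<in> carrier Cstar" for k
  proof (intro conjI holomorphic_nearI[OF X W(1,2)])
    fix y assume y: "y \<in> W"
    show "mdiff X (g k) y" using W(3,4)[OF y] by (simp add: g_def)
    show "mdiff X (h k) y" using mdiff3_surface[of y] y WS by (auto simp: h_def mdiff3_def)
  qed (simp add: t_def)
  have sum: "f x = (\<Sum>k<2. g k x * (h k (torus_action (t k) x) - h k x))" if "x \<in> W" for x
    using W(5)[OF that]
    by (simp add: numeral_2_eq_2 g_def h_def t_def torus_action_def split_beta)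
  show "f \<in> fixed_point_ideal Cstar X torus_action a"
    unfolding fixed_point_ideal_def
    using f near sum W(1,2)
    by (intro CollectI conjI exI[of _ t, THEN exI[of _ h], THEN exI[of _ g], THEN exI[of _ "2::nat"]]) blast+
qed

text \<open>Fixed points are determined by \<open>x\<close>, and \<open>p\<close> is injective near
  a simple zero, so it has no other zero there.\<close>

lemma isolated:
  assumes "a \<in> fixed_points Cstar X torus_action"
  shows "isolated_point X (fixed_points Cstar X torus_action) a"
proof -
  have "a \<in> (\<lambda>x. (0, 0, x)) ` {x. p x = 0}" using assms by (simp only: fixed_points_surface)
  then obtain x0 where x0: "p x0 = 0" and a: "a = (0, 0, x0)" by blast
  obtain r where r: "r > 0" "inj_on p (ball x0 r)" using locally_injective simple[OF x0] by blast
  let ?W = "{z. snd (snd z) \<in> ball x0 r} \<inter> S"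
  have "open {z :: complex \<times> complex \<times> complex. snd (snd z) \<in> ball x0 r}"
    using open_vimage[OF open_ball[of x0 r], of "\<lambda>z :: complex \<times> complex \<times> complex. snd (snd z)"]
    by (simp add: vimage_def continuous_on_snd continuous_on_id)
  then have "openin (mtop X) ?W" by (auto simp: openin_open)
  moreover have "?W \<inter> (\<lambda>x. (0, 0, x)) ` {x. p x = 0} = {a}"
  proof -
    have "x = x0" if "p x = 0" "x \<in> ball x0 r" for x
      using inj_onD[OF r(2), of x x0] that x0 r(1) by simp
    then show ?thesis using x0 a r(1) by auto
  qed
  ultimately show ?thesis unfolding isolated_point_def fixed_points_surface by blast
qed


section \<open>The spray\<close>

definition spray_bundle :: "(complex \<times> complex \<times> complex, (complex \<times> complex \<times> complex) \<times> cvec) vbundle" where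
  "spray_bundle = \<lparr>total = product_manifold X (complex_space 3), bproj = fst, brank = 3,
     fzero = (\<lambda>z. (z, \<lambda>i. 0)), fadd = (\<lambda>e e'. (fst e, \<lambda>i. snd e i + snd e' i)),
     fscale = (\<lambda>c e. (fst e, \<lambda>i. c * snd e i))\<rparr>"

text \<open>As the group is abelian, the parameter \<open>w 2\<close> of the torus factor is
  invariant. On each axis of the fibre two of the three factors are the identity, so the partial
  derivatives at 0 are the three vector fields.\<close>

definition spray_map :: "(complex \<times> complex \<times> complex) \<times> cvec \<Rightarrow> complex \<times> complex \<times> complex" where
  "spray_map = (\<lambda>(z, w). torus_action (exp (w 2)) (shear_u p (w 1) (shear_v p (w 0) z)))"

text \<open>In \<open>spray_map\<close> the invariant \<open>x\<close> is shifted by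
  \<open>w 0\<close> times \<open>u\<close> and then by \<open>w 1\<close> times the current
  \<open>v\<close>, so these fibre coordinates must carry the weights opposite to those of
  \<open>u\<close> and \<open>v\<close>.\<close>

definition lift_action :: "complex \<Rightarrow> (complex \<times> complex \<times> complex) \<times> cvec \<Rightarrow> (complex \<times> complex \<times> complex) \<times> cvec" where
  "lift_action t = (\<lambda>(z, w). (torus_action t z,
     \<lambda>i. if i = 0 then inverse t * w 0 else if i = 1 then t * w 1 else w i))"

abbreviation "Tot \<equiv> product_manifold X (complex_space 3)"

lemma spray_bundle_sel [simp]:
  "total spray_bundle = Tot" "bproj spray_bundle = fst" "brank spray_bundle = 3"
  "fzero spray_bundle z = (z, \<lambda>i. 0)" "fadd spray_bundle e e' = (fst e, \<lambda>i. snd e i + snd e' i)"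
  "fscale spray_bundle c e = (fst e, \<lambda>i. c * snd e i)"
  by (simp_all add: spray_bundle_def)

lemma complex_manifold_Tot: "complex_manifold Tot"
  by (intro complex_manifold_product complex_manifold_surface complex_manifold_complex_space)

lemma mdiff_Tot:
  assumes "e \<in> points Tot"
  shows "mdiff3 Tot fst e" "mdiff Tot (\<lambda>e. snd e i) e"
proof -
  note P = complex_manifold_surface complex_manifold_complex_space assms
  have "mdiff3 X (\<lambda>z. z) (fst e)" using assms by (intro mdiff3_surface) auto
  then show "mdiff3 Tot fst e"
    using mdiff_fst[OF P, of fst] mdiff_fst[OF P, of "\<lambda>z. fst (snd z)"] mdiff_fst[OF P, of "\<lambda>z. snd (snd z)"]
    by (simp add: mdiff3_def)
  have "mdiff (complex_space 3) (\<lambda>w. w i) (snd e)"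
    using assms by (subst mdiff_complex_space) (auto intro: hdiff_coordinate)
  then show "mdiff Tot (\<lambda>e. snd e i) e" by (rule mdiff_snd[OF P])
qed

lemma mdiff3_spray_map:
  assumes M: "complex_manifold M" "x \<in> points M"
    and f: "mdiff3 M f x" and w: "\<And>i. mdiff M (\<lambda>y. w y i) x"
  shows "mdiff3 M (\<lambda>y. spray_map (f y, w y)) x"
proof -
  have "exp field_differentiable (at (w x 2))" by (rule field_differentiable_within_exp)
  then have "mdiff M (\<lambda>y. exp (w y 2)) x" by (intro mdiff_field_compose[OF M w])
  then show ?thesis unfolding spray_map_def split_conv
    by (intro mdiff3_torus_action[OF M] mdiff3_shear[OF M] f w) auto
qed

lemma spray_map_surface: "z \<in> S \<Longrightarrow> spray_map (z, w) \<in> S"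
  unfolding spray_map_def split_conv by (intro torus_action_surface shear_surface) auto

lemma trivialisation: "local_trivialisation X spray_bundle (points X) snd"
proof -
  have tot: "{e \<in> points Tot. bproj spray_bundle e \<in> points X} = points Tot" by auto
  have "biholomorphic Tot Tot (\<lambda>e. e)"
    using holomorphic_map_id[OF complex_manifold_Tot] by (auto simp: biholomorphic_def)
  then have "biholomorphic (open_submanifold (total spray_bundle) {e \<in> points (total spray_bundle). bproj spray_bundle e \<in> points X})
      (product_manifold (open_submanifold X (points X)) (complex_space (brank spray_bundle)))
      (\<lambda>e. (bproj spray_bundle e, snd e))"
    unfolding spray_bundle_sel(1,3) tot open_submanifold_points[OF complex_manifold_Tot]
      open_submanifold_points[OF complex_manifold_surface] by simp
  then show ?thesis unfolding local_trivialisation_def by auto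
qed

lemma vector_bundle: "holomorphic_vector_bundle X spray_bundle"
  unfolding holomorphic_vector_bundle_def
proof (intro conjI)
  show "complex_manifold (total spray_bundle)" using complex_manifold_Tot by simp
  show "holomorphic_map (total spray_bundle) X (bproj spray_bundle)"
    using holomorphic_map_fst[OF complex_manifold_surface complex_manifold_complex_space] by simp
  show "\<forall>x\<in>points X. \<exists>U h. x \<in> U \<and> local_trivialisation X spray_bundle U h"
    using trivialisation by blast
qed (auto simp: complex_manifold_surface fibre_def Cn_def)

lemma spray: "spray X spray_bundle spray_map"
  unfolding spray_def
proof (intro conjI vector_bundle ballI)
  show "holomorphic_map (total spray_bundle) X spray_map"
    unfolding spray_bundle_sel
  proof (rule holomorphic_map_surfaceI[OF complex_manifold_Tot])
    fix e assume e: "e \<in> points Tot"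
    then show "spray_map e \<in> S" using spray_map_surface[of "fst e" "snd e"] by auto
    show "mdiff3 Tot spray_map e"
      using mdiff3_spray_map[OF complex_manifold_Tot e mdiff_Tot(1)[OF e], of snd] mdiff_Tot(2)[OF e] by simp
  qed
  show "spray_map (fzero spray_bundle x) = x" for x by (simp add: spray_map_def)
qed

text \<open>Columns \<open>i\<close> and \<open>k\<close> form an invertible diagonal block, and a
  vector supported on these two positions solves the system whatever the third column is.\<close>

lemma jacobian_map_surj:
  assumes "i < 3" "k < 3" "i \<noteq> k" "J 0 i \<noteq> 0" "J 1 i = 0" "J 0 k = 0" "J 1 k \<noteq> 0"
  shows "jacobian_map 3 2 J ` Cn 3 = Cn 2"
proof (intro equalityI subsetI)
  fix y assume y: "y \<in> Cn 2"
  define h where "h = (\<lambda>m. if m = i then y 0 / J 0 i else if m = k then y 1 / J 1 k else 0)"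
  have sum: "(\<Sum>m<3. J j m * h m) = J j i * h i + J j k * h k" for j
  proof -
    have "(\<Sum>m<3. J j m * h m) = (\<Sum>m\<in>{i, k}. J j m * h m)"
      by (rule sum.mono_neutral_right) (use assms in \<open>auto simp: h_def\<close>)
    then show ?thesis using assms(3) by simp
  qed
  have "jacobian_map 3 2 J h = y"
  proof (rule Cn_eqI[OF _ y])
    show "jacobian_map 3 2 J h \<in> Cn 2" by (simp add: jacobian_map_def Cn_def)
    fix j :: nat assume "j < 2"
    then have "j = 0 \<or> j = 1" by auto
    then show "jacobian_map 3 2 J h j = y j"
      unfolding jacobian_map_def sum using assms by (auto simp: h_def)
  qed
  moreover have "h \<in> Cn 3" using assms by (auto simp: h_def Cn_def)
  ultimately show "y \<in> jacobian_map 3 2 J ` Cn 3" by blast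
qed (auto simp: jacobian_map_def Cn_def)

lemma spray_map_axes:
  "spray_map (z, (\<lambda>i. 0)(0 := t)) = shear_v p t z"
  "spray_map (z, (\<lambda>i. 0)(1 := t)) = shear_u p t z"
  "spray_map (z, (\<lambda>i. 0)(2 := t)) = torus_action (exp t) z"
  by (simp_all add: spray_map_def)

text \<open>Reduces domination to one-variable derivatives along two axes of the fibre. A Jacobian
  \<open>J\<close> exists by holomorphy of the spray; its relevant entries are then identified by
  uniqueness of derivatives.\<close>

lemma submersion_atI:
  assumes z: "z \<in> S" and U: "(U, \<psi>) \<in> maximal_atlas complex_3space" "\<psi> ` (U \<inter> S) = \<psi> ` U \<inter> Cn 2" "z \<in> U"
    and ik: "i < 3" "k < 3" "i \<noteq> k"
    and i0: "((\<lambda>t. \<psi> (spray_map (z, (\<lambda>i. 0)(i := t))) 0) has_field_derivative a) (at 0)" "a \<noteq> 0"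
    and i1: "((\<lambda>t. \<psi> (spray_map (z, (\<lambda>i. 0)(i := t))) 1) has_field_derivative 0) (at 0)"
    and k0: "((\<lambda>t. \<psi> (spray_map (z, (\<lambda>i. 0)(k := t))) 0) has_field_derivative 0) (at 0)"
    and k1: "((\<lambda>t. \<psi> (spray_map (z, (\<lambda>i. 0)(k := t))) 1) has_field_derivative b) (at 0)" "b \<noteq> 0"
  shows "submersion_at (fibre_manifold X spray_bundle z) X spray_map (fzero spray_bundle z)"
proof -
  let ?F = "fibre spray_bundle z"
  have F: "?F = {z} \<times> Cn 3" using z by (auto simp: fibre_def)
  have inv: "inv_into ?F snd w = (z, w)" if "w \<in> Cn 3" for w
    using that inv_into_f_f[of snd ?F "(z, w)"] by (auto simp: F inj_on_def)
  have zero: "(\<lambda>i. 0) \<in> Cn 3" by (simp add: Cn_def)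
  have "\<exists>J. has_complex_gradient 3 (\<lambda>w. \<psi> (spray_map (z, w)) j) J (\<lambda>i. 0)" if "j < 2" for j
  proof -
    note C = complex_manifold_complex_space[of 3]
    have 0: "(\<lambda>i. 0) \<in> points (complex_space 3)" using zero by simp
    have "mdiff3 (complex_space 3) (\<lambda>w. spray_map (z, w)) w" if "w \<in> points (complex_space 3)" for w
      using that by (intro mdiff3_spray_map[OF C that])
        (auto simp: mdiff3_def mdiff_const[OF C] mdiff_complex_space hdiff_coordinate hdiff_const)
    moreover have "mdiff complex_3space (\<lambda>y. \<psi> y j) (spray_map (z, (\<lambda>i. 0)))"
      using mdiff_atlas_chart[OF complex_manifold_complex_3space U(1,3)] that by (simp add: spray_map_def)
    ultimately have "mdiff (complex_space 3) (\<lambda>w. \<psi> (spray_map (z, w)) j) (\<lambda>i. 0)"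
      by (intro mdiff_comp_triple[OF C 0, of "\<lambda>w. spray_map (z, w)" "\<lambda>y. \<psi> y j"]) (auto simp: mdiff3_def)
    then show ?thesis using zero by (simp add: mdiff_complex_space hdiff_def)
  qed
  then obtain J where J: "\<And>j. j < 2 \<Longrightarrow> has_complex_gradient 3 (\<lambda>w. \<psi> (spray_map (z, w)) j) (J j) (\<lambda>i. 0)"
    by metis
  have partial: "J j m = d"
    if "j < 2" "m < 3" "((\<lambda>t. \<psi> (spray_map (z, (\<lambda>i. 0)(m := t))) j) has_field_derivative d) (at 0)" for j m d
    using gradient_partial[OF zero J[OF that(1)] that(2)] that(3) DERIV_unique by force
  have surj: "jacobian_map 3 2 J ` Cn 3 = Cn 2"
    by (rule jacobian_map_surj[OF ik])
      (use partial[OF _ ik(1) i0(1)] partial[OF _ ik(1) i1] partial[OF _ ik(2) k0] partial[OF _ ik(2) k1(1)]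
        i0(2) k1(2) in auto)
  have jac: "has_jacobian 3 2 (\<lambda>w. \<psi> (spray_map (inv_into ?F snd w))) J (\<lambda>i. 0)"
    unfolding has_jacobian_def
  proof (intro allI impI)
    fix j :: nat assume j: "j < 2"
    show "has_complex_gradient 3 (\<lambda>w. \<psi> (spray_map (inv_into ?F snd w)) j) (J j) (\<lambda>i. 0)"
      by (subst has_complex_gradient_cong[where g="\<lambda>w. \<psi> (spray_map (z, w)) j"])
        (use J[OF j] inv zero in \<open>auto simp: eventually_at_filter\<close>)
  qed
  have c1: "(?F, snd) \<in> charts (fibre_manifold X spray_bundle z)"
  proof -
    have "z \<in> points X" using z by simp
    then show ?thesis unfolding fibre_manifold_def using trivialisation by (simp only: cmanifold.simps) blast
  qed
  have c2: "(U \<inter> S, \<psi>) \<in> charts X" using U charts_E by (auto simp: surface_eq)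
  show ?thesis unfolding submersion_at_def
    by (intro bexI[OF _ c1] bexI[OF _ c2] case_prodI exI[of _ J] conjI)
      (use jac surj z U(3) zero in \<open>auto simp: fibre_manifold_def F spray_map_def\<close>)
qed

lemma dominating: "dominating_spray X spray_bundle spray_map"
  unfolding dominating_spray_def
proof (intro conjI spray ballI)
  fix z assume "z \<in> points X"
  then have z: "z \<in> S" by simp
  obtain u v x where uvx: "z = (u, v, x)" by (cases z) auto
  have exp: "((\<lambda>t. exp t * c) has_field_derivative c) (at 0)"
    "((\<lambda>t. inverse (exp t) * c) has_field_derivative - c) (at 0)" for c :: complex
    by (auto intro!: derivative_eq_intros simp flip: exp_minus)
  have lin: "((\<lambda>t. c + t * d) has_field_derivative d) (at 0)" "((\<lambda>t. t * d) has_field_derivative d) (at 0)"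
    for c d :: complex
    by (auto intro!: derivative_eq_intros)
  consider "u \<noteq> 0" | "v \<noteq> 0" | "u = 0" "v = 0" by blast
  then show "submersion_at (fibre_manifold X spray_bundle z) X spray_map (fzero spray_bundle z)"
  proof cases
    case 1
    \<comment> \<open>In the coordinates \<open>(u, x)\<close> the torus direction has derivative
      \<open>(u, 0)\<close>, and the shear that fixes \<open>u\<close> has derivative
      \<open>(0, u)\<close>.\<close>
    show ?thesis
      by (rule submersion_atI[OF z chart_u slice_defect, where i=2 and k=0 and a=u and b=u])
        (use 1 in \<open>simp_all add: spray_map_axes[unfolded One_nat_def] shear_v_def torus_action_def uvx exp lin\<close>)
  next
    case 2
    \<comment> \<open>In the coordinates \<open>(v, x)\<close> the torus direction has derivative
      \<open>(-v, 0)\<close>, and the shear that fixes \<open>v\<close> has derivative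
      \<open>(0, v)\<close>.\<close>
    show ?thesis
      by (rule submersion_atI[OF z chart_v slice_defect, where i=2 and k=1 and a="-v" and b=v])
        (use 2 in \<open>simp_all add: spray_map_axes[unfolded One_nat_def] shear_u_def torus_action_def uvx exp lin\<close>)
  next
    case 3
    then have d: "deriv p x \<noteq> 0" using z uvx simple by auto
    then obtain r where r: "r > 0" "inj_on p (ball x r)" by (rule locally_injective)
    \<comment> \<open>The torus generator vanishes here, so both shears are used. As
      \<open>u = v = 0\<close>, they keep \<open>x\<close> and add \<open>t * deriv p x\<close> to
      \<open>u\<close> and to \<open>v\<close> respectively.\<close>
    show ?thesis
      by (rule submersion_atI[OF z chart_0[OF open_ball r(2)] slice_defect, where i=1 and k=0 and a="deriv p x" and b="deriv p x"])
        (use 3 d r(1) in \<open>simp_all add: spray_map_axes[unfolded One_nat_def] shear_u_def shear_v_def uvx lin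
          translation_quotient_0\<close>)
  qed
qed

section \<open>Holomorphy of the actions and equivariance\<close>

lemma holomorphic_torus_action: "holomorphic_action Cstar Cstar_manifold X torus_action"
  unfolding holomorphic_action_def
proof (intro conjI ballI complex_lie_group_Cstar complex_manifold_surface)
  note P = complex_manifold_Cstar complex_manifold_surface
  note M = complex_manifold_product[OF P]
  show "holomorphic_map (product_manifold Cstar_manifold X) X (\<lambda>(t, x). torus_action t x)"
    unfolding split_beta
  proof (rule holomorphic_map_surfaceI[OF M])
    fix y assume y: "y \<in> points (product_manifold Cstar_manifold X)"
    then have y': "fst y \<noteq> 0" "snd y \<in> S" by auto
    then show "torus_action (fst y) (snd y) \<in> S" by (intro torus_action_surface)
    have "mdiff3 (product_manifold Cstar_manifold X) snd y"
      using mdiff3_snd[OF P y mdiff3_surface[OF y'(2)]] .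
    then show "mdiff3 (product_manifold Cstar_manifold X) (\<lambda>y. torus_action (fst y) (snd y)) y"
      using mdiff3_torus_action[OF M y] mdiff_fst[OF P y mdiff_Cstar[OF y'(1)]] y'(1) by blast
  qed
qed (simp_all add: torus_action_mult)

lemma holomorphic_lift_action: "holomorphic_action Cstar Cstar_manifold Tot lift_action"
  unfolding holomorphic_action_def
proof (intro conjI ballI complex_lie_group_Cstar complex_manifold_Tot)
  note P = complex_manifold_Cstar complex_manifold_Tot
  note M = complex_manifold_product[OF P]
  let ?L = "product_manifold Cstar_manifold Tot"
  have hol1: "holomorphic_map ?L X (\<lambda>y. torus_action (fst y) (fst (snd y)))"
  proof (rule holomorphic_map_surfaceI[OF M])
    fix y assume y: "y \<in> points ?L"
    then have y': "fst y \<noteq> 0" "snd y \<in> points Tot" "fst (snd y) \<in> S" by auto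
    then show "torus_action (fst y) (fst (snd y)) \<in> S" by (intro torus_action_surface)
    have "mdiff3 ?L (\<lambda>y. fst (snd y)) y"
      using mdiff3_snd[OF P y mdiff_Tot(1)[OF y'(2)]] .
    then show "mdiff3 ?L (\<lambda>y. torus_action (fst y) (fst (snd y))) y"
      using mdiff3_torus_action[OF M y] mdiff_fst[OF P y mdiff_Cstar[OF y'(1)]] y'(1) by blast
  qed
  have hol2: "holomorphic_map ?L (complex_space 3) (\<lambda>y i. if i = 0 then inverse (fst y) * snd (snd y) 0
      else if i = 1 then fst y * snd (snd y) 1 else snd (snd y) i)"
  proof (rule holomorphic_map_complex_spaceI[OF M])
    fix y assume y: "y \<in> points ?L"
    then have y': "fst y \<noteq> 0" "snd y \<in> points Tot" by auto
    show "(\<lambda>i. if i = 0 then inverse (fst y) * snd (snd y) 0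
      else if i = 1 then fst y * snd (snd y) 1 else snd (snd y) i) \<in> Cn 3"
      using y'(2) by (auto simp: Cn_def)
    fix j :: nat
    have t: "mdiff ?L fst y" using mdiff_fst[OF P y mdiff_Cstar[OF y'(1)]] .
    have w: "mdiff ?L (\<lambda>y. snd (snd y) i) y" for i
      using mdiff_snd[OF P y mdiff_Tot(2)[OF y'(2)]] .
    have "mdiff ?L (\<lambda>y. inverse (fst y) * snd (snd y) 0) y" "mdiff ?L (\<lambda>y. fst y * snd (snd y) 1) y"
      by (intro mdiff_mult[OF M y] mdiff_inverse[OF M y] t w y')+
    then show "mdiff ?L (\<lambda>y. if j = 0 then inverse (fst y) * snd (snd y) 0
      else if j = 1 then fst y * snd (snd y) 1 else snd (snd y) j) y"
      using w[of j] by (cases "j = 0"; cases "j = 1") simp_all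
  qed
  show "holomorphic_map ?L Tot (\<lambda>(t, e). lift_action t e)"
  proof -
    have "(\<lambda>(t, e). lift_action t e) = (\<lambda>y. (torus_action (fst y) (fst (snd y)),
        \<lambda>i. if i = 0 then inverse (fst y) * snd (snd y) 0
          else if i = 1 then fst y * snd (snd y) 1 else snd (snd y) i))"
      by (simp add: fun_eq_iff lift_action_def)
    then show ?thesis
      using holomorphic_map_pair[OF M complex_manifold_surface complex_manifold_complex_space hol1 hol2]
      by simp
  qed
qed (auto simp: lift_action_def torus_action_mult fun_eq_iff)

lemma fst_lift_action [simp]: "fst (lift_action t e) = torus_action t (fst e)"
  by (simp add: lift_action_def split_beta)

text \<open>\<open>shear_equivariant\<close> moves \<open>t\<close> out past both shears, and
  commutativity of the torus moves it past \<open>exp (w 2)\<close>.\<close>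

lemma spray_map_equivariant:
  assumes "t \<noteq> 0"
  shows "spray_map (lift_action t e) = torus_action t (spray_map e)"
  using assms
  by (simp add: spray_map_def lift_action_def split_beta shear_equivariant mult.commute flip: torus_action_mult)

lemma equivariant: "equivariant_spray Cstar Cstar_manifold X torus_action spray_bundle lift_action spray_map"
  unfolding equivariant_spray_def
proof (intro conjI spray holomorphic_torus_action)
  show "holomorphic_action Cstar Cstar_manifold (total spray_bundle) lift_action"
    using holomorphic_lift_action by simp
  show "\<forall>t\<in>carrier Cstar. \<forall>e\<in>points (total spray_bundle).
      bproj spray_bundle (lift_action t e) = torus_action t (bproj spray_bundle e) \<and>
      spray_map (lift_action t e) = torus_action t (spray_map e)"
    by (simp add: spray_map_equivariant)
qed (auto simp: lift_action_def fibre_def fun_eq_iff algebra_simps)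

end

theorem corollary3p8:
  fixes p :: "complex \<Rightarrow> complex"
  assumes "p holomorphic_on UNIV"
    and "\<And>z. p z = 0 \<Longrightarrow> deriv p z \<noteq> 0"
  shows "(\<forall>a\<in>fixed_points Cstar (surface p) torus_action.
            isolated_point (surface p) (fixed_points Cstar (surface p) torus_action) a \<and>
            reduced_fixed_point Cstar (surface p) torus_action a) \<and>
         equivariantly_elliptic Cstar Cstar_manifold (surface p) torus_action"
proof -
  interpret smooth_surface p using assms by unfold_locales
  show ?thesis
    using isolated reduced dominating equivariant by (auto simp: equivariantly_elliptic_def)
qed

end
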